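(* The class of all semi-complete digraphs is a well-quasi-order under minor containment. That is, for every infinite sequence $G_1, G_2, \ldots$ of semi-complete digraphs there exist $j > i \geq 1$ such that $G_i$ is a minor of $G_j$.
   Context: All digraphs are finite (in general loops and parallel edges are allowed); an edge $uv$ has tail $u$ and head $v$. A digraph is simple if it is loopless and there is at most one edge $uv$ for every ordered pair of distinct vertices $u,v$ (so $uv$ and $vu$ may both be edges). A simple digraph $G$ is semi-complete if for all distinct $u,v\in V(G)$ at least one of $uv, vu$ is an edge. A digraph is strongly-connected if it is non-null and has a directed path from $u$ to $v$ for all vertices $u,v$. Minors: a digraph $H$ is a minor of a digraph $G$ if $H$ can be obtained from a subdigraph of $G$ by repeatedly contracting a strongly-connected subdigraph to a vertex. Equivalently, there is a minor mapping from $H$ to $G$, i.e. a mapping $\phi$ defined on $V(H)$ such that: (i) for every $v\in V(H)$, $\phi(v)$ is a non-null strongly-connected subdigraph of $G$; (ii) $\phi(u)$ and $\phi(v)$ are vertex-disjoint for distinct $u,v\in V(H)$; (iii) for all $u,v\in V(H)$ (not necessarily distinct), if there are $k$ edges of $H$ with tail $u$ and head $v$, then there are at least $k$ edges of $G$ with tail in $V(\phi(u))$ and head in $V(\phi(v))$ that are not contained in $E(\phi(x))$ for any $x\in V(H)$. *)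

theory Defs
  imports "Graph_Theory.Digraph_Component" "Graph_Theory.Digraph_Isomorphism"
begin

text \<open>
  Finite digraphs with loops and parallel edges are those satisfying \<^const>\<open>fin_digraph\<close>;
  the locale \<^const>\<open>digraph\<close> adds the absence of loops and of parallel arcs (antiparallel
  arcs remain possible), which is simplicity. The null digraph is allowed throughout.
\<close>

definition semi_complete :: "('a, 'b) pre_digraph \<Rightarrow> bool" where
  "semi_complete G \<longleftrightarrow> digraph G \<and>
    (\<forall>u \<in> verts G. \<forall>v \<in> verts G. u \<noteq> v \<longrightarrow> u \<rightarrow>\<^bsub>G\<^esub> v \<or> v \<rightarrow>\<^bsub>G\<^esub> u)"

text \<open>
  The vertex resulting from the contraction of \<open>S\<close> is represented by some vertex \<open>r\<close> of \<open>S\<close>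
  (the choice is immaterial up to isomorphism). Only the arcs of \<open>S\<close> disappear: any other arc
  between two vertices of \<open>S\<close> becomes a loop at \<open>r\<close>.
\<close>

definition contract :: "('a, 'b) pre_digraph \<Rightarrow> ('a, 'b) pre_digraph \<Rightarrow> 'a \<Rightarrow> ('a, 'b) pre_digraph"
  where
  "contract G S r = \<lparr>
     verts = insert r (verts G - verts S),
     arcs = arcs G - arcs S,
     tail = (\<lambda>e. if tail G e \<in> verts S then r else tail G e),
     head = (\<lambda>e. if head G e \<in> verts S then r else head G e) \<rparr>"

definition contraction_step :: "('a, 'b) pre_digraph \<Rightarrow> ('a, 'b) pre_digraph \<Rightarrow> bool" where
  "contraction_step G G' \<longleftrightarrow>
    (\<exists>S r. subgraph S G \<and> strongly_connected S \<and> r \<in> verts S \<and> G' = contract G S r)"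

definition minor :: "('c, 'd) pre_digraph \<Rightarrow> ('a, 'b) pre_digraph \<Rightarrow> bool" where
  "minor H G \<longleftrightarrow>
    (\<exists>G' K. subgraph G' G \<and> contraction_step\<^sup>*\<^sup>* G' K \<and> digraph_iso H K)"

subsection \<open>Minor mappings\<close>

definition minor_mapping ::
  "('c, 'd) pre_digraph \<Rightarrow> ('a, 'b) pre_digraph \<Rightarrow> ('c \<Rightarrow> ('a, 'b) pre_digraph) \<Rightarrow> bool" where
  "minor_mapping H G \<phi> \<longleftrightarrow>
    (\<forall>v \<in> verts H. subgraph (\<phi> v) G \<and> strongly_connected (\<phi> v)) \<and>
    (\<forall>u \<in> verts H. \<forall>v \<in> verts H. u \<noteq> v \<longrightarrow> verts (\<phi> u) \<inter> verts (\<phi> v) = {}) \<and>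
    (\<forall>u \<in> verts H. \<forall>v \<in> verts H.
       card {e \<in> arcs H. tail H e = u \<and> head H e = v} \<le>
       card {e \<in> arcs G. tail G e \<in> verts (\<phi> u) \<and> head G e \<in> verts (\<phi> v) \<and>
                        (\<forall>x \<in> verts H. e \<notin> arcs (\<phi> x))})"

text \<open>A subdigraph survives a change of the incidence functions away from its own arcs.\<close>

lemma reachable_cong:
  assumes "verts G = verts G'" "arcs G = arcs G'"
    and "\<And>e. e \<in> arcs G \<Longrightarrow> tail G e = tail G' e" "\<And>e. e \<in> arcs G \<Longrightarrow> head G e = head G' e"
  shows "u \<rightarrow>\<^sup>*\<^bsub>G\<^esub> v \<longleftrightarrow> u \<rightarrow>\<^sup>*\<^bsub>G'\<^esub> v"
proof -
  have "arcs_ends G = arcs_ends G'"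
    unfolding arcs_ends_conv using assms by (auto intro!: image_cong)
  then show ?thesis using assms(1) by (simp add: reachable_def)
qed

lemma strongly_connected_cong:
  assumes "verts G = verts G'" "arcs G = arcs G'"
    and "\<And>e. e \<in> arcs G \<Longrightarrow> tail G e = tail G' e" "\<And>e. e \<in> arcs G \<Longrightarrow> head G e = head G' e"
  shows "strongly_connected G \<longleftrightarrow> strongly_connected G'"
  using reachable_cong[OF assms] assms(1) by (simp add: strongly_connected_def)

lemma contract_sel [simp]:
  "verts (contract G S r) = insert r (verts G - verts S)"
  "arcs (contract G S r) = arcs G - arcs S"
  "tail (contract G S r) e = (if tail G e \<in> verts S then r else tail G e)"
  "head (contract G S r) e = (if head G e \<in> verts S then r else head G e)"
  by (simp_all add: contract_def)

lemma wf_digraph_contract: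
  assumes "wf_digraph G"
  shows "wf_digraph (contract G S r)"
proof -
  interpret wf_digraph G by fact
  show ?thesis by unfold_locales auto
qed

lemma fin_digraph_contract:
  assumes "fin_digraph G"
  shows "fin_digraph (contract G S r)"
proof -
  interpret fin_digraph G by fact
  show ?thesis by unfold_locales auto
qed

subsection \<open>From minors to minor mappings\<close>

lemma minor_mapping_iso:
  assumes "digraph_iso H K" "fin_digraph K"
  shows "\<exists>\<phi>. minor_mapping H K \<phi>"
proof -
  interpret K: fin_digraph K by fact
  obtain f where f: "pre_digraph.digraph_isomorphism H f" and K: "K = app_iso f H"
    using assms by (auto simp: digraph_iso_def)
  then have inj: "inj_on (iso_verts f) (verts H)" "inj_on (iso_arcs f) (arcs H)"
    and ends: "\<And>a. a \<in> arcs H \<Longrightarrow> tail K (iso_arcs f a) = iso_verts f (tail H a)"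
       "\<And>a. a \<in> arcs H \<Longrightarrow> head K (iso_arcs f a) = iso_verts f (head H a)"
    and in_K: "\<And>v. v \<in> verts H \<Longrightarrow> iso_verts f v \<in> verts K"
       "\<And>a. a \<in> arcs H \<Longrightarrow> iso_arcs f a \<in> arcs K"
    by (auto simp: pre_digraph.digraph_isomorphism_def)
  define \<phi> where
    "\<phi> v = \<lparr>verts = {iso_verts f v}, arcs = {}, tail = tail K, head = head K\<rparr>" for v
  have wf: "wf_digraph (\<phi> v)" for v
    by unfold_locales (auto simp: \<phi>_def)
  have "subgraph (\<phi> v) K" if "v \<in> verts H" for v
    using in_K(1)[OF that] wf[of v] K.wf_digraph unfolding subgraph_def compatible_def
    by (simp add: \<phi>_def)
  moreover have "strongly_connected (\<phi> v)" for v
    by (auto simp: strongly_connected_def reachable_def \<phi>_def)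
  moreover have "verts (\<phi> u) \<inter> verts (\<phi> v) = {}"
    if "u \<in> verts H" "v \<in> verts H" "u \<noteq> v" for u v
    using that inj(1) by (auto simp: \<phi>_def inj_on_def)
  moreover have "card {e \<in> arcs H. tail H e = u \<and> head H e = v} \<le>
      card {e \<in> arcs K. tail K e \<in> verts (\<phi> u) \<and> head K e \<in> verts (\<phi> v) \<and>
                        (\<forall>x \<in> verts H. e \<notin> arcs (\<phi> x))}" for u v
  proof (rule card_inj_on_le[where f = "iso_arcs f"])
    show "inj_on (iso_arcs f) {e \<in> arcs H. tail H e = u \<and> head H e = v}"
      using inj(2) by (rule inj_on_subset) auto
  qed (auto simp: \<phi>_def ends in_K)
  ultimately show ?thesis unfolding minor_mapping_def by blast
qed

lemma minor_mapping_subgraph: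
  assumes "minor_mapping H G' \<phi>" "subgraph G' G" "fin_digraph G"
  shows "minor_mapping H G \<phi>"
proof -
  interpret fin_digraph G by fact
  have sub: "verts G' \<subseteq> verts G" "arcs G' \<subseteq> arcs G" "tail G' = tail G" "head G' = head G"
    using assms(2) by (auto simp: subgraph_def compatible_def)
  have "subgraph S G" if "subgraph S G'" for S
    using that assms(2) by (auto simp: subgraph_def compatible_def)
  moreover have "card {e \<in> arcs G'. tail G' e \<in> verts (\<phi> u) \<and> head G' e \<in> verts (\<phi> v) \<and>
                        (\<forall>x \<in> verts H. e \<notin> arcs (\<phi> x))} \<le>
     card {e \<in> arcs G. tail G e \<in> verts (\<phi> u) \<and> head G e \<in> verts (\<phi> v) \<and>
                        (\<forall>x \<in> verts H. e \<notin> arcs (\<phi> x))}" for u v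
    by (rule card_mono) (use sub in auto)
  ultimately show ?thesis
    using assms(1) unfolding minor_mapping_def by (meson le_trans)
qed

lemma minor_mapping_contract:
  assumes "minor_mapping H (contract G S r) \<phi>"
    and S: "subgraph S G" "strongly_connected S" "r \<in> verts S" and "fin_digraph G"
  shows "\<exists>\<psi>. minor_mapping H G \<psi>"
proof -
  interpret G: fin_digraph G by fact
  let ?K = "contract G S r"
  define c where "c y = (if y \<in> verts S then r else y)" for y
  have S': "verts S \<subseteq> verts G" "arcs S \<subseteq> arcs G" "tail S = tail G" "head S = head G"
    "wf_digraph S"
    using S(1) by (auto simp: subgraph_def compatible_def)
  have cS: "c y \<in> verts S \<longleftrightarrow> y \<in> verts S" for y
    using S(3) by (auto simp: c_def)
  define \<psi> where "\<psi> x = \<lparr>verts = {y \<in> verts G. c y \<in> verts (\<phi> x)},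
      arcs = arcs (\<phi> x) \<union> (if r \<in> verts (\<phi> x) then arcs S else {}),
      tail = tail G, head = head G\<rparr>" for x
  have \<phi>: "subgraph (\<phi> x) ?K" "strongly_connected (\<phi> x)" if "x \<in> verts H" for x
    using assms(1) that by (auto simp: minor_mapping_def)
  have \<phi>_sub: "verts (\<phi> x) \<subseteq> verts ?K" "arcs (\<phi> x) \<subseteq> arcs G - arcs S" "wf_digraph (\<phi> x)"
     "tail (\<phi> x) e = c (tail G e)" "head (\<phi> x) e = c (head G e)" if "x \<in> verts H" for x e
  proof -
    have "tail (\<phi> x) = tail ?K" "head (\<phi> x) = head ?K"
      using \<phi>(1)[OF that] by (simp_all add: subgraph_def compatible_def)
    then show "tail (\<phi> x) e = c (tail G e)" "head (\<phi> x) e = c (head G e)"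
      by (simp_all add: c_def)
  qed (use \<phi>(1)[OF that] in \<open>simp_all add: subgraph_def\<close>)
  have wf: "wf_digraph (\<psi> x)" if x: "x \<in> verts H" for x
  proof
    interpret P: wf_digraph "\<phi> x" using \<phi>_sub x by blast
    interpret S: wf_digraph S by fact
    fix e assume e: "e \<in> arcs (\<psi> x)"
    show "tail (\<psi> x) e \<in> verts (\<psi> x)" "head (\<psi> x) e \<in> verts (\<psi> x)"
    proof (atomize (full), cases "e \<in> arcs (\<phi> x)")
      case True
      then show "tail (\<psi> x) e \<in> verts (\<psi> x) \<and> head (\<psi> x) e \<in> verts (\<psi> x)"
        using \<phi>_sub[OF x] P.tail_in_verts[OF True] P.head_in_verts[OF True]
        by (auto simp: \<psi>_def)
    next
      case False
      then have *: "r \<in> verts (\<phi> x)" "e \<in> arcs S" using e by (auto simp: \<psi>_def split: if_splits)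
      then show "tail (\<psi> x) e \<in> verts (\<psi> x) \<and> head (\<psi> x) e \<in> verts (\<psi> x)"
        using S.tail_in_verts[OF *(2)] S.head_in_verts[OF *(2)] S' by (auto simp: \<psi>_def c_def)
    qed
  qed
  have sub: "subgraph (\<psi> x) G" if "x \<in> verts H" for x
    using wf[OF that] \<phi>_sub(2)[OF that] S' G.wf_digraph
    unfolding subgraph_def compatible_def by (auto simp: \<psi>_def)
  have reach_base: "a \<rightarrow>\<^sup>*\<^bsub>\<psi> x\<^esub> b"
    if x: "x \<in> verts H" and "a \<in> verts (\<psi> x)" "c a = c b" "b \<in> verts G" for a b x
  proof (cases "a \<in> verts S")
    case True
    then have "c a = r" by (simp add: c_def)
    then have r: "r \<in> verts (\<phi> x)" using that(2) by (simp add: \<psi>_def)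
    have b: "b \<in> verts S" using True cS that(3) by metis
    have "subgraph S (\<psi> x)"
      unfolding subgraph_def compatible_def
    proof (intro conjI)
      show "verts S \<subseteq> verts (\<psi> x)" using S'(1) r by (auto simp: \<psi>_def c_def)
    qed (use S' r wf[OF x] in \<open>simp_all add: \<psi>_def\<close>)
    moreover have "a \<rightarrow>\<^sup>*\<^bsub>S\<^esub> b" using S(2) True b by (simp add: strongly_connected_def)
    ultimately show ?thesis by (metis pre_digraph.reachable_mono)
  next
    case False
    then have "b \<notin> verts S" using cS that(3) by metis
    then have "a = b" using False that(3) by (simp add: c_def)
    then show ?thesis using that by (auto simp: reachable_def)
  qed
  have reach: "a \<rightarrow>\<^sup>*\<^bsub>\<psi> x\<^esub> b"
    if x: "x \<in> verts H" and pq: "p \<rightarrow>\<^sup>*\<^bsub>\<phi> x\<^esub> q"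
      and ab: "a \<in> verts (\<psi> x)" "b \<in> verts (\<psi> x)" "c a = p" "c b = q" for a b p q x
  proof -
    interpret P: wf_digraph "\<phi> x" using \<phi>_sub x by blast
    interpret Q: wf_digraph "\<psi> x" by (rule wf) fact
    from pq ab show ?thesis
    proof (induction arbitrary: b rule: P.reachable_induct)
      case base
      then show ?case using reach_base[OF x, of a b] by (auto simp: \<psi>_def)
    next
      case (step p' q)
      obtain e where e: "e \<in> arcs (\<phi> x)" "c (tail G e) = p'" "c (head G e) = q"
        using step.hyps(2) \<phi>_sub[OF x] by (metis reachableE)
      then have e': "e \<in> arcs (\<psi> x)" by (simp add: \<psi>_def)
      have "a \<rightarrow>\<^sup>*\<^bsub>\<psi> x\<^esub> tail (\<psi> x) e"
        using step.IH[of "tail (\<psi> x) e"] Q.tail_in_verts[OF e'] step.prems e(2)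
        by (simp add: \<psi>_def)
      also have "tail (\<psi> x) e \<rightarrow>\<^bsub>\<psi> x\<^esub> head (\<psi> x) e"
        using e' by (auto simp: arcs_ends_conv)
      also have "head (\<psi> x) e \<rightarrow>\<^sup>*\<^bsub>\<psi> x\<^esub> b"
        using reach_base[OF x Q.head_in_verts[OF e'], of b] step.prems e(3)
        by (simp add: \<psi>_def)
      finally show ?case .
    qed
  qed
  have "strongly_connected (\<psi> x)" if x: "x \<in> verts H" for x
  proof
    obtain p where p: "p \<in> verts (\<phi> x)" using \<phi>(2)[OF x] by (auto simp: strongly_connected_def)
    have "p \<in> verts G" "c p = p"
      using \<phi>_sub(1)[OF x] p S(3) S'(1) by (auto simp: c_def)
    then show "verts (\<psi> x) \<noteq> {}" using p by (auto simp: \<psi>_def)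
  next
    fix a b assume ab: "a \<in> verts (\<psi> x)" "b \<in> verts (\<psi> x)"
    then have "c a \<in> verts (\<phi> x)" "c b \<in> verts (\<phi> x)" by (auto simp: \<psi>_def)
    then have "c a \<rightarrow>\<^sup>*\<^bsub>\<phi> x\<^esub> c b" using \<phi>(2)[OF x] by (auto simp: strongly_connected_def)
    then show "a \<rightarrow>\<^sup>*\<^bsub>\<psi> x\<^esub> b" using reach[OF x] ab by blast
  qed
  moreover have "verts (\<psi> u) \<inter> verts (\<psi> v) = {}"
    if "u \<in> verts H" "v \<in> verts H" "u \<noteq> v" for u v
  proof -
    have "verts (\<phi> u) \<inter> verts (\<phi> v) = {}"
      using assms(1) that unfolding minor_mapping_def by blast
    then show ?thesis by (auto simp: \<psi>_def)
  qed
  moreover have "card {e \<in> arcs H. tail H e = u \<and> head H e = v} \<le>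
      card {e \<in> arcs G. tail G e \<in> verts (\<psi> u) \<and> head G e \<in> verts (\<psi> v) \<and>
                        (\<forall>x \<in> verts H. e \<notin> arcs (\<psi> x))}" (is "_ \<le> card ?R")
    if "u \<in> verts H" "v \<in> verts H" for u v
  proof -
    have "card {e \<in> arcs H. tail H e = u \<and> head H e = v} \<le>
      card {e \<in> arcs ?K. tail ?K e \<in> verts (\<phi> u) \<and> head ?K e \<in> verts (\<phi> v) \<and>
                        (\<forall>x \<in> verts H. e \<notin> arcs (\<phi> x))}" (is "_ \<le> card ?L")
      using assms(1) that unfolding minor_mapping_def by blast
    also have "?L \<subseteq> ?R" by (auto simp: \<psi>_def c_def)
    then have "card ?L \<le> card ?R" by (rule card_mono[rotated]) simp
    finally show ?thesis .
  qed
  ultimately show ?thesis using sub unfolding minor_mapping_def by blast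
qed

lemma minor_imp_minor_mapping:
  assumes "minor H G" "fin_digraph G"
  shows "\<exists>\<phi>. minor_mapping H G \<phi>"
proof -
  obtain G' K where sub: "subgraph G' G" and contr: "contraction_step\<^sup>*\<^sup>* G' K"
    and iso: "digraph_iso H K"
    using assms(1) by (auto simp: minor_def)
  have "fin_digraph G'"
    using sub assms(2) by (metis fin_digraph.fin_digraph_subgraph)
  with contr have "\<exists>\<phi>. minor_mapping H G' \<phi>"
  proof (induction rule: converse_rtranclp_induct)
    case base
    then show ?case using minor_mapping_iso[OF iso] by blast
  next
    case (step X Y)
    then show ?case
      using minor_mapping_contract fin_digraph_contract unfolding contraction_step_def by metis
  qed
  then show ?thesis using minor_mapping_subgraph sub assms(2) by blast
qed

subsection \<open>From minor mappings to minors\<close>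

definition collapse :: "('c \<Rightarrow> ('a, 'b) pre_digraph) \<Rightarrow> ('c \<Rightarrow> 'a) \<Rightarrow> 'c set \<Rightarrow> 'a \<Rightarrow> 'a" where
  "collapse \<phi> r W y =
    (if \<exists>w\<in>W. y \<in> verts (\<phi> w) then r (THE w. w \<in> W \<and> y \<in> verts (\<phi> w)) else y)"

lemma collapse_eq:
  assumes "v \<in> W" "y \<in> verts (\<phi> v)" "\<And>u. u \<in> W \<Longrightarrow> y \<in> verts (\<phi> u) \<Longrightarrow> u = v"
  shows "collapse \<phi> r W y = r v"
proof -
  have "(THE w. w \<in> W \<and> y \<in> verts (\<phi> w)) = v"
    by (rule the_equality) (use assms in blast)+
  then show ?thesis using assms(1,2) by (auto simp: collapse_def)
qed

lemma contract_family:
  fixes \<phi> :: "'c \<Rightarrow> ('a, 'b) pre_digraph"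
  assumes "wf_digraph G" "finite W"
    and sub: "\<And>w. w \<in> W \<Longrightarrow> subgraph (\<phi> w) G \<and> strongly_connected (\<phi> w) \<and> r w \<in> verts (\<phi> w)"
    and disj: "\<And>u v. u \<in> W \<Longrightarrow> v \<in> W \<Longrightarrow> u \<noteq> v \<Longrightarrow> verts (\<phi> u) \<inter> verts (\<phi> v) = {}"
  shows "contraction_step\<^sup>*\<^sup>* G \<lparr>verts = collapse \<phi> r W ` verts G,
       arcs = arcs G - (\<Union>w\<in>W. arcs (\<phi> w)),
       tail = (\<lambda>e. collapse \<phi> r W (tail G e)), head = (\<lambda>e. collapse \<phi> r W (head G e))\<rparr>"
    (is "contraction_step\<^sup>*\<^sup>* G (?K W)")
  using assms(2) sub disj
proof (induction W rule: finite_induct)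
  case empty
  have "collapse \<phi> r {} = (\<lambda>y. y)" by (auto simp: collapse_def)
  then have "?K {} = G" by simp
  then show ?case by simp
next
  case (insert w W)
  interpret G: wf_digraph G by fact
  have sub: "verts (\<phi> v) \<subseteq> verts G" "arcs (\<phi> v) \<subseteq> arcs G" "tail (\<phi> v) = tail G"
    "head (\<phi> v) = head G" "wf_digraph (\<phi> v)" "strongly_connected (\<phi> v)" "r v \<in> verts (\<phi> v)"
    if "v \<in> insert w W" for v
    using insert.prems(1)[OF that] by (auto simp: subgraph_def compatible_def)
  have in_W: "collapse \<phi> r X y = r v" if "v \<in> X" "X \<subseteq> insert w W" "y \<in> verts (\<phi> v)" for v y X
  proof (rule collapse_eq[where v = v])
    fix u assume "u \<in> X" "y \<in> verts (\<phi> u)"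
    then show "u = v" using that insert.prems(2)[of u v] by blast
  qed (use that in auto)
  have out_W: "collapse \<phi> r X y = y" if "\<And>v. v \<in> X \<Longrightarrow> y \<notin> verts (\<phi> v)" for X y
    using that by (auto simp: collapse_def)
  have disj: "y \<notin> verts (\<phi> v)" if "y \<in> verts (\<phi> w)" "v \<in> W" for y v
    using that insert.prems(2)[of w v] insert.hyps(2) by blast
  have fix_w: "collapse \<phi> r W y = y" if "y \<in> verts (\<phi> w)" for y
    using out_W disj that by blast
  have col: "collapse \<phi> r (insert w W) y =
      (if collapse \<phi> r W y \<in> verts (\<phi> w) then r w else collapse \<phi> r W y)" for y
  proof (cases "\<exists>v\<in>W. y \<in> verts (\<phi> v)")
    case True
    then obtain v where v: "v \<in> W" "y \<in> verts (\<phi> v)" by blast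
    then have "collapse \<phi> r W y = r v" "collapse \<phi> r (insert w W) y = r v"
      using in_W[of v] by blast+
    moreover have "r v \<notin> verts (\<phi> w)" using disj sub(7)[of v] v(1) by blast
    ultimately show ?thesis by simp
  next
    case False
    then have "collapse \<phi> r W y = y" using out_W by blast
    then show ?thesis using False in_W[of w "insert w W"] out_W[of "insert w W"] by auto
  qed
  define S where "S = \<phi> w\<lparr>tail := tail (?K W), head := head (?K W)\<rparr>"
  have vertsS: "verts S = verts (\<phi> w)" "arcs S = arcs (\<phi> w)" by (simp_all add: S_def)
  have endsS: "tail S e = collapse \<phi> r W (tail G e)" "head S e = collapse \<phi> r W (head G e)" for e
    by (simp_all add: S_def)
  interpret P: wf_digraph "\<phi> w" using sub(5)[of w] by simp
  have in_w: "tail G e \<in> verts (\<phi> w)" "head G e \<in> verts (\<phi> w)" if "e \<in> arcs (\<phi> w)" for e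
    using P.tail_in_verts[OF that] P.head_in_verts[OF that] sub(3,4)[of w] by simp_all
  have ends: "tail (\<phi> w) e = tail S e" "head (\<phi> w) e = head S e" if "e \<in> arcs (\<phi> w)" for e
    using in_w[OF that] fix_w sub(3,4)[of w] by (simp_all add: endsS)
  have wfS: "wf_digraph S"
  proof
    fix e assume e: "e \<in> arcs S"
    then show "tail S e \<in> verts S" "head S e \<in> verts S"
      using in_w[of e] fix_w by (simp_all add: vertsS endsS)
  qed
  have "strongly_connected (\<phi> w) \<longleftrightarrow> strongly_connected S"
    by (rule strongly_connected_cong) (simp_all only: vertsS ends)
  then have scS: "strongly_connected S" using sub(6) by blast
  have wfK: "wf_digraph (?K W)" by unfold_locales auto
  have "arcs (\<phi> w) \<inter> arcs (\<phi> v) = {}" if "v \<in> W" for v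
  proof -
    interpret Q: wf_digraph "\<phi> v" using sub(5)[of v] that by simp
    have "tail G e \<in> verts (\<phi> w) \<inter> verts (\<phi> v)" if "e \<in> arcs (\<phi> w) \<inter> arcs (\<phi> v)" for e
      using that in_w(1)[of e] Q.tail_in_verts[of e] sub(3)[of v] \<open>v \<in> W\<close> by simp
    then show ?thesis using disj that by blast
  qed
  moreover have "verts (\<phi> w) \<subseteq> collapse \<phi> r W ` verts G"
  proof
    fix y assume "y \<in> verts (\<phi> w)"
    then show "y \<in> collapse \<phi> r W ` verts G"
      using fix_w[of y] sub(1)[of w] by (metis imageI insertI1 subsetD)
  qed
  ultimately have subS: "subgraph S (?K W)"
    using sub(2)[of w] wfS wfK unfolding subgraph_def compatible_def
    by (auto simp: vertsS endsS fun_eq_iff)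
  have "collapse \<phi> r (insert w W) ` verts G =
      insert (r w) (collapse \<phi> r W ` verts G - verts (\<phi> w))" (is "?L = ?R")
  proof (rule set_eqI)
    fix y
    have "r w \<in> verts G" "collapse \<phi> r W (r w) = r w" "r w \<in> verts (\<phi> w)"
      using sub(1,7)[of w] fix_w by auto
    then have "r w \<in> ?L" by (metis col imageI)
    then show "y \<in> ?L \<longleftrightarrow> y \<in> ?R" by (auto simp: col)
  qed
  then have "?K (insert w W) = contract (?K W) S (r w)"
    by (auto simp: contract_def vertsS col)
  then have "contraction_step (?K W) (?K (insert w W))"
    unfolding contraction_step_def using subS scS sub(7)[of w] vertsS by auto
  moreover have "contraction_step\<^sup>*\<^sup>* G (?K W)"
    using insert.IH insert.prems by blast
  ultimately show ?case by (rule rtranclp.rtrancl_into_rtrancl[rotated])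
qed

lemma minor_mapping_imp_minor:
  assumes "minor_mapping H G \<phi>" "fin_digraph G" "fin_digraph H"
  shows "minor H G"
proof -
  interpret G: fin_digraph G by fact
  interpret H: fin_digraph H by fact
  let ?V = "verts H"
  have \<phi>: "subgraph (\<phi> v) G" "strongly_connected (\<phi> v)" if "v \<in> ?V" for v
    using assms(1) that by (auto simp: minor_mapping_def)
  have disj: "u = v" if "u \<in> ?V" "v \<in> ?V" "y \<in> verts (\<phi> u)" "y \<in> verts (\<phi> v)" for u v y
  proof (rule ccontr)
    assume "u \<noteq> v"
    then have "verts (\<phi> u) \<inter> verts (\<phi> v) = {}"
      using assms(1) that(1,2) unfolding minor_mapping_def by blast
    then show False using that(3,4) by blast
  qed
  have sub: "verts (\<phi> v) \<subseteq> verts G" "arcs (\<phi> v) \<subseteq> arcs G" "tail (\<phi> v) = tail G"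
    "head (\<phi> v) = head G" "wf_digraph (\<phi> v)" if "v \<in> ?V" for v
    using \<phi>[OF that] by (simp_all add: subgraph_def compatible_def)
  define L where "L u v = {e \<in> arcs H. tail H e = u \<and> head H e = v}" for u v
  define R where "R u v = {e \<in> arcs G. tail G e \<in> verts (\<phi> u) \<and> head G e \<in> verts (\<phi> v) \<and>
                        (\<forall>x \<in> verts H. e \<notin> arcs (\<phi> x))}" for u v
  have "\<exists>f. f ` L u v \<subseteq> R u v \<and> inj_on f (L u v)" if "u \<in> ?V" "v \<in> ?V" for u v
  proof (rule card_le_inj)
    show "finite (L u v)" "finite (R u v)" by (auto simp: L_def R_def)
    show "card (L u v) \<le> card (R u v)"
      using assms(1) that unfolding minor_mapping_def L_def R_def by blast
  qed
  then obtain F where F: "\<And>u v. u \<in> ?V \<Longrightarrow> v \<in> ?V \<Longrightarrow> F u v ` L u v \<subseteq> R u v \<and> inj_on (F u v) (L u v)"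
    by metis
  define f where "f e = F (tail H e) (head H e) e" for e
  have f: "f e \<in> R (tail H e) (head H e)" if "e \<in> arcs H" for e
    using F[of "tail H e" "head H e"] that by (auto simp: f_def L_def)
  have inj_f: "inj_on f (arcs H)"
  proof (rule inj_onI)
    fix a b assume ab: "a \<in> arcs H" "b \<in> arcs H" "f a = f b"
    have "tail H a = tail H b" "head H a = head H b"
      using f[OF ab(1)] f[OF ab(2)] ab disj by (auto simp: R_def)
    then show "a = b"
      using F[of "tail H a" "head H a"] ab by (auto simp: f_def L_def inj_on_def)
  qed
  define r where "r v = (SOME y. y \<in> verts (\<phi> v))" for v
  have r: "r v \<in> verts (\<phi> v)" if "v \<in> ?V" for v
    using \<phi>(2)[OF that] unfolding r_def strongly_connected_def by (simp add: some_in_eq)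
  define G' where "G' = \<lparr>verts = (\<Union>v\<in>?V. verts (\<phi> v)), arcs = f ` arcs H \<union> (\<Union>v\<in>?V. arcs (\<phi> v)),
      tail = tail G, head = head G\<rparr>"
  have wfG': "wf_digraph G'"
  proof
    fix e assume e: "e \<in> arcs G'"
    show "tail G' e \<in> verts G'" "head G' e \<in> verts G'"
    proof (atomize (full), cases "e \<in> f ` arcs H")
      case True
      then show "tail G' e \<in> verts G' \<and> head G' e \<in> verts G'"
        using f by (fastforce simp: G'_def R_def)
    next
      case False
      then obtain v where v: "v \<in> ?V" "e \<in> arcs (\<phi> v)" using e by (auto simp: G'_def)
      interpret P: wf_digraph "\<phi> v" using sub v by blast
      show "tail G' e \<in> verts G' \<and> head G' e \<in> verts G'"
        using P.tail_in_verts[OF v(2)] P.head_in_verts[OF v(2)] sub(3,4)[OF v(1)] v(1)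
        by (auto simp: G'_def)
    qed
  qed
  have subG': "subgraph G' G"
    unfolding subgraph_def compatible_def
    using wfG' G.wf_digraph sub(1,2) f by (auto simp: G'_def R_def)
  have sub': "subgraph (\<phi> v) G'" if "v \<in> ?V" for v
    unfolding subgraph_def compatible_def
    using wfG' sub[OF that] that by (auto simp: G'_def)
  let ?c = "collapse \<phi> r ?V"
  let ?K = "\<lparr>verts = ?c ` verts G', arcs = arcs G' - (\<Union>v\<in>?V. arcs (\<phi> v)),
       tail = (\<lambda>e. ?c (tail G' e)), head = (\<lambda>e. ?c (head G' e))\<rparr>"
  have contr: "contraction_step\<^sup>*\<^sup>* G' ?K"
  proof (rule contract_family)
    show "verts (\<phi> u) \<inter> verts (\<phi> v) = {}" if "u \<in> ?V" "v \<in> ?V" "u \<noteq> v" for u v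
      using that disj by blast
  qed (use wfG' sub' \<phi>(2) r in auto)
  have c: "?c y = r v" if "v \<in> ?V" "y \<in> verts (\<phi> v)" for v y
    by (rule collapse_eq[where v = v]) (use that disj in blast)+
  define iso where "iso = \<lparr>iso_verts = r, iso_arcs = f, iso_head = head ?K, iso_tail = tail ?K\<rparr>"
  have "H.digraph_isomorphism iso"
    unfolding H.digraph_isomorphism_def
  proof (intro conjI ballI)
    show "wf_digraph H" by (rule H.wf_digraph)
    show "inj_on (iso_verts iso) ?V"
      by (rule inj_onI) (use r disj in \<open>metis digraph_isomorphism.select_convs(1) iso_def\<close>)
    show "inj_on (iso_arcs iso) (arcs H)" using inj_f by (simp add: iso_def)
    fix a assume a: "a \<in> arcs H"
    show "iso_verts iso (tail H a) = iso_tail iso (iso_arcs iso a)"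
      using f[OF a] c[of "tail H a"] H.tail_in_verts[OF a] by (auto simp: iso_def R_def G'_def)
    show "iso_verts iso (head H a) = iso_head iso (iso_arcs iso a)"
      using f[OF a] c[of "head H a"] H.head_in_verts[OF a] by (auto simp: iso_def R_def G'_def)
  qed
  moreover have "?K = app_iso iso H"
  proof -
    have "?c ` verts G' = r ` ?V"
    proof
      show "?c ` verts G' \<subseteq> r ` ?V" using c by (auto simp: G'_def)
      show "r ` ?V \<subseteq> ?c ` verts G'"
      proof
        fix y assume "y \<in> r ` ?V"
        then obtain v where v: "v \<in> ?V" "y = r v" by blast
        then have "r v \<in> verts G'" "?c (r v) = r v" using r c by (auto simp: G'_def)
        then show "y \<in> ?c ` verts G'" using v by (metis imageI)
      qed
    qed
    moreover have "arcs G' - (\<Union>v\<in>?V. arcs (\<phi> v)) = f ` arcs H"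
      using f by (auto simp: G'_def R_def)
    ultimately show ?thesis by (simp add: app_iso_def iso_def)
  qed
  ultimately have "digraph_iso H ?K" unfolding digraph_iso_def by blast
  then show ?thesis unfolding minor_def using subG' contr by blast
qed

theorem minor_iff_minor_mapping:
  assumes "fin_digraph H" "fin_digraph G"
  shows "minor H G \<longleftrightarrow> (\<exists>\<phi>. minor_mapping H G \<phi>)"
  using assms minor_imp_minor_mapping minor_mapping_imp_minor by blast

end

theory Submission
  imports Defs "HOL-Library.Ramsey" "HOL-Library.Sublist"
begin

text \<open>
  If the first digraph, on \<open>h\<close> vertices, is not a minor of any later one, then no later digraph has a
  complete minor on \<open>h\<close> vertices. In a semi-complete digraph, a vertex \<open>u\<close> of much larger out-degree
  than \<open>v\<close> has many paths of length two to \<open>v\<close>. Hence many vertices of similar out-degree, or a large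
  matching from vertices of small to vertices of large out-degree, produce a complete minor. If neither
  occurs, then cutting along the out-degree yields a directed path decomposition of bounded width.

  For bounded width, one decomposes along the separations of smallest order \<open>m\<close>, so that the pieces
  between consecutive ones only have separations of larger order, and argues by downward induction on
  \<open>m\<close>. Menger's theorem and uncrossing provide \<open>m\<close> disjoint threads through all separations of order
  \<open>m\<close>. Higman's lemma embeds one sequence of pieces into another, and skipped pieces are bridged by
  contracting segments of threads. A segment of an induced path is strongly connected unless it has
  length one, since all its chords point backwards; colouring the positions on a thread by their
  parity excludes that length.
\<close>

section \<open>Almost full relations\<close>

text \<open>Directed separations let semi-completeness pay twice. No edge leads from the first
  strict side to the second, so all edges lead back. Two minor maps that agree on the adhesion set
  therefore glue: an edge of the smaller digraph between the strict sides can only run backwards,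
  and there the larger digraph has every edge. Nothing beyond the ordered adhesion set has to be
  passed between neighbouring pieces; the root lists record it.

  Orders are raised one at a time because bridging a skipped part of the host takes as many disjoint
  paths as an adhesion set has vertices. Menger's theorem supplies them only if no smaller
  separation lies in between, which holds once the smaller orders have been cut away. In a chain of
  width \<open>k\<close> every separation has order at most \<open>k\<close>. So a piece whose inner
  separations all have order above \<open>k\<close> is a single bag, and up to isomorphism there are
  finitely many of those.\<close>

definition af_on :: "('a \<Rightarrow> 'a \<Rightarrow> bool) \<Rightarrow> 'a set \<Rightarrow> bool" where
  "af_on P A \<longleftrightarrow> (\<forall>f::nat \<Rightarrow> 'a. (\<forall>i. f i \<in> A) \<longrightarrow> (\<exists>i j. i < j \<and> P (f i) (f j)))"

lemma af_onI:
  assumes "\<And>f::nat \<Rightarrow> 'a. (\<And>i. f i \<in> A) \<Longrightarrow> \<exists>i j. i < j \<and> P (f i) (f j)"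
  shows "af_on P A"
  using assms by (auto simp: af_on_def)

lemma af_onD:
  assumes "af_on P A" "\<And>i::nat. f i \<in> A"
  shows "\<exists>i j. i < j \<and> P (f i) (f j)"
  using assms by (auto simp: af_on_def)

text \<open>Ramsey's theorem for pairs gives a homogeneous subsequence. Its colour cannot be the bad
  one, since the subsequence itself contains a good pair.\<close>

lemma af_on_subseq:
  fixes f :: "nat \<Rightarrow> 'a"
  assumes "af_on P A" "\<And>i. f i \<in> A"
  shows "\<exists>r. strict_mono (r :: nat \<Rightarrow> nat) \<and> (\<forall>i j. i < j \<longrightarrow> P (f (r i)) (f (r j)))"
proof -
  define c where "c X = (if P (f (Min X)) (f (Max X)) then 0 else 1 :: nat)" for X
  have "\<exists>Y t. Y \<subseteq> (UNIV::nat set) \<and> infinite Y \<and> t < 2 \<and> (\<forall>x\<in>Y. \<forall>y\<in>Y. x \<noteq> y \<longrightarrow> c {x, y} = t)"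
    by (rule Ramsey2) (auto simp: c_def)
  then obtain Y t where Y: "infinite Y" "\<forall>x\<in>Y. \<forall>y\<in>Y. x \<noteq> y \<longrightarrow> c {x, y} = t"
    by (elim exE conjE)
  define r where "r = enumerate Y"
  have r: "strict_mono r" "\<And>i. r i \<in> Y"
    using Y(1) by (auto simp: r_def strict_mono_enumerate enumerate_in_set)
  have c: "c {r i, r j} = (if P (f (r i)) (f (r j)) then 0 else 1)" if "i < j" for i j
  proof -
    have "r i < r j" using r(1) that by (simp add: strict_mono_def)
    then show ?thesis by (simp add: c_def min_def max_def)
  qed
  have t: "c {r i, r j} = t" if "i < j" for i j
    using Y(2) r that by (simp add: strict_mono_eq)
  obtain i j where "i < j" "P (f (r i)) (f (r j))"
    using af_onD[OF assms(1), of "\<lambda>i. f (r i)"] assms(2) by blast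
  then have "t = 0" using c t by (metis (full_types))
  then show ?thesis using r(1) c t by (metis zero_neq_one)
qed

lemma af_on_mono:
  assumes "af_on P A" "B \<subseteq> A"
  shows "af_on P B"
  using assms unfolding af_on_def by blast

text \<open>Codes are related to elements instead of computed from them, because a decomposition
  involves arbitrary choices of separations, paths and orderings.\<close>

lemma af_on_coding:
  assumes "af_on Q B" "\<And>x. x \<in> A \<Longrightarrow> \<exists>y\<in>B. R x y"
    and "\<And>x y x' y'. x \<in> A \<Longrightarrow> x' \<in> A \<Longrightarrow> R x y \<Longrightarrow> R x' y' \<Longrightarrow> Q y y' \<Longrightarrow> P x x'"
  shows "af_on P A"
proof (rule af_onI)
  fix f :: "nat \<Rightarrow> 'b"
  assume f: "\<And>i. f i \<in> A"
  then have "\<forall>i. \<exists>y. y \<in> B \<and> R (f i) y" using assms(2) by blast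
  then obtain g where g: "\<And>i. g i \<in> B \<and> R (f i) (g i)" by metis
  then show "\<exists>i j. i < j \<and> P (f i) (f j)"
    using af_onD[OF assms(1), of g] assms(3) f by metis
qed

lemma af_on_times:
  assumes "af_on P A" "af_on Q B"
  shows "af_on (\<lambda>x y. P (fst x) (fst y) \<and> Q (snd x) (snd y)) (A \<times> B)"
proof (rule af_onI)
  fix f :: "nat \<Rightarrow> 'a \<times> 'b"
  assume f: "\<And>i. f i \<in> A \<times> B"
  then have f': "fst (f i) \<in> A" "snd (f i) \<in> B" for i by (auto simp: mem_Times_iff)
  obtain r where r: "strict_mono (r :: nat \<Rightarrow> nat)"
    "\<And>i j. i < j \<Longrightarrow> P (fst (f (r i))) (fst (f (r j)))"
    using af_on_subseq[OF assms(1), of "\<lambda>i. fst (f i)"] f' by blast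
  obtain i j where "i < j" "Q (snd (f (r i))) (snd (f (r j)))"
    using af_onD[OF assms(2), of "\<lambda>i. snd (f (r i))"] f' by blast
  moreover from this(1) have "r i < r j" using r(1) by (simp add: strict_mono_less)
  ultimately show "\<exists>i j. i < j \<and> P (fst (f i)) (fst (f j)) \<and> Q (snd (f i)) (snd (f j))"
    using r(2) by blast
qed

lemma infinite_strict_mono:
  fixes S :: "nat set"
  assumes "infinite S"
  shows "\<exists>r::nat \<Rightarrow> nat. strict_mono r \<and> (\<forall>i. r i \<in> S)"
  using assms by (intro exI[of _ "enumerate S"]) (simp add: strict_mono_enumerate enumerate_in_set)

lemma af_on_Un:
  assumes "af_on P A" "af_on P B"
  shows "af_on P (A \<union> B)"
proof (rule af_onI)
  fix f :: "nat \<Rightarrow> 'a"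
  assume f: "\<And>i. f i \<in> A \<union> B"
  have "UNIV = {i. f i \<in> A} \<union> {i. f i \<in> B}" using f by auto
  then have "infinite {i. f i \<in> A} \<or> infinite {i. f i \<in> B}"
    by (metis finite_Un infinite_UNIV_nat)
  then obtain C where C: "infinite {i. f i \<in> C}" "af_on P C" using assms by blast
  then obtain r where r: "strict_mono (r :: nat \<Rightarrow> nat)" "\<And>i. f (r i) \<in> C"
    using infinite_strict_mono by blast
  obtain i j where "i < j" "P (f (r i)) (f (r j))"
    using af_onD[OF C(2), of "\<lambda>i. f (r i)"] r(2) by blast
  moreover from this(1) have "r i < r j" using r(1) by (simp add: strict_mono_less)
  ultimately show "\<exists>i j. i < j \<and> P (f i) (f j)" by blast
qed

lemma af_on_finite_eq:
  assumes "finite A"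
  shows "af_on (=) A"
proof (rule af_onI)
  fix f :: "nat \<Rightarrow> 'a"
  assume "\<And>i. f i \<in> A"
  then have "range f \<subseteq> A" by auto
  then have "finite (range f)" using assms by (rule finite_subset)
  then have "\<not> inj f" using range_inj_infinite by auto
  then show "\<exists>i j. i < j \<and> f i = f j"
    unfolding inj_def by (metis linorder_neqE_nat)
qed

section \<open>Higman's lemma\<close>

text \<open>Prefixes of infinite bad sequences, the states of the Nash-Williams
  construction.\<close>

definition bad_from :: "('a \<Rightarrow> 'a \<Rightarrow> bool) \<Rightarrow> 'a set \<Rightarrow> 'a list \<Rightarrow> bool" where
  "bad_from P A xs \<longleftrightarrow> (\<exists>f::nat \<Rightarrow> 'a. (\<forall>i. f i \<in> A) \<and> (\<forall>i j. i < j \<longrightarrow> \<not> P (f i) (f j)) \<and>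
     xs = map f [0..<length xs])"

text \<open>Each prefix is extended by an entry of least measure among those that keep it
  extendable. A bad sequence that agrees with the result below \<open>n\<close> has its
  \<open>n\<close>-th entry among these candidates.\<close>

lemma minimal_bad_sequence:
  fixes m :: "'a \<Rightarrow> nat"
  assumes "\<not> af_on P A"
  shows "\<exists>f::nat \<Rightarrow> 'a. (\<forall>i. f i \<in> A) \<and> (\<forall>i j. i < j \<longrightarrow> \<not> P (f i) (f j)) \<and>
    (\<forall>n (g::nat \<Rightarrow> 'a). (\<forall>i. g i \<in> A) \<longrightarrow> (\<forall>i<n. g i = f i) \<longrightarrow> m (g n) < m (f n) \<longrightarrow>
       (\<exists>i j. i < j \<and> P (g i) (g j)))"
proof -
  have bad0: "bad_from P A []"
    using assms by (auto simp: bad_from_def af_on_def)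
  have ext: "\<exists>x. bad_from P A (xs @ [x])" if "bad_from P A xs" for xs
  proof -
    obtain f :: "nat \<Rightarrow> 'a" where f: "\<forall>i. f i \<in> A" "\<forall>i j. i < j \<longrightarrow> \<not> P (f i) (f j)"
      "xs = map f [0..<length xs]"
      using \<open>bad_from P A xs\<close> unfolding bad_from_def by blast
    then have "xs @ [f (length xs)] = map f [0..<length (xs @ [f (length xs)])]" by simp
    then show ?thesis using f(1,2) unfolding bad_from_def by blast
  qed
  define nx where "nx xs = (ARG_MIN m x. bad_from P A (xs @ [x]))" for xs
  have nx: "bad_from P A (xs @ [nx xs])" "\<And>y. bad_from P A (xs @ [y]) \<Longrightarrow> m (nx xs) \<le> m y"
    if "bad_from P A xs" for xs
    using ext[OF that] unfolding nx_def by (metis arg_min_natI, metis arg_min_nat_le)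
  define s where "s = rec_nat [] (\<lambda>_ xs. xs @ [nx xs])"
  have s: "s 0 = []" "\<And>n. s (Suc n) = s n @ [nx (s n)]" by (simp_all add: s_def)
  have len: "length (s n) = n" for n by (induction n) (auto simp: s)
  have bad: "bad_from P A (s n)" for n by (induction n) (auto simp: s bad0 nx)
  define f where "f n = nx (s n)" for n
  have sf: "s n = map f [0..<n]" for n by (induction n) (auto simp: s f_def)
  have P: "f i \<in> A \<and> f j \<in> A \<and> \<not> P (f i) (f j)" if "i < j" for i j
  proof -
    obtain g where g: "\<And>i. g i \<in> A" "\<And>i j. i < j \<Longrightarrow> \<not> P (g i) (g j)" "s (Suc j) = map g [0..<Suc j]"
      using bad[of "Suc j"] len unfolding bad_from_def by auto
    have "f k = g k" if "k \<le> j" for k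
      using that arg_cong[OF g(3), of "\<lambda>xs. xs ! k"] unfolding sf
      by (simp del: upt_Suc add: nth_append)
    then show ?thesis using g that by (metis le_refl less_imp_le_nat)
  qed
  show ?thesis
  proof (intro exI[of _ f] conjI allI impI)
    fix i show "f i \<in> A" using P[of i "Suc i"] by simp
  next
    fix i j :: nat assume "i < j" then show "\<not> P (f i) (f j)" using P by blast
  next
    fix n g assume g: "\<forall>i. g i \<in> A" "\<forall>i<n. g i = f i" "m (g n) < m (f n)"
    show "\<exists>i j. i < j \<and> P (g i) (g j)"
    proof (rule ccontr)
      assume "\<not> ?thesis"
      then have "bad_from P A (map g [0..<Suc n])"
        using g(1) unfolding bad_from_def by (intro exI[of _ g]) auto
      moreover have "map g [0..<Suc n] = s n @ [g n]" using g(2) by (simp add: sf)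
      ultimately have "m (f n) \<le> m (g n)" using nx(2)[OF bad] by (simp add: f_def)
      then show False using g(3) by simp
    qed
  qed
qed

text \<open>The Nash-Williams argument: along a subsequence with ascending heads, words are replaced
  by their tails. The result is smaller at its first changed position, so it has a good pair, and
  putting the heads back makes that pair good in the minimal bad sequence.\<close>

theorem higman:
  assumes "af_on P A"
  shows "af_on (list_emb P) (lists A)"
proof (rule ccontr)
  assume *: "\<not> ?thesis"
  obtain f :: "nat \<Rightarrow> 'a list" where f: "\<And>i. f i \<in> lists A" "\<And>i j. i < j \<Longrightarrow> \<not> list_emb P (f i) (f j)"
    and min: "\<And>n (g::nat \<Rightarrow> 'a list). (\<forall>i. g i \<in> lists A) \<Longrightarrow> (\<forall>i<n. g i = f i) \<Longrightarrow> length (g n) < length (f n) \<Longrightarrow>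
       (\<exists>i j. i < j \<and> list_emb P (g i) (g j))"
    using minimal_bad_sequence[OF *, of length] by blast
  have "f i \<noteq> []" for i using f(2)[of i "Suc i"] by auto
  then have hd: "f i = hd (f i) # tl (f i)" for i by simp
  have hdA: "hd (f i) \<in> A" "tl (f i) \<in> lists A" for i
    using f(1)[of i] \<open>f i \<noteq> []\<close> by (cases "f i"; simp)+
  obtain r where r: "strict_mono (r :: nat \<Rightarrow> nat)" "\<And>i j. i < j \<Longrightarrow> P (hd (f (r i))) (hd (f (r j)))"
    using af_on_subseq[OF assms, of "\<lambda>i. hd (f i)"] hdA by blast
  define g where "g i = (if i < r 0 then f i else tl (f (r (i - r 0))))" for i
  have rr: "r 0 \<le> r i" for i using r(1) by (simp add: strict_mono_less_eq)
  have "\<exists>i j. i < j \<and> list_emb P (g i) (g j)"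
  proof (rule min[of g "r 0"])
    show "\<forall>i. g i \<in> lists A" using f(1) hdA by (auto simp: g_def)
    show "\<forall>i<r 0. g i = f i" by (simp add: g_def)
    show "length (g (r 0)) < length (f (r 0))" using \<open>f (r 0) \<noteq> []\<close> by (simp add: g_def)
  qed
  then obtain i j where ij: "i < j" "list_emb P (g i) (g j)" by blast
  consider "j < r 0" | "i < r 0" "r 0 \<le> j" | "r 0 \<le> i" using ij(1) by linarith
  then show False
  proof cases
    case 1
    then show False using ij f(2) by (simp add: g_def)
  next
    case 2
    then have "list_emb P (f i) (tl (f (r (j - r 0))))" using ij by (simp add: g_def)
    then have "list_emb P (f i) (f (r (j - r 0)))" by (subst hd) (rule list_emb_Cons)
    then show False using f(2) 2 rr[of "j - r 0"] by (meson order.strict_trans2)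
  next
    case 3
    let ?i = "r (i - r 0)" and ?j = "r (j - r 0)"
    have "i - r 0 < j - r 0" using 3 ij(1) by linarith
    then have lt: "?i < ?j" "P (hd (f ?i)) (hd (f ?j))" using r by (auto simp: strict_mono_less)
    have "list_emb P (tl (f ?i)) (tl (f ?j))" using 3 ij by (simp add: g_def)
    then have "list_emb P (f ?i) (f ?j)" using lt(2) by (subst hd, subst (2) hd) (rule list_emb_Cons2)
    then show False using f(2) lt(1) by blast
  qed
qed

section \<open>Menger's theorem\<close>

definition dpath :: "('a \<times> 'a) set \<Rightarrow> 'a list \<Rightarrow> bool" where
  "dpath E p \<longleftrightarrow> p \<noteq> [] \<and> distinct p \<and> successively (\<lambda>u v. (u, v) \<in> E) p"

definition separation :: "'a set \<Rightarrow> ('a \<times> 'a) set \<Rightarrow> 'a set \<times> 'a set \<Rightarrow> bool" where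
  "separation V E S \<longleftrightarrow> fst S \<union> snd S = V \<and> (\<forall>u \<in> fst S - snd S. \<forall>v \<in> snd S - fst S. (u, v) \<notin> E)"

definition linked :: "('a \<times> 'a) set \<Rightarrow> 'a set \<Rightarrow> 'a set \<Rightarrow> nat \<Rightarrow> (nat \<Rightarrow> 'a list) \<Rightarrow> bool" where
  "linked E X Y k P \<longleftrightarrow> (\<forall>i<k. dpath E (P i) \<and> hd (P i) \<in> X \<and> last (P i) \<in> Y) \<and>
     (\<forall>i<k. \<forall>j<k. i \<noteq> j \<longrightarrow> set (P i) \<inter> set (P j) = {})"

lemma separationD:
  assumes "separation V E (A, B)"
  shows "A \<union> B = V" "\<And>u v. (u, v) \<in> E \<Longrightarrow> u \<in> A \<Longrightarrow> u \<notin> B \<Longrightarrow> v \<in> B \<Longrightarrow> v \<in> A"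
  using assms by (auto simp: separation_def)

lemma separationI:
  assumes "A \<union> B = V" "\<And>u v. (u, v) \<in> E \<Longrightarrow> u \<in> A \<Longrightarrow> u \<notin> B \<Longrightarrow> v \<in> B \<Longrightarrow> v \<notin> A \<Longrightarrow> False"
  shows "separation V E (A, B)"
  using assms by (auto simp: separation_def)

lemma dpath_mono: "dpath E p \<Longrightarrow> E \<subseteq> F \<Longrightarrow> dpath F p"
  unfolding dpath_def by (auto elim: successively_mono)

lemma linked_mono: "linked E X Y k P \<Longrightarrow> E \<subseteq> F \<Longrightarrow> linked F X Y k P"
  unfolding linked_def by (meson dpath_mono)

text \<open>As many disjoint paths as vertices of \<open>T\<close>, each with a chosen vertex in
  \<open>T\<close>, use up all of \<open>T\<close>. Hence no path meets \<open>T\<close> elsewhere,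
  and the paths can be indexed by \<open>T\<close>.\<close>

lemma reindex_by_representatives:
  fixes P :: "nat \<Rightarrow> 'a list"
  assumes "finite T" "card T = k" "\<And>i. i < k \<Longrightarrow> e (P i) \<in> T \<and> e (P i) \<in> set (P i)"
    and disj: "\<And>i j. i < k \<Longrightarrow> j < k \<Longrightarrow> i \<noteq> j \<Longrightarrow> set (P i) \<inter> set (P j) = {}"
  shows "\<exists>h. (\<forall>t\<in>T. h t < k \<and> e (P (h t)) = t \<and> set (P (h t)) \<inter> T = {t}) \<and> inj_on h T"
proof -
  have inj: "inj_on (\<lambda>i. e (P i)) {..<k}"
    using assms(3) disj by (intro inj_onI) (metis disjoint_iff lessThan_iff)
  have "(\<lambda>i. e (P i)) ` {..<k} = T"
    by (rule card_seteq) (use assms inj in \<open>auto simp: card_image\<close>)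
  then have "\<forall>t\<in>T. \<exists>i. i < k \<and> e (P i) = t" by auto
  then obtain h where h: "\<And>t. t \<in> T \<Longrightarrow> h t < k \<and> e (P (h t)) = t" by metis
  have injh: "inj_on h T" using h by (metis inj_onI)
  have "set (P (h t)) \<inter> T = {t}" if t: "t \<in> T" for t
  proof
    show "{t} \<subseteq> set (P (h t)) \<inter> T" using assms(3) h t by fastforce
    show "set (P (h t)) \<inter> T \<subseteq> {t}"
    proof
      fix u assume u: "u \<in> set (P (h t)) \<inter> T"
      then have "u \<in> set (P (h u))" using assms(3)[of "h u"] h[of u] by auto
      then have "h u = h t" using disj[of "h u" "h t"] u h t by blast
      then show "u \<in> {t}" using injh u t by (auto simp: inj_on_def)
    qed
  qed
  then show ?thesis using h injh by blast
qed

text \<open>The last vertex is exempt from the closure condition: a path may end in a separator,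
  from which edges of the digraph leave \<open>A\<close>.\<close>

lemma dpath_invariant:
  assumes "dpath E p" "hd p \<in> A"
    and step: "\<And>u v. (u, v) \<in> E \<Longrightarrow> u \<in> A \<Longrightarrow> u \<in> set p \<Longrightarrow> u \<noteq> last p \<Longrightarrow> v \<in> A"
  shows "set p \<subseteq> A"
proof -
  have p: "p \<noteq> []" "distinct p" and
    succ: "\<And>i. Suc i < length p \<Longrightarrow> (p ! i, p ! Suc i) \<in> E"
    using assms(1) by (auto simp: dpath_def successively_conv_nth)
  have "p ! i \<in> A" if "i < length p" for i
    using that
  proof (induction i)
    case 0
    then show ?case using assms(2) p by (simp add: hd_conv_nth)
  next
    case (Suc i)
    have "p ! i \<noteq> last p"
      using Suc.prems p by (simp add: last_conv_nth nth_eq_iff_index_eq)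
    then show ?case using Suc step[OF succ[of i]] by simp
  qed
  then show ?thesis by (auto simp: in_set_conv_nth)
qed

lemma dpath_invariant_rev:
  assumes "dpath E p" "last p \<in> B"
    and step: "\<And>u v. (u, v) \<in> E \<Longrightarrow> v \<in> B \<Longrightarrow> v \<in> set p \<Longrightarrow> v \<noteq> hd p \<Longrightarrow> u \<in> B"
  shows "set p \<subseteq> B"
proof -
  have "dpath (E\<inverse>) (rev p)" using assms(1) by (simp add: dpath_def)
  then have "set (rev p) \<subseteq> B"
    by (rule dpath_invariant) (use assms in \<open>auto simp: hd_rev last_rev\<close>)
  then show ?thesis by simp
qed

text \<open>
  If deleting the edge \<open>(x, y)\<close> creates a separation \<open>(A, B)\<close> of order \<open>k - 1\<close>, then linkages from
  \<open>X\<close> to \<open>A \<inter> B\<close> plus \<open>x\<close> and from \<open>A \<inter> B\<close> plus \<open>y\<close> to \<open>Y\<close> meet only in \<open>A \<inter> B\<close> and can be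
  concatenated.
\<close>

theorem menger:
  assumes "finite V" "E \<subseteq> V \<times> V" "X \<subseteq> V" "Y \<subseteq> V"
    and "\<And>A B. separation V E (A, B) \<Longrightarrow> X \<subseteq> A \<Longrightarrow> Y \<subseteq> B \<Longrightarrow> k \<le> card (A \<inter> B)"
  shows "\<exists>P. linked E X Y k P"
  using assms(2-)
proof (induction "card E" arbitrary: E X Y rule: less_induct)
  case less
  note XY = \<open>X \<subseteq> V\<close> \<open>Y \<subseteq> V\<close>
  note min = less.prems(4)
  have finE: "finite E" using assms(1) less.prems(1) finite_subset by blast
  show ?case
  proof (cases "E = {}")
    case True
    \<comment> \<open>Without edges every cover of \<open>V\<close> is a separation. This one has
      adhesion set \<open>X \<inter> Y\<close>, whose vertices form the trivial paths.\<close>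
    have "k \<le> card (X \<inter> (V - (X - Y)))"
      by (rule min) (use XY in \<open>auto simp: separation_def True\<close>)
    moreover have "X \<inter> (V - (X - Y)) = X \<inter> Y" using XY by auto
    ultimately obtain T where T: "T \<subseteq> X \<inter> Y" "card T = k" "finite T"
      by (metis obtain_subset_with_card_n)
    then obtain f where f: "bij_betw f {..<k} T" using ex_bij_betw_nat_finite[of T]
      by (auto simp: atLeast0LessThan)
    have "f i \<in> T" if "i < k" for i using f that by (auto simp: bij_betw_def)
    moreover have "f i \<noteq> f j" if "i < k" "j < k" "i \<noteq> j" for i j
      using f that by (auto simp: bij_betw_def inj_on_def)
    ultimately have "linked E X Y k (\<lambda>i. [f i])"
      using T(1) by (auto simp: linked_def dpath_def)
    then show ?thesis by blast
  next
    case False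
    then obtain x y where xy: "(x, y) \<in> E" by auto
    let ?E = "E - {(x, y)}"
    have card: "card ?E < card E" using finE xy by (rule card_Diff1_less)
    have E': "?E \<subseteq> V \<times> V" using less.prems(1) by auto
    have xyV: "x \<in> V" "y \<in> V" using xy less.prems(1) by auto
    show ?thesis
    proof (cases "\<forall>A B. separation V ?E (A, B) \<longrightarrow> X \<subseteq> A \<longrightarrow> Y \<subseteq> B \<longrightarrow> k \<le> card (A \<inter> B)")
      case True
      then have "\<exists>P. linked ?E X Y k P" using less.hyps[OF card E' XY] by blast
      then show ?thesis using linked_mono[of ?E X Y k _ E] by blast
    next
      case False
      then obtain A B where AB: "separation V ?E (A, B)" "X \<subseteq> A" "Y \<subseteq> B" "card (A \<inter> B) < k"
        by (metis not_le)
      note sep = separationD[OF AB(1)]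
      define S where "S = A \<inter> B"
      have finS: "finite S" using sep(1) assms(1) by (auto simp: S_def)
      have "\<not> separation V E (A, B)" using min AB by (meson not_le)
      then have xA: "x \<in> A" "x \<notin> B" "y \<in> B" "y \<notin> A"
        using AB(1) by (auto simp: separation_def)
      \<comment> \<open>Only the deleted edge crosses \<open>(A, B)\<close>, so moving its head
        \<open>y\<close> into \<open>A\<close> gives a separation of \<open>E\<close>. Hence the
        order was exactly \<open>k - 1\<close>.\<close>
      have "k \<le> card (insert y A \<inter> B)"
        by (rule min, rule separationI) (use sep xA xyV AB in auto)
      moreover have "insert y A \<inter> B = insert y S" using xA by (auto simp: S_def)
      moreover have "y \<notin> S" "x \<notin> S" using xA by (auto simp: S_def)
      ultimately have cards: "card (insert x S) = k" "card (insert y S) = k"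
        using AB(4) finS by (auto simp: S_def)
      have SV: "insert x S \<subseteq> V" "insert y S \<subseteq> V" using sep(1) xyV by (auto simp: S_def)
      have "\<exists>P. linked ?E X (insert x S) k P"
      proof (rule less.hyps[OF card E' XY(1) SV(1)])
        fix C D assume CD: "separation V ?E (C, D)" "X \<subseteq> C" "insert x S \<subseteq> D"
        note sepC = separationD[OF CD(1)]
        \<comment> \<open>The deleted edge does not cross, as its tail lies in \<open>D\<close>.
          Moreover \<open>A \<inter> B\<close> lies in \<open>D\<close>, so this adhesion set is
          part of \<open>C \<inter> D\<close>.\<close>
        have "separation V E (C \<inter> A, D \<union> B)"
        proof (rule separationI)
          show "C \<inter> A \<union> (D \<union> B) = V" using sep(1) sepC(1) by auto
          fix u v assume uv: "(u, v) \<in> E" "u \<in> C \<inter> A" "u \<notin> D \<union> B" "v \<in> D \<union> B" "v \<notin> C \<inter> A"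
          then have "(u, v) \<in> ?E" using CD(3) by auto
          then have "v \<in> B \<Longrightarrow> v \<in> A" "v \<in> D \<Longrightarrow> v \<in> C" using sep(2) sepC(2) uv by auto
          moreover have "v \<in> V" using uv less.prems(1) by auto
          ultimately show False using uv sep(1) sepC(1) by auto
        qed
        then have "k \<le> card ((C \<inter> A) \<inter> (D \<union> B))" by (rule min) (use AB CD in auto)
        also have "\<dots> \<le> card (C \<inter> D)"
          by (rule card_mono) (use sepC(1) assms(1) CD(3) in \<open>auto simp: S_def\<close>)
        finally show "k \<le> card (C \<inter> D)" .
      qed
      then obtain P1 where P1: "linked ?E X (insert x S) k P1" by blast
      have "\<exists>P. linked ?E (insert y S) Y k P"
      proof (rule less.hyps[OF card E' SV(2) XY(2)])
        fix C D assume CD: "separation V ?E (C, D)" "insert y S \<subseteq> C" "Y \<subseteq> D"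
        note sepC = separationD[OF CD(1)]
        have "separation V E (C \<union> A, D \<inter> B)"
        proof (rule separationI)
          show "C \<union> A \<union> (D \<inter> B) = V" using sep(1) sepC(1) by auto
          fix u v assume uv: "(u, v) \<in> E" "u \<in> C \<union> A" "u \<notin> D \<inter> B" "v \<in> D \<inter> B" "v \<notin> C \<union> A"
          then have "(u, v) \<in> ?E" using CD(2) by auto
          then have "\<not> (u \<in> A \<and> u \<notin> B)" "\<not> (u \<in> C \<and> u \<notin> D)" using sep(2) sepC(2) uv by auto
          then show False using uv sep(1) sepC(1) less.prems(1) by auto
        qed
        then have "k \<le> card ((C \<union> A) \<inter> (D \<inter> B))" by (rule min) (use AB CD in auto)
        also have "\<dots> \<le> card (C \<inter> D)"
          by (rule card_mono) (use sepC(1) assms(1) CD(2) in \<open>auto simp: S_def\<close>)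
        finally show "k \<le> card (C \<inter> D)" .
      qed
      then obtain P2 where P2: "linked ?E (insert y S) Y k P2" by blast
      have "\<exists>h. (\<forall>t\<in>insert x S. h t < k \<and> last (P1 (h t)) = t \<and>
          set (P1 (h t)) \<inter> insert x S = {t}) \<and> inj_on h (insert x S)"
        by (rule reindex_by_representatives) (use P1 finS cards in \<open>simp_all add: linked_def dpath_def\<close>)
      then obtain h1 where h1': "\<forall>t\<in>insert x S. h1 t < k \<and> last (P1 (h1 t)) = t \<and>
          set (P1 (h1 t)) \<inter> insert x S = {t}" "inj_on h1 (insert x S)"
        by (elim exE conjE)
      note h1 = h1'(1)[rule_format] h1'(2)
      have "\<exists>h. (\<forall>t\<in>insert y S. h t < k \<and> hd (P2 (h t)) = t \<and>
          set (P2 (h t)) \<inter> insert y S = {t}) \<and> inj_on h (insert y S)"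
        by (rule reindex_by_representatives) (use P2 finS cards in \<open>simp_all add: linked_def dpath_def\<close>)
      then obtain h2 where h2': "\<forall>t\<in>insert y S. h2 t < k \<and> hd (P2 (h2 t)) = t \<and>
          set (P2 (h2 t)) \<inter> insert y S = {t}" "inj_on h2 (insert y S)"
        by (elim exE conjE)
      note h2 = h2'(1)[rule_format] h2'(2)
      define Q1 where "Q1 t = P1 (h1 t)" for t
      define Q2 where "Q2 t = P2 (h2 t)" for t
      have Q1: "dpath ?E (Q1 t)" "hd (Q1 t) \<in> X" "last (Q1 t) = t" "set (Q1 t) \<inter> insert x S = {t}"
        if "t \<in> insert x S" for t
        using h1(1)[OF that] P1 by (auto simp: Q1_def linked_def)
      have Q2: "dpath ?E (Q2 t)" "last (Q2 t) \<in> Y" "hd (Q2 t) = t" "set (Q2 t) \<inter> insert y S = {t}"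
        if "t \<in> insert y S" for t
        using h2(1)[OF that] P2 by (auto simp: Q2_def linked_def)
      have Q1d: "set (Q1 s) \<inter> set (Q1 t) = {}" if "s \<in> insert x S" "t \<in> insert x S" "s \<noteq> t" for s t
      proof -
        have "h1 s \<noteq> h1 t" using h1(2) that by (meson inj_onD)
        then show ?thesis
          using P1 h1(1)[OF that(1)] h1(1)[OF that(2)] unfolding Q1_def linked_def by blast
      qed
      have Q2d: "set (Q2 s) \<inter> set (Q2 t) = {}" if "s \<in> insert y S" "t \<in> insert y S" "s \<noteq> t" for s t
      proof -
        have "h2 s \<noteq> h2 t" using h2(2) that by (meson inj_onD)
        then show ?thesis
          using P2 h2(1)[OF that(1)] h2(1)[OF that(2)] unfolding Q2_def linked_def by blast
      qed
      have Q1A: "set (Q1 t) \<subseteq> A" if "t \<in> insert x S" for t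
      proof (rule dpath_invariant[OF Q1(1)[OF that]])
        show "hd (Q1 t) \<in> A" using Q1(2)[OF that] AB(2) by auto
        fix u v assume uv: "(u, v) \<in> ?E" "u \<in> A" "u \<in> set (Q1 t)" "u \<noteq> last (Q1 t)"
        then have "u \<notin> S" using Q1(3,4)[OF that] by auto
        then have "u \<notin> B" using uv by (simp add: S_def)
        then show "v \<in> A" using sep(2)[OF uv(1)] uv sep(1) less.prems(1) by auto
      qed
      have Q2B: "set (Q2 t) \<subseteq> B" if "t \<in> insert y S" for t
      proof (rule dpath_invariant_rev[OF Q2(1)[OF that]])
        show "last (Q2 t) \<in> B" using Q2(2)[OF that] AB(3) by auto
        fix u v assume uv: "(u, v) \<in> ?E" "v \<in> B" "v \<in> set (Q2 t)" "v \<noteq> hd (Q2 t)"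
        then have "v \<notin> S" using Q2(3,4)[OF that] by auto
        then have "v \<notin> A" using uv by (simp add: S_def)
        then show "u \<in> B" using sep(2)[OF uv(1)] uv sep(1) less.prems(1) by auto
      qed
      \<comment> \<open>The start of the second path for \<open>t\<close>: the path ending in
        \<open>x\<close> continues across the edge to \<open>y\<close>, any other one at the same
        vertex.\<close>
      define y' where "y' t = (if t = x then y else t)" for t
      have y': "y' t \<in> insert y S" if "t \<in> insert x S" for t using that by (auto simp: y'_def)
      \<comment> \<open>A vertex \<open>t\<close> of \<open>S\<close> ends one path and begins the
        next, so one copy is dropped.\<close>
      define R where "R t = Q1 t @ (if t = x then Q2 y else tl (Q2 t))" for t
      have setR: "set (R t) \<subseteq> set (Q1 t) \<union> set (Q2 (y' t))" for t
      proof -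
        have "set (tl xs) \<subseteq> set xs" for xs :: "'a list" by (cases xs) auto
        then show ?thesis by (auto simp: R_def y'_def)
      qed
      have cross: "s = y' t" if "s \<in> insert x S" "t \<in> insert x S" "z \<in> set (Q1 s)" "z \<in> set (Q2 (y' t))" for s t z
      proof -
        have "z \<in> S" using Q1A[OF that(1)] Q2B[OF y'[OF that(2)]] that by (auto simp: S_def)
        then have "z \<in> set (Q1 s) \<inter> insert x S" "z \<in> set (Q2 (y' t)) \<inter> insert y S"
          using that(3,4) by simp_all
        then show ?thesis unfolding Q1(4)[OF that(1)] Q2(4)[OF y'[OF that(2)]] by simp
      qed
      have disjR: "set (R s) \<inter> set (R t) = {}" if "s \<in> insert x S" "t \<in> insert x S" "s \<noteq> t" for s t
      proof -
        have yne: "y \<notin> insert x S" using xA by (auto simp: S_def)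
        have ne: "y' s \<noteq> y' t" using that yne by (auto simp: y'_def)
        have ne2: "s \<noteq> y' t" "t \<noteq> y' s" using that yne by (auto simp: y'_def)
        have "set (Q1 s) \<inter> set (Q2 (y' t)) = {}" "set (Q1 t) \<inter> set (Q2 (y' s)) = {}"
          using cross[OF that(1,2)] cross[OF that(2,1)] ne2 by (meson disjoint_iff)+
        then have "(set (Q1 s) \<union> set (Q2 (y' s))) \<inter> (set (Q1 t) \<union> set (Q2 (y' t))) = {}"
          using Q1d[OF that] Q2d[OF y'[OF that(1)] y'[OF that(2)] ne] by auto
        then show ?thesis using setR[of s] setR[of t] by auto
      qed
      have pathR: "dpath E (R t) \<and> hd (R t) \<in> X \<and> last (R t) \<in> Y" if t: "t \<in> insert x S" for t
      proof -
        have q1: "Q1 t \<noteq> []" "distinct (Q1 t)" "successively (\<lambda>u v. (u, v) \<in> E) (Q1 t)"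
          using dpath_mono[OF Q1(1)[OF t], of E] by (auto simp: dpath_def)
        have q2: "Q2 (y' t) \<noteq> []" "distinct (Q2 (y' t))"
          "successively (\<lambda>u v. (u, v) \<in> E) (Q2 (y' t))"
          using dpath_mono[OF Q2(1)[OF y'[OF t]], of E] by (auto simp: dpath_def)
        have hdX: "hd (R t) \<in> X" using Q1(2)[OF t] q1(1) by (simp add: R_def)
        show ?thesis
        proof (cases "t = x")
          case True
          then have "set (Q1 t) \<inter> set (Q2 y) = {}" using cross[OF t t] xA by (auto simp: y'_def)
          then have "dpath E (R t)" using q1 q2 True Q1(3)[OF t] Q2(3)[of y] xy
            by (auto simp: dpath_def R_def y'_def successively_append_iff)
          moreover have "last (R t) \<in> Y" using q2 True Q2(2)[of y] by (simp add: R_def y'_def)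
          ultimately show ?thesis using hdX by blast
        next
          case False
          then have tS: "t \<in> S" "y' t = t" using t by (auto simp: y'_def)
          then obtain ys where ys: "Q2 t = t # ys" using q2 Q2(3)[of t] by (cases "Q2 t") auto
          have R: "R t = Q1 t @ ys" using False ys by (simp add: R_def)
          have "set (Q1 t) \<inter> set (Q2 t) \<subseteq> {t}"
            using Q1A[OF t] Q2B[of t] Q1(4)[OF t] tS by (auto simp: S_def)
          then have "set (Q1 t) \<inter> set ys = {}" using q2(2) ys tS by auto
          then have "dpath E (R t)" using q1 q2 Q1(3)[OF t] ys tS
            by (auto simp: dpath_def R successively_append_iff successively_Cons)
          moreover have "last (R t) \<in> Y" using Q2(2)[of t] ys tS Q1(3)[OF t] by (cases ys) (auto simp: R)
          ultimately show ?thesis using hdX by blast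
        qed
      qed
      obtain f where f: "bij_betw f {..<k} (insert x S)"
        using ex_bij_betw_nat_finite[of "insert x S"] finS cards by (auto simp: atLeast0LessThan)
      then have fS: "f i \<in> insert x S" if "i < k" for i
        using that by (auto simp: bij_betw_def)
      have finj: "f i \<noteq> f j" if "i < k" "j < k" "i \<noteq> j" for i j
        using f that by (auto simp: bij_betw_def inj_on_def)
      have "linked E X Y k (\<lambda>i. R (f i))"
        unfolding linked_def using pathR disjR fS finj by presburger
      then show ?thesis by blast
    qed
  qed
qed

text \<open>A shortest path on vertices of \<open>p\<close> has no chord that skips forward. Keeping
  to \<open>set p\<close> preserves the disjointness of a linkage.\<close>

lemma chordless_dpath:
  assumes "dpath E p"
  shows "\<exists>q. dpath E q \<and> hd q = hd p \<and> last q = last p \<and> set q \<subseteq> set p \<and>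
    (\<forall>a b. Suc a < b \<longrightarrow> b < length q \<longrightarrow> (q ! a, q ! b) \<notin> E)"
proof -
  let ?Q = "\<lambda>q. dpath E q \<and> hd q = hd p \<and> last q = last p \<and> set q \<subseteq> set p"
  define q where "q = (ARG_MIN length q. ?Q q)"
  have q: "?Q q" "\<And>r. ?Q r \<Longrightarrow> length q \<le> length r"
    unfolding q_def using assms arg_min_natI[of ?Q p length] arg_min_nat_le[of ?Q _ length] by auto
  have "(q ! a, q ! b) \<notin> E" if ab: "Suc a < b" "b < length q" for a b
  proof
    assume e: "(q ! a, q ! b) \<in> E"
    let ?r = "take (Suc a) q @ drop b q"
    have q': "q \<noteq> []" "distinct q" "successively (\<lambda>u v. (u, v) \<in> E) q"
      using q(1) by (auto simp: dpath_def)
    have "successively (\<lambda>u v. (u, v) \<in> E) (take (Suc a) q @ drop (Suc a) q)"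
      "successively (\<lambda>u v. (u, v) \<in> E) (take b q @ drop b q)" using q'(3) by simp_all
    then have s: "successively (\<lambda>u v. (u, v) \<in> E) (take (Suc a) q)"
      "successively (\<lambda>u v. (u, v) \<in> E) (drop b q)"
      unfolding successively_append_iff by blast+
    have "last (take (Suc a) q) = q ! a" "hd (drop b q) = q ! b"
      using ab by (simp_all add: take_Suc_conv_app_nth hd_drop_conv_nth)
    then have "successively (\<lambda>u v. (u, v) \<in> E) ?r"
      using s e by (simp add: successively_append_iff)
    moreover have "set (take (Suc a) q) \<inter> set (drop b q) = {}"
      by (rule set_take_disj_set_drop_if_distinct) (use q' ab in auto)
    ultimately have "dpath E ?r" using q' by (simp add: dpath_def)
    moreover have "hd ?r = hd q" "last ?r = last q" "set ?r \<subseteq> set q"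
      using ab q'(1) by (auto simp: last_drop dest: in_set_takeD in_set_dropD)
    ultimately have "?Q ?r" using q(1) by (metis subset_trans)
    then have "length q \<le> length ?r" by (rule q(2))
    then show False using ab by simp
  qed
  then show ?thesis using q(1) by blast
qed

section \<open>Separations and path decompositions\<close>

definition sep_order :: "'a set \<times> 'a set \<Rightarrow> nat" where
  "sep_order S = card (fst S \<inter> snd S)"

definition sep_le :: "'a set \<times> 'a set \<Rightarrow> 'a set \<times> 'a set \<Rightarrow> bool" where
  "sep_le C D \<longleftrightarrow> fst C \<subseteq> fst D \<and> snd D \<subseteq> snd C"

definition sep_meet :: "'a set \<times> 'a set \<Rightarrow> 'a set \<times> 'a set \<Rightarrow> 'a set \<times> 'a set" where
  "sep_meet C D = (fst C \<inter> fst D, snd C \<union> snd D)"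

definition sep_join :: "'a set \<times> 'a set \<Rightarrow> 'a set \<times> 'a set \<Rightarrow> 'a set \<times> 'a set" where
  "sep_join C D = (fst C \<union> fst D, snd C \<inter> snd D)"

lemma sep_le_refl [simp]: "sep_le C C"
  by (simp add: sep_le_def)

lemma sep_le_trans: "sep_le C D \<Longrightarrow> sep_le D F \<Longrightarrow> sep_le C F"
  by (auto simp: sep_le_def)

lemma sep_le_antisym: "sep_le C D \<Longrightarrow> sep_le D C \<Longrightarrow> C = D"
  by (auto simp: sep_le_def prod_eq_iff)

lemma separation_meet:
  "separation V E C \<Longrightarrow> separation V E D \<Longrightarrow> E \<subseteq> V \<times> V \<Longrightarrow> separation V E (sep_meet C D)"
  unfolding separation_def sep_meet_def by auto blast+

lemma separation_join:
  "separation V E C \<Longrightarrow> separation V E D \<Longrightarrow> E \<subseteq> V \<times> V \<Longrightarrow> separation V E (sep_join C D)"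
  unfolding separation_def sep_join_def by auto

lemma separation_sub: "separation V E S \<Longrightarrow> fst S \<subseteq> V \<and> snd S \<subseteq> V"
  by (auto simp: separation_def)

lemma sep_order_leI:
  assumes "finite V" "separation V E D" "separation V E C" "sep_le C D"
  shows "sep_order C \<le> card (fst D \<inter> snd C)" "sep_order D \<le> card (fst D \<inter> snd C)"
  using assms separation_sub[OF assms(2)] separation_sub[OF assms(3)]
  by (auto simp: sep_order_def sep_le_def intro!: card_mono dest: finite_subset)

text \<open>If \<open>D1\<close> and \<open>C2\<close> are the sides of one separation, this is
  submodularity of the order. If they come from two consecutive separations, it bounds the bags that
  arise by uncrossing.\<close>

lemma bag_submodular:
  assumes "finite D1" "finite Z1"
  shows "card ((D1 \<inter> Z1) \<inter> (C2 \<union> Z2)) + card ((D1 \<union> Z1) \<inter> (C2 \<inter> Z2))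
    \<le> card (D1 \<inter> C2) + card (Z1 \<inter> Z2)"
proof -
  let ?X = "(D1 \<inter> Z1) \<inter> (C2 \<union> Z2)" and ?Y = "(D1 \<union> Z1) \<inter> (C2 \<inter> Z2)"
  let ?P = "D1 \<inter> C2" and ?Q = "Z1 \<inter> Z2"
  have "card ?X + card ?Y = card (?X \<union> ?Y) + card (?X \<inter> ?Y)"
    by (rule card_Un_Int) (use assms in auto)
  also have "\<dots> \<le> card (?P \<union> ?Q) + card (?P \<inter> ?Q)"
    by (intro add_mono card_mono) (use assms in auto)
  also have "\<dots> = card ?P + card ?Q"
    by (rule card_Un_Int[symmetric]) (use assms in auto)
  finally show ?thesis .
qed

lemma sep_order_submodular:
  assumes "finite (fst C)" "finite (fst D)"
  shows "sep_order (sep_meet C D) + sep_order (sep_join C D) \<le> sep_order C + sep_order D"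
  using bag_submodular[OF assms, of "snd C" "snd D"]
  by (simp add: sep_order_def sep_meet_def sep_join_def)

text \<open>
  A sequence of steps from \<open>({}, V)\<close> to \<open>(V, {})\<close> is a directed path decomposition with bags
  \<open>fst D \<inter> snd C\<close> of size at most \<open>k\<close>.
\<close>

definition sep_step :: "'a set \<Rightarrow> ('a \<times> 'a) set \<Rightarrow> nat \<Rightarrow> 'a set \<times> 'a set \<Rightarrow> 'a set \<times> 'a set \<Rightarrow> bool"
  where
  "sep_step V E k C D \<longleftrightarrow> separation V E C \<and> separation V E D \<and> sep_le C D \<and>
     card (fst D \<inter> snd C) \<le> k"

abbreviation sep_steps where "sep_steps V E k \<equiv> (sep_step V E k)\<^sup>*\<^sup>*"

lemma sep_steps_le: "sep_steps V E k C D \<Longrightarrow> sep_le C D"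
  by (induction rule: rtranclp_induct) (auto simp: sep_step_def intro: sep_le_trans)

lemma sep_steps_separation:
  "sep_steps V E k C D \<Longrightarrow> separation V E C \<Longrightarrow> separation V E D"
  by (induction rule: rtranclp_induct) (auto simp: sep_step_def)

lemma sep_steps_order:
  assumes "sep_steps V E k C D" "sep_order C \<le> k" "finite V"
  shows "sep_order D \<le> k"
  using assms(1)
proof (cases rule: rtranclp.cases)
  case rtrancl_refl
  then show ?thesis using assms(2) by simp
next
  case (rtrancl_into_rtrancl F)
  then show ?thesis using sep_order_leI(2)[OF assms(3), of E D F] by (auto simp: sep_step_def)
qed

text \<open>The bag of the joined step contains the adhesion set of \<open>sep_join C Z\<close>, so
  it has at least \<open>sep_order Z\<close> vertices. Submodularity then leaves at most
  \<open>k\<close> for the bag of the step between the meets.\<close>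

lemma sep_step_meet:
  assumes "sep_step V E k C D" "separation V E Z" "sep_order Z \<le> sep_order (sep_join C Z)"
    "finite V" "E \<subseteq> V \<times> V"
  shows "sep_step V E k (sep_meet C Z) (sep_meet D Z)"
proof -
  have C: "separation V E C" "separation V E D" "sep_le C D" "card (fst D \<inter> snd C) \<le> k"
    using assms(1) by (auto simp: sep_step_def)
  have fin: "finite (fst D)" "finite (fst Z)" "finite (snd C)"
    using C assms separation_sub by (metis finite_subset)+
  have "card (fst (sep_meet D Z) \<inter> snd (sep_meet C Z)) +
      card (fst (sep_join D Z) \<inter> snd (sep_join C Z)) \<le> card (fst D \<inter> snd C) + sep_order Z"
    using bag_submodular[OF fin(1,2), of "snd C" "snd Z"]
    by (simp add: sep_order_def sep_meet_def sep_join_def)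
  moreover have "sep_order (sep_join C Z) \<le> card (fst (sep_join D Z) \<inter> snd (sep_join C Z))"
    using fin C(3) by (auto simp: sep_order_def sep_join_def sep_le_def intro!: card_mono)
  ultimately have "card (fst (sep_meet D Z) \<inter> snd (sep_meet C Z)) \<le> k"
    using assms(3) C(4) by linarith
  moreover have "sep_le (sep_meet C Z) (sep_meet D Z)"
    using C(3) by (auto simp: sep_le_def sep_meet_def)
  ultimately show ?thesis
    using separation_meet[OF C(1) assms(2,5)] separation_meet[OF C(2) assms(2,5)]
    by (simp add: sep_step_def)
qed

lemma sep_step_join:
  assumes "sep_step V E k C D" "separation V E Z" "sep_order Z \<le> sep_order (sep_meet C Z)"
    "finite V" "E \<subseteq> V \<times> V"
  shows "sep_step V E k (sep_join C Z) (sep_join D Z)"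
proof -
  have C: "separation V E C" "separation V E D" "sep_le C D" "card (fst D \<inter> snd C) \<le> k"
    using assms(1) by (auto simp: sep_step_def)
  have fin: "finite (fst D)" "finite (fst Z)" "finite (snd C)"
    using C assms separation_sub by (metis finite_subset)+
  have "card (fst (sep_meet D Z) \<inter> snd (sep_meet C Z)) +
      card (fst (sep_join D Z) \<inter> snd (sep_join C Z)) \<le> card (fst D \<inter> snd C) + sep_order Z"
    using bag_submodular[OF fin(1,2), of "snd C" "snd Z"]
    by (simp add: sep_order_def sep_meet_def sep_join_def)
  moreover have "sep_order (sep_meet C Z) \<le> card (fst (sep_meet D Z) \<inter> snd (sep_meet C Z))"
    using fin C(3) by (auto simp: sep_order_def sep_meet_def sep_le_def intro!: card_mono)
  ultimately have "card (fst (sep_join D Z) \<inter> snd (sep_join C Z)) \<le> k"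
    using assms(3) C(4) by linarith
  moreover have "sep_le (sep_join C Z) (sep_join D Z)"
    using C(3) by (auto simp: sep_le_def sep_join_def)
  ultimately show ?thesis
    using separation_join[OF C(1) assms(2,5)] separation_join[OF C(2) assms(2,5)]
    by (simp add: sep_step_def)
qed

text \<open>
  Uncrossing every separation of a chain with \<open>Z\<close> keeps the bags small, by submodularity and the
  minimality of the order of \<open>Z\<close>.
\<close>

lemma sep_steps_via_minimal:
  assumes XY: "sep_steps V E k X Y" and V: "finite V" "E \<subseteq> V \<times> V"
    and sep: "separation V E X" "separation V E Z" "sep_le X Z" "sep_le Z Y"
    and min: "\<And>W. separation V E W \<Longrightarrow> sep_le X W \<Longrightarrow> sep_le W Y \<Longrightarrow> sep_order Z \<le> sep_order W"
  shows "sep_steps V E k X Z \<and> sep_steps V E k Z Y"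
proof -
  \<comment> \<open>Both halves are built along the given chain. For separations below
    \<open>Y\<close>, meets and joins with \<open>Z\<close> lie between \<open>X\<close> and
    \<open>Y\<close>, so \<open>min\<close> applies; at \<open>C = Y\<close> they become
    \<open>Z\<close> and \<open>Y\<close>.\<close>
  have "sep_le C Y \<longrightarrow> sep_steps V E k X (sep_meet C Z) \<and> sep_steps V E k Z (sep_join C Z)"
    if "sep_steps V E k X C" for C
    using that
  proof (induction rule: rtranclp_induct)
    case base
    have "sep_meet X Z = X" "sep_join X Z = Z"
      using sep(3) by (auto simp: sep_le_def sep_meet_def sep_join_def prod_eq_iff)
    then show ?case by simp
  next
    case (step C D)
    show ?case
    proof
      assume DY: "sep_le D Y"
      then have CY: "sep_le C Y" using step(2) sep_le_trans[of C D Y] by (simp add: sep_step_def)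
      have XC: "sep_le X C" "separation V E C"
        using sep_steps_le[OF step(1)] sep_steps_separation[OF step(1)] sep(1) by auto
      have "sep_order Z \<le> sep_order (sep_join C Z)" "sep_order Z \<le> sep_order (sep_meet C Z)"
        by (rule min; use XC CY sep separation_join[OF XC(2) sep(2) V(2)]
            separation_meet[OF XC(2) sep(2) V(2)] in
            \<open>auto simp: sep_le_def sep_join_def sep_meet_def\<close>)+
      then show "sep_steps V E k X (sep_meet D Z) \<and> sep_steps V E k Z (sep_join D Z)"
        using step(3) CY sep_step_meet[OF step(2) sep(2) _ V] sep_step_join[OF step(2) sep(2) _ V]
        by (meson rtranclp.rtrancl_into_rtrancl)
    qed
  qed
  from this[OF XY] show ?thesis
    using sep(4) by (auto simp: sep_le_def sep_meet_def sep_join_def Int_absorb1 Un_absorb1 Un_absorb2 Int_absorb2)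
qed

text \<open>The bound concerns only separations that can be inserted without exceeding width
  \<open>k\<close>. The ends are exempt, since they may be earlier cuts of smaller order. For
  \<open>m = 0\<close> the bound is void, for \<open>m = Suc k\<close> nothing can be
  inserted.\<close>

definition level :: "'a set \<Rightarrow> ('a \<times> 'a) set \<Rightarrow> nat \<Rightarrow> nat \<Rightarrow> 'a set \<times> 'a set \<Rightarrow> 'a set \<times> 'a set \<Rightarrow> bool"
  where
  "level V E k m X Y \<longleftrightarrow> separation V E X \<and> separation V E Y \<and> sep_order X \<le> k \<and>
     sep_steps V E k X Y \<and>
     (\<forall>Z. sep_steps V E k X Z \<and> sep_steps V E k Z Y \<and> Z \<noteq> X \<and> Z \<noteq> Y \<longrightarrow> m \<le> sep_order Z)"

text \<open>Cutting at an inner separation of order \<open>m\<close> removes it from both halves,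
  and by antisymmetry of \<open>sep_le\<close> nothing new becomes inner. So the number of such
  separations decreases.\<close>

lemma level_decompose:
  assumes "finite V" "level V E k m X Y"
  shows "\<exists>zs. (\<forall>z\<in>set zs. sep_order z = m) \<and> successively (level V E k (Suc m)) (X # zs @ [Y])"
  using assms(2)
proof (induction "card {Z. sep_steps V E k X Z \<and> sep_steps V E k Z Y \<and> Z \<noteq> X \<and> Z \<noteq> Y \<and> sep_order Z = m}"
    arbitrary: X Y rule: less_induct)
  case less
  let ?B = "\<lambda>X Y. {Z. sep_steps V E k X Z \<and> sep_steps V E k Z Y \<and> Z \<noteq> X \<and> Z \<noteq> Y \<and> sep_order Z = m}"
  have lv: "separation V E X" "separation V E Y" "sep_order X \<le> k" "sep_steps V E k X Y"
    "\<And>Z. sep_steps V E k X Z \<Longrightarrow> sep_steps V E k Z Y \<Longrightarrow> Z \<noteq> X \<Longrightarrow> Z \<noteq> Y \<Longrightarrow> m \<le> sep_order Z"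
    using less.prems unfolding level_def by blast+
  have fin: "finite (?B X Y)"
  proof (rule finite_subset)
    show "?B X Y \<subseteq> Pow V \<times> Pow V"
      using sep_steps_separation[OF _ lv(1), of k] separation_sub by fastforce
  qed (use assms(1) in simp)
  show ?case
  proof (cases "?B X Y = {}")
    case True
    then have "level V E k (Suc m) X Y"
      using lv unfolding level_def by (metis (mono_tags, lifting) empty_Collect_eq le_neq_implies_less Suc_leI)
    then show ?thesis by (intro exI[of _ "[]"]) simp
  next
    case False
    then obtain Z where Z: "sep_steps V E k X Z" "sep_steps V E k Z Y" "Z \<noteq> X" "Z \<noteq> Y" "sep_order Z = m"
      by blast
    have sepZ: "separation V E Z" "sep_order Z \<le> k"
      using Z sep_steps_separation lv(1,3) sep_steps_order assms(1) by metis+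
    have anti: "W = Z" if "sep_steps V E k W Z" "sep_steps V E k Z W" for W
      using that sep_steps_le sep_le_antisym by metis
    have neY: "W \<noteq> Y" if "sep_steps V E k W Z" for W
      using that Z(2,4) anti by blast
    have neX: "W \<noteq> X" if "sep_steps V E k Z W" for W
      using that Z(1,3) anti by blast
    have subs: "?B X Z \<subseteq> ?B X Y - {Z}" "?B Z Y \<subseteq> ?B X Y - {Z}"
      using neX neY Z(1,2) by (auto intro: rtranclp_trans)
    have ZB: "Z \<in> ?B X Y" using Z by blast
    have "card (?B X Y - {Z}) < card (?B X Y)" using fin ZB by (rule card_Diff1_less)
    moreover have "card (?B X Z) \<le> card (?B X Y - {Z})" "card (?B Z Y) \<le> card (?B X Y - {Z})"
      using subs fin by (auto intro!: card_mono)
    ultimately have cards: "card (?B X Z) < card (?B X Y)" "card (?B Z Y) < card (?B X Y)"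
      by linarith+
    have l1: "level V E k m X Z"
      unfolding level_def using lv sepZ Z neY by (meson rtranclp_trans)
    have l2: "level V E k m Z Y"
      unfolding level_def using lv sepZ Z neX by (meson rtranclp_trans)
    obtain zs1 where zs1: "\<forall>z\<in>set zs1. sep_order z = m" "successively (level V E k (Suc m)) (X # zs1 @ [Z])"
      using less.hyps[OF cards(1) l1] by blast
    obtain zs2 where zs2: "\<forall>z\<in>set zs2. sep_order z = m" "successively (level V E k (Suc m)) (Z # zs2 @ [Y])"
      using less.hyps[OF cards(2) l2] by blast
    have "successively (level V E k (Suc m)) ((X # zs1) @ ([Z] @ (zs2 @ [Y])))"
      using zs1(2) zs2(2) by (subst successively_append_iff) (auto simp: successively_append_iff successively_Cons)
    then show ?thesis
      using zs1(1) zs2(1) Z(5) by (intro exI[of _ "zs1 @ Z # zs2"]) auto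
  qed
qed

text \<open>Otherwise Menger's theorem gives a separation of order below \<open>m\<close>. Uncrossed
  into the interval from \<open>Z\<close> to \<open>Z'\<close> and taken of least order there, it
  can be inserted into the chain, which the level forbids.\<close>

lemma level_linked:
  assumes V: "finite V" "E \<subseteq> V \<times> V" and lev: "level V E k m X Y"
    and Z: "sep_steps V E k X Z" "sep_steps V E k Z Z'" "sep_steps V E k Z' Y"
      "sep_order Z = m" "sep_order Z' = m"
  shows "\<exists>P. linked E (fst Z \<inter> snd Z) (fst Z' \<inter> snd Z') m P"
proof (rule menger[OF V])
  have sep: "separation V E X" "separation V E Z" "separation V E Z'"
    using lev Z sep_steps_separation unfolding level_def by metis+
  then show "fst Z \<inter> snd Z \<subseteq> V" "fst Z' \<inter> snd Z' \<subseteq> V" using separation_sub by blast+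
  have le: "sep_le Z Z'" by (rule sep_steps_le) fact
  fix A B
  assume AB: "separation V E (A, B)" "fst Z \<inter> snd Z \<subseteq> A" "fst Z' \<inter> snd Z' \<subseteq> B"
  show "m \<le> card (A \<inter> B)"
  proof (rule ccontr)
    assume lt: "\<not> m \<le> card (A \<inter> B)"
    \<comment> \<open>Forcing \<open>(A, B)\<close> between \<open>Z\<close> and \<open>Z'\<close>
      keeps the adhesion set inside \<open>A \<inter> B\<close>, as \<open>A\<close> contains the
      adhesion set of \<open>Z\<close> and \<open>B\<close> that of \<open>Z'\<close>.\<close>
    define W where "W = sep_join Z (sep_meet (A, B) Z')"
    have W: "separation V E W" "sep_le Z W" "sep_le W Z'"
      using le separation_join[OF sep(2) separation_meet[OF AB(1) sep(3) V(2)] V(2)]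
      by (auto simp: W_def sep_join_def sep_meet_def sep_le_def)
    have "sep_order W \<le> card (A \<inter> B)"
      unfolding sep_order_def
      by (rule card_mono) (use AB le sep V(1) finite_subset[of A V] in
          \<open>auto simp: W_def sep_join_def sep_meet_def sep_le_def separation_def\<close>)
    let ?Q = "\<lambda>W. separation V E W \<and> sep_le Z W \<and> sep_le W Z'"
    define U where "U = (ARG_MIN sep_order W. ?Q W)"
    have U: "?Q U" "\<And>W. ?Q W \<Longrightarrow> sep_order U \<le> sep_order W"
      unfolding U_def using W arg_min_natI[of ?Q W sep_order] arg_min_nat_le[of ?Q _ sep_order] by auto
    have "sep_order U < m" using U(2)[of W] W \<open>sep_order W \<le> card (A \<inter> B)\<close> lt by linarith
    have "sep_steps V E k Z U \<and> sep_steps V E k U Z'"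
      by (rule sep_steps_via_minimal[OF Z(2) V sep(2)]) (use U in auto)
    then have "sep_steps V E k X U" "sep_steps V E k U Y"
      "U = X \<Longrightarrow> Z = X" "U = Y \<Longrightarrow> Z' = Y"
      using Z by (meson rtranclp_trans sep_steps_le sep_le_antisym)+
    \<comment> \<open>If \<open>U\<close> is \<open>X\<close> or \<open>Y\<close>, then it equals
      \<open>Z\<close> or \<open>Z'\<close> and has order \<open>m\<close> anyway.\<close>
    then have "m \<le> sep_order U" using lev Z(4,5) unfolding level_def by (metis order_refl)
    then show False using \<open>sep_order U < m\<close> by simp
  qed
qed

section \<open>Rooted minors and threads\<close>

definition semicomplete_rel :: "'a set \<Rightarrow> ('a \<times> 'a) set \<Rightarrow> bool" where
  "semicomplete_rel V E \<longleftrightarrow> finite V \<and> E \<subseteq> V \<times> V \<and> irrefl E \<and>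
     (\<forall>u\<in>V. \<forall>v\<in>V. u \<noteq> v \<longrightarrow> (u, v) \<in> E \<or> (v, u) \<in> E)"

definition sconn :: "('a \<times> 'a) set \<Rightarrow> 'a set \<Rightarrow> bool" where
  "sconn E S \<longleftrightarrow> S \<noteq> {} \<and> (\<forall>x\<in>S. \<forall>y\<in>S. (x, y) \<in> (E \<inter> S \<times> S)\<^sup>*)"

lemma sconnI:
  assumes "r \<in> S" "\<And>y. y \<in> S \<Longrightarrow> (r, y) \<in> (E \<inter> S \<times> S)\<^sup>*" "\<And>y. y \<in> S \<Longrightarrow> (y, r) \<in> (E \<inter> S \<times> S)\<^sup>*"
  shows "sconn E S"
  using assms unfolding sconn_def by (meson empty_iff rtrancl_trans)

lemma sconn_singleton [simp]: "sconn E {x}"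
  by (auto simp: sconn_def)

lemma sconn_reach_mono:
  assumes "sconn E S" "x \<in> S" "y \<in> S" "S \<subseteq> T"
  shows "(x, y) \<in> (E \<inter> T \<times> T)\<^sup>*"
proof -
  have "(E \<inter> S \<times> S)\<^sup>* \<subseteq> (E \<inter> T \<times> T)\<^sup>*" by (rule rtrancl_mono) (use assms(4) in auto)
  then show ?thesis using assms by (auto simp: sconn_def)
qed

lemma sconn_Un:
  assumes "sconn E S" "sconn E T" "S \<inter> T \<noteq> {}"
  shows "sconn E (S \<union> T)"
proof -
  obtain r where r: "r \<in> S" "r \<in> T" using assms(3) by blast
  show ?thesis
    by (rule sconnI[of r])
      (use r sconn_reach_mono[OF assms(1), of _ _ "S \<union> T"] sconn_reach_mono[OF assms(2), of _ _ "S \<union> T"]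
       in auto)
qed

text \<open>Backward steps of two lead down to \<open>lo\<close> or \<open>Suc lo\<close>. From
  \<open>Suc lo\<close>, one step forward and one such step back reach \<open>lo\<close>; this
  detour needs a position above \<open>Suc lo\<close>, which length one does not have.\<close>

lemma sconn_segment:
  fixes p :: "nat \<Rightarrow> 'a"
  assumes le: "lo \<le> hi" and ne: "hi \<noteq> Suc lo"
    and fwd: "\<And>t. lo \<le> t \<Longrightarrow> t < hi \<Longrightarrow> (p t, p (Suc t)) \<in> E"
    and bwd: "\<And>t. lo \<le> t \<Longrightarrow> Suc (Suc t) \<le> hi \<Longrightarrow> (p (Suc (Suc t)), p t) \<in> E"
  shows "sconn E (p ` {lo..hi})"
proof -
  let ?S = "p ` {lo..hi}"
  let ?R = "E \<inter> ?S \<times> ?S"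
  have f: "(p t, p (Suc t)) \<in> ?R" if "lo \<le> t" "t < hi" for t using that fwd by auto
  have b: "(p (Suc (Suc t)), p t) \<in> ?R" if "lo \<le> t" "Suc (Suc t) \<le> hi" for t using that bwd by auto
  have from_lo: "(p lo, p t) \<in> ?R\<^sup>*" if "lo \<le> t" "t \<le> hi" for t
    using that
  proof (induction rule: dec_induct)
    case (step t)
    then show ?case using f[of t] by (auto intro: rtrancl_into_rtrancl)
  qed simp
  have to_lo: "(p t, p lo) \<in> ?R\<^sup>*" if "lo \<le> t" "t \<le> hi" for t
    using that
  proof (induction t rule: less_induct)
    case (less t)
    have "t = lo \<or> t = Suc lo \<or> (t = Suc (Suc (t - 2)) \<and> lo \<le> t - 2)"
      using less.prems(1) by arith
    then consider "t = lo" | "t = Suc lo" | s where "t = Suc (Suc s)" "lo \<le> s" by blast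
    then show ?case
    proof cases
      case 1
      then show ?thesis by simp
    next
      case 2
      then have "Suc t \<le> hi" using less.prems ne by linarith
      then have "(p t, p (Suc t)) \<in> ?R" "(p (Suc t), p lo) \<in> ?R" using f[of t] b[of lo] 2 by auto
      then show ?thesis by (meson converse_rtrancl_into_rtrancl r_into_rtrancl)
    next
      case 3
      then have "(p s, p lo) \<in> ?R\<^sup>*" using less by auto
      moreover have "(p t, p s) \<in> ?R" using b[of s] 3 less.prems by auto
      ultimately show ?thesis by (rule converse_rtrancl_into_rtrancl[rotated])
    qed
  qed
  show ?thesis by (rule sconnI[of "p lo"]) (use le from_lo to_lo in auto)
qed

text \<open>The two lists are the left and right boundary of a piece. Roots of the host lie in the
  branch sets of the roots with the same index, so that maps of adjacent pieces overlap in the right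
  branch sets.\<close>

definition rooted_minor_map :: "('a \<Rightarrow> 'b set) \<Rightarrow> 'a set \<Rightarrow> ('a \<times> 'a) set \<Rightarrow> 'a list \<Rightarrow> 'a list \<Rightarrow>
    'b set \<Rightarrow> ('b \<times> 'b) set \<Rightarrow> 'b list \<Rightarrow> 'b list \<Rightarrow> bool" where
  "rooted_minor_map \<phi> W E xs ys W' E' xs' ys' \<longleftrightarrow>
     (\<forall>v\<in>W. \<phi> v \<subseteq> W' \<and> sconn E' (\<phi> v)) \<and>
     (\<forall>u\<in>W. \<forall>v\<in>W. u \<noteq> v \<longrightarrow> \<phi> u \<inter> \<phi> v = {}) \<and>
     (\<forall>u\<in>W. \<forall>v\<in>W. (u, v) \<in> E \<longrightarrow> (\<exists>x\<in>\<phi> u. \<exists>y\<in>\<phi> v. (x, y) \<in> E')) \<and>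
     list_all2 (\<lambda>x x'. x' \<in> \<phi> x) xs xs' \<and> list_all2 (\<lambda>y y'. y' \<in> \<phi> y) ys ys'"

definition rooted_minor :: "'a set \<Rightarrow> ('a \<times> 'a) set \<Rightarrow> 'a list \<Rightarrow> 'a list \<Rightarrow>
    'b set \<Rightarrow> ('b \<times> 'b) set \<Rightarrow> 'b list \<Rightarrow> 'b list \<Rightarrow> bool" where
  "rooted_minor W E xs ys W' E' xs' ys' \<longleftrightarrow> (\<exists>\<phi>. rooted_minor_map \<phi> W E xs ys W' E' xs' ys')"

lemma rooted_minor_restrict:
  assumes "rooted_minor W E xs ys W' E' xs' ys'"
    and "\<And>u v. u \<in> W \<Longrightarrow> v \<in> W \<Longrightarrow> (u, v) \<in> F \<Longrightarrow> (u, v) \<in> E"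
  shows "rooted_minor W F xs ys W' E' xs' ys'"
proof -
  obtain \<phi> where "rooted_minor_map \<phi> W E xs ys W' E' xs' ys'"
    using assms(1) unfolding rooted_minor_def by blast
  then have "rooted_minor_map \<phi> W F xs ys W' E' xs' ys'"
    using assms(2) unfolding rooted_minor_map_def by simp
  then show ?thesis unfolding rooted_minor_def by blast
qed

text \<open>Branch sets of the two maps meet only in the common boundary of the host, and there only
  for the same vertex of the minor. So unions stay strongly connected and disjoint. Edges from the
  right strict side to the left one are realised by \<open>full\<close>.\<close>

lemma rooted_minor_glue:
  assumes m1: "rooted_minor W1 E1 xs zs W1' E' xs' zs'"
    and m2: "rooted_minor W2 E2 zs ys W2' E' zs' ys'"
    and roots: "set xs \<subseteq> W1" "set ys \<subseteq> W2" "set zs = W1 \<inter> W2" "set zs' = W1' \<inter> W2'"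
    and edges: "\<And>u v. u \<in> W1 \<union> W2 \<Longrightarrow> v \<in> W1 \<union> W2 \<Longrightarrow> (u, v) \<in> E \<Longrightarrow>
        u \<in> W1 \<and> v \<in> W1 \<and> (u, v) \<in> E1 \<or> u \<in> W2 \<and> v \<in> W2 \<and> (u, v) \<in> E2 \<or>
        u \<in> W2 - W1 \<and> v \<in> W1 - W2"
    and full: "\<And>x y. x \<in> W2' - W1' \<Longrightarrow> y \<in> W1' - W2' \<Longrightarrow> (x, y) \<in> E'"
  shows "rooted_minor (W1 \<union> W2) E xs ys (W1' \<union> W2') E' xs' ys'"
proof -
  obtain f where "rooted_minor_map f W1 E1 xs zs W1' E' xs' zs'"
    using m1 unfolding rooted_minor_def by blast
  then have f: "\<And>v. v \<in> W1 \<Longrightarrow> f v \<subseteq> W1'" "\<And>v. v \<in> W1 \<Longrightarrow> sconn E' (f v)"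
    "\<And>u v. u \<in> W1 \<Longrightarrow> v \<in> W1 \<Longrightarrow> u \<noteq> v \<Longrightarrow> f u \<inter> f v = {}"
    "\<And>u v. u \<in> W1 \<Longrightarrow> v \<in> W1 \<Longrightarrow> (u, v) \<in> E1 \<Longrightarrow> \<exists>x\<in>f u. \<exists>y\<in>f v. (x, y) \<in> E'"
    "list_all2 (\<lambda>x x'. x' \<in> f x) xs xs'" "list_all2 (\<lambda>x x'. x' \<in> f x) zs zs'"
    unfolding rooted_minor_map_def by blast+
  obtain g where "rooted_minor_map g W2 E2 zs ys W2' E' zs' ys'"
    using m2 unfolding rooted_minor_def by blast
  then have g: "\<And>v. v \<in> W2 \<Longrightarrow> g v \<subseteq> W2'" "\<And>v. v \<in> W2 \<Longrightarrow> sconn E' (g v)"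
    "\<And>u v. u \<in> W2 \<Longrightarrow> v \<in> W2 \<Longrightarrow> u \<noteq> v \<Longrightarrow> g u \<inter> g v = {}"
    "\<And>u v. u \<in> W2 \<Longrightarrow> v \<in> W2 \<Longrightarrow> (u, v) \<in> E2 \<Longrightarrow> \<exists>x\<in>g u. \<exists>y\<in>g v. (x, y) \<in> E'"
    "list_all2 (\<lambda>x x'. x' \<in> g x) zs zs'" "list_all2 (\<lambda>x x'. x' \<in> g x) ys ys'"
    unfolding rooted_minor_map_def by blast+
  define h where "h v = (if v \<in> W1 then f v else {}) \<union> (if v \<in> W2 then g v else {})" for v
  have common: "\<exists>z \<in> W1 \<inter> W2. x \<in> f z \<and> x \<in> g z" if "x \<in> W1' \<inter> W2'" for x
  proof -
    have "x \<in> set zs'" using that roots(4) by simp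
    then obtain i where i: "i < length zs'" "x = zs' ! i" by (auto simp: in_set_conv_nth)
    then have "i < length zs" "x \<in> f (zs ! i)" "x \<in> g (zs ! i)"
      using f(6) g(5) by (auto simp: list_all2_conv_all_nth)
    then show ?thesis using roots(3) nth_mem by blast
  qed
  have meet: "f z \<inter> g z \<noteq> {}" if "z \<in> W1 \<inter> W2" for z
  proof -
    have "z \<in> set zs" using that roots(3) by simp
    then obtain i where i: "i < length zs" "z = zs ! i" by (auto simp: in_set_conv_nth)
    then have "zs' ! i \<in> f z" "zs' ! i \<in> g z"
      using f(6) g(5) by (simp_all add: list_all2_conv_all_nth)
    then show ?thesis by blast
  qed
  have inter: "u = v" if uv: "u \<in> W1" "v \<in> W2" "x \<in> f u" "x \<in> g v" for u v x
  proof -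
    have "x \<in> W1' \<inter> W2'" using f(1)[OF uv(1)] g(1)[OF uv(2)] uv by blast
    then obtain z where z: "z \<in> W1" "z \<in> W2" "x \<in> f z" "x \<in> g z" using common[of x] by blast
    then have "u = z" "v = z" using f(3)[of u z] g(3)[of v z] uv by blast+
    then show ?thesis by simp
  qed
  have "rooted_minor_map h (W1 \<union> W2) E xs ys (W1' \<union> W2') E' xs' ys'"
    unfolding rooted_minor_map_def
  proof (intro conjI ballI impI)
    fix v assume v: "v \<in> W1 \<union> W2"
    then show "h v \<subseteq> W1' \<union> W2'" using f(1) g(1) by (auto simp: h_def)
    show "sconn E' (h v)"
      using v f(2)[of v] g(2)[of v] meet[of v] by (auto simp: h_def intro: sconn_Un)
  next
    fix u v assume uv: "u \<in> W1 \<union> W2" "v \<in> W1 \<union> W2" "u \<noteq> v"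
    show "h u \<inter> h v = {}"
    proof (rule ccontr)
      assume "h u \<inter> h v \<noteq> {}"
      then obtain x where x: "x \<in> h u" "x \<in> h v" by blast
      have "u \<in> W1 \<and> x \<in> f u \<or> u \<in> W2 \<and> x \<in> g u" "v \<in> W1 \<and> x \<in> f v \<or> v \<in> W2 \<and> x \<in> g v"
        using x by (auto simp: h_def split: if_splits)
      then show False using uv(3) inter[of u v x] inter[of v u x] f(3)[of u v] g(3)[of u v] by blast
    qed
  next
    fix u v assume uv: "u \<in> W1 \<union> W2" "v \<in> W1 \<union> W2" "(u, v) \<in> E"
    consider "u \<in> W1" "v \<in> W1" "(u, v) \<in> E1" | "u \<in> W2" "v \<in> W2" "(u, v) \<in> E2"
      | "u \<in> W2 - W1" "v \<in> W1 - W2" using edges[OF uv] by blast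
    then show "\<exists>x\<in>h u. \<exists>y\<in>h v. (x, y) \<in> E'"
    proof cases
      case 1
      then show ?thesis using f(4)[OF 1] by (auto simp: h_def)
    next
      case 2
      then show ?thesis using g(4)[OF 2] by (auto simp: h_def)
    next
      case 3
      obtain x y where xy: "x \<in> g u" "y \<in> f v"
        using 3 f(2)[of v] g(2)[of u] by (auto simp: sconn_def)
      have "x \<notin> W1'"
      proof
        assume "x \<in> W1'"
        then obtain z where "z \<in> W1" "z \<in> W2" "x \<in> g z" using common[of x] g(1)[of u] 3 xy by blast
        then show False using g(3)[of u z] 3 xy by blast
      qed
      moreover have "y \<notin> W2'"
      proof
        assume "y \<in> W2'"
        then obtain z where "z \<in> W1" "z \<in> W2" "y \<in> f z" using common[of y] f(1)[of v] 3 xy by blast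
        then show False using f(3)[of v z] 3 xy by blast
      qed
      ultimately have "(x, y) \<in> E'" using full[of x y] f(1)[of v] g(1)[of u] 3 xy by blast
      then show ?thesis using xy 3 by (auto simp: h_def)
    qed
  next
    show "list_all2 (\<lambda>x x'. x' \<in> h x) xs xs'"
      by (rule list.rel_mono_strong[OF f(5)]) (use roots(1) in \<open>auto simp: h_def\<close>)
    show "list_all2 (\<lambda>x x'. x' \<in> h x) ys ys'"
      by (rule list.rel_mono_strong[OF g(6)]) (use roots(2) in \<open>auto simp: h_def\<close>)
  qed
  then show ?thesis unfolding rooted_minor_def by blast
qed

definition bag :: "'a set \<times> 'a set \<Rightarrow> 'a set \<times> 'a set \<Rightarrow> 'a set" where
  "bag X Y = fst Y \<inter> snd X"

text \<open>\<open>F\<close> collects the edges to be realised, \<open>E1\<close> and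
  \<open>E2\<close> those realised by the parts; an edge inside both bags may be left to either
  part. The separations exclude edges of \<open>F\<close> forwards across \<open>Z\<close> and
  supply all edges of the host backwards across \<open>Z'\<close>.\<close>

lemma rooted_minor_concat:
  assumes m1: "rooted_minor (bag X Z) E1 xs zs (bag X' Z') E' xs' zs'"
    and m2: "rooted_minor (bag Z Y) E2 zs ys (bag Z' Y') E' zs' ys'"
    and sepH: "separation V E Z" "sep_le X Z" "sep_le Z Y" "fst Y \<subseteq> V"
    and sepG: "separation V' E' Z'" "sep_le X' Z'" "sep_le Z' Y'" "fst Y' \<subseteq> V'"
    and sem: "semicomplete_rel V' E'"
    and roots: "set xs \<subseteq> bag X Z" "set ys \<subseteq> bag Z Y" "set zs = bag Z Z" "set zs' = bag Z' Z'"
    and edges: "\<And>u v. (u, v) \<in> F \<Longrightarrow> (u, v) \<in> E"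
      "\<And>u v. u \<in> bag X Z \<Longrightarrow> v \<in> bag X Z \<Longrightarrow> (u, v) \<in> F \<Longrightarrow>
         (u, v) \<in> E1 \<or> u \<in> bag Z Y \<and> v \<in> bag Z Y \<and> (u, v) \<in> E2"
      "\<And>u v. u \<in> bag Z Y \<Longrightarrow> v \<in> bag Z Y \<Longrightarrow> (u, v) \<in> F \<Longrightarrow>
         (u, v) \<in> E2 \<or> u \<in> bag X Z \<and> v \<in> bag X Z \<and> (u, v) \<in> E1"
  shows "rooted_minor (bag X Y) F xs ys (bag X' Y') E' xs' ys'"
proof -
  have un: "bag X Z \<union> bag Z Y = bag X Y"
    using sepH unfolding bag_def separation_def sep_le_def by blast
  have un': "bag X' Z' \<union> bag Z' Y' = bag X' Y'"
    using sepG unfolding bag_def separation_def sep_le_def by blast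
  show ?thesis
    unfolding un[symmetric] un'[symmetric]
  proof (rule rooted_minor_glue[OF m1 m2 roots(1,2)])
    show "set zs = bag X Z \<inter> bag Z Y" "set zs' = bag X' Z' \<inter> bag Z' Y'"
      using roots(3,4) sepH(2,3) sepG(2,3) by (auto simp: bag_def sep_le_def)
  next
    fix x y assume xy: "x \<in> bag Z' Y' - bag X' Z'" "y \<in> bag X' Z' - bag Z' Y'"
    then have "x \<in> snd Z' - fst Z'" "y \<in> fst Z' - snd Z'"
      using sepG(2,3) by (auto simp: bag_def sep_le_def)
    then have "x \<noteq> y" "(y, x) \<notin> E'" "x \<in> V'" "y \<in> V'"
      using sepG(1) by (auto simp: separation_def)
    then show "(x, y) \<in> E'" using sem unfolding semicomplete_rel_def by blast
  next
    fix u v assume uv: "u \<in> bag X Z \<union> bag Z Y" "v \<in> bag X Z \<union> bag Z Y" "(u, v) \<in> F"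
    have "\<not> (u \<in> bag X Z - bag Z Y \<and> v \<in> bag Z Y - bag X Z)"
    proof
      assume *: "u \<in> bag X Z - bag Z Y \<and> v \<in> bag Z Y - bag X Z"
      then have "u \<in> fst Z - snd Z" "v \<in> snd Z - fst Z"
        using sepH(2,3) by (auto simp: bag_def sep_le_def)
      then show False using sepH(1) edges(1)[OF uv(3)] by (auto simp: separation_def)
    qed
    then show "u \<in> bag X Z \<and> v \<in> bag X Z \<and> (u, v) \<in> E1 \<or> u \<in> bag Z Y \<and> v \<in> bag Z Y \<and> (u, v) \<in> E2 \<or>
        u \<in> bag Z Y - bag X Z \<and> v \<in> bag X Z - bag Z Y"
      using uv edges(2,3) by blast
  qed
qed

text \<open>Every path has to meet the adhesion set, which has only as many vertices as there are
  paths. So each path meets it once; before that it cannot leave \<open>A - B\<close>, and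
  afterwards it could not get from \<open>A - B\<close> to its end in \<open>B\<close>.\<close>

lemma thread_crossing:
  assumes sep: "separation V E (A, B)" "finite V" "card (A \<inter> B) = m" "E \<subseteq> V \<times> V"
    and P: "linked E X Y m P" "X \<subseteq> A" "Y \<subseteq> B"
  shows "\<exists>pos. (\<lambda>j. P j ! pos j) ` {..<m} = A \<inter> B \<and> (\<forall>j<m. pos j < length (P j) \<and>
     (\<forall>t<pos j. P j ! t \<in> A - B) \<and> (\<forall>t. pos j < t \<longrightarrow> t < length (P j) \<longrightarrow> P j ! t \<in> B - A))"
proof -
  note s = separationD[OF sep(1)]
  have path: "P j \<noteq> []" "distinct (P j)" "\<And>t. Suc t < length (P j) \<Longrightarrow> (P j ! t, P j ! Suc t) \<in> E"
    "P j ! 0 \<in> A" "P j ! (length (P j) - 1) \<in> B" if "j < m" for j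
    using P that unfolding linked_def dpath_def
    by (auto simp: successively_conv_nth hd_conv_nth last_conv_nth)
  have hit: "\<exists>t<length (P j). P j ! t \<in> A \<inter> B" if "j < m" for j
  proof (rule ccontr)
    assume no: "\<not> ?thesis"
    have "P j ! t \<in> A - B" if "t < length (P j)" for t
      using that
    proof (induction t)
      case 0
      then show ?case using path(4)[OF \<open>j < m\<close>] no by auto
    next
      case (Suc t)
      then have "P j ! t \<in> A - B" "(P j ! t, P j ! Suc t) \<in> E" using path(3)[OF \<open>j < m\<close>] by auto
      moreover have "P j ! Suc t \<in> V" using calculation sep(4) by auto
      ultimately show ?case using s no Suc.prems by auto
    qed
    then show False using path(1,5)[OF \<open>j < m\<close>] by auto
  qed
  then obtain pos where pos: "\<And>j. j < m \<Longrightarrow> pos j < length (P j) \<and> P j ! pos j \<in> A \<inter> B" by metis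
  have disj: "set (P i) \<inter> set (P j) = {}" if "i < m" "j < m" "i \<noteq> j" for i j
    using P(1) that by (auto simp: linked_def)
  have inj: "inj_on (\<lambda>j. P j ! pos j) {..<m}"
  proof (rule inj_onI)
    fix i j assume ij: "i \<in> {..<m}" "j \<in> {..<m}" "P i ! pos i = P j ! pos j"
    then have "P i ! pos i \<in> set (P i)" "P j ! pos j \<in> set (P j)"
      using pos[of i] pos[of j] nth_mem by blast+
    then show "i = j" using disj[of i j] ij by auto
  qed
  have finS: "finite (A \<inter> B)" using s(1) sep(2) by auto
  have im: "(\<lambda>j. P j ! pos j) ` {..<m} = A \<inter> B"
    by (rule card_seteq[OF finS]) (use pos inj sep(3) in \<open>auto simp: card_image\<close>)
  have uniq: "t = pos j" if "j < m" "t < length (P j)" "P j ! t \<in> A \<inter> B" for j t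
  proof -
    have "P j ! t \<in> (\<lambda>j. P j ! pos j) ` {..<m}" using that(3) im by simp
    then obtain i where i: "i < m" "P j ! t = P i ! pos i" by auto
    have "P j ! t \<in> set (P j)" using that(2) by simp
    moreover have "P j ! t \<in> set (P i)" using i pos[of i] by simp
    ultimately
    have "i = j" using disj[of i j] i(1) that(1) by blast
    then show ?thesis using i that pos[of j] path(2)[of j] by (simp add: nth_eq_iff_index_eq)
  qed
  have before: "P j ! t \<in> A - B" if "j < m" "t < pos j" for j t
    using that(2)
  proof (induction t)
    case 0
    then show ?case using path(1,4)[OF that(1)] uniq[OF that(1), of 0] by auto
  next
    case (Suc t)
    then have "P j ! t \<in> A - B" "(P j ! t, P j ! Suc t) \<in> E"
      using path(3)[OF that(1)] pos[OF that(1)] by auto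
    moreover have "P j ! Suc t \<in> V" using calculation sep(4) by auto
    ultimately show ?case
      using s uniq[OF that(1), of "Suc t"] pos[OF that(1)] Suc.prems by auto
  qed
  have after: "P j ! t \<in> B - A" if "j < m" "pos j < t" "t < length (P j)" for j t
  proof (rule ccontr)
    assume no: "P j ! t \<notin> B - A"
    have "0 < t" using that(2) by simp
    then have "(P j ! (t - 1), P j ! t) \<in> E" using path(3)[OF that(1), of "t - 1"] that(3) by simp
    then have "P j ! t \<in> A - B" using no uniq[OF that(1,3)] that(2) sep(4) s(1) by auto
    have "P j ! t' \<in> A - B" if "t \<le> t'" "t' < length (P j)" for t'
      using that
    proof (induction rule: dec_induct)
      case base
      show ?case by fact
    next
      case (step t')
      then have "P j ! t' \<in> A - B" "(P j ! t', P j ! Suc t') \<in> E" using path(3)[OF \<open>j < m\<close>] by auto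
      moreover have "P j ! Suc t' \<in> V" using calculation sep(4) by auto
      ultimately show ?case
        using s uniq[OF \<open>j < m\<close>, of "Suc t'"] step \<open>pos j < t\<close> by auto
    qed
    from this[of "length (P j) - 1"] show False using path(5)[OF that(1)] that(3) by auto
  qed
  show ?thesis using im pos before after by blast
qed

section \<open>Threads through a chain of separations\<close>

definition threading :: "('a \<times> 'a) set \<Rightarrow> (nat \<Rightarrow> 'a set \<times> 'a set) \<Rightarrow> nat \<Rightarrow> nat \<Rightarrow>
    (nat \<Rightarrow> 'a list) \<Rightarrow> (nat \<Rightarrow> nat \<Rightarrow> nat) \<Rightarrow> bool" where
  "threading E Z n m P pos \<longleftrightarrow>
     (\<forall>j<m. dpath E (P j) \<and> (\<forall>a b. Suc a < b \<longrightarrow> b < length (P j) \<longrightarrow> (P j ! a, P j ! b) \<notin> E)) \<and>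
     (\<forall>i<m. \<forall>j<m. i \<noteq> j \<longrightarrow> set (P i) \<inter> set (P j) = {}) \<and>
     (\<forall>a\<le>n. (\<lambda>j. P j ! pos a j) ` {..<m} = bag (Z a) (Z a) \<and>
       (\<forall>j<m. pos a j < length (P j) \<and> (\<forall>t<pos a j. P j ! t \<in> fst (Z a) - snd (Z a)) \<and>
         (\<forall>t. pos a j < t \<longrightarrow> t < length (P j) \<longrightarrow> P j ! t \<in> snd (Z a) - fst (Z a))))"

text \<open>Listing every adhesion set by thread index puts the \<open>j\<close>-th roots of all
  pieces on the same thread.\<close>

definition roots :: "nat \<Rightarrow> (nat \<Rightarrow> 'a list) \<Rightarrow> (nat \<Rightarrow> nat \<Rightarrow> nat) \<Rightarrow> nat \<Rightarrow> 'a list" where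
  "roots m P pos a = map (\<lambda>j. P j ! pos a j) [0..<m]"

definition colours :: "nat \<Rightarrow> (nat \<Rightarrow> nat \<Rightarrow> nat) \<Rightarrow> nat \<Rightarrow> bool list" where
  "colours m pos a = map (\<lambda>j. odd (pos a j)) [0..<m]"

lemma threading_exists:
  assumes V: "finite V" "E \<subseteq> V \<times> V"
    and Z: "\<And>a. a \<le> n \<Longrightarrow> separation V E (Z a) \<and> sep_order (Z a) = m"
      "\<And>a. a \<le> n \<Longrightarrow> sep_le (Z 0) (Z a) \<and> sep_le (Z a) (Z n)"
    and P: "linked E (bag (Z 0) (Z 0)) (bag (Z n) (Z n)) m P"
  shows "\<exists>Q pos. threading E Z n m Q pos"
proof -
  let ?C = "\<lambda>j q. dpath E q \<and> hd q = hd (P j) \<and> last q = last (P j) \<and> set q \<subseteq> set (P j) \<and>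
    (\<forall>a b. Suc a < b \<longrightarrow> b < length q \<longrightarrow> (q ! a, q ! b) \<notin> E)"
  define Q where "Q j = (SOME q. ?C j q)" for j
  have Q: "?C j (Q j)" if "j < m" for j
    unfolding Q_def by (rule someI_ex, rule chordless_dpath) (use P that in \<open>simp add: linked_def\<close>)
  have disj: "set (Q i) \<inter> set (Q j) = {}" if "i < m" "j < m" "i \<noteq> j" for i j
  proof -
    have "set (P i) \<inter> set (P j) = {}" using P that by (simp add: linked_def)
    then show ?thesis using Q[OF that(1)] Q[OF that(2)] by blast
  qed
  have lQ: "linked E (bag (Z 0) (Z 0)) (bag (Z n) (Z n)) m Q"
    using Q disj P unfolding linked_def by simp
  let ?D = "\<lambda>a pos. (\<lambda>j. Q j ! pos j) ` {..<m} = bag (Z a) (Z a) \<and> (\<forall>j<m. pos j < length (Q j) \<and>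
     (\<forall>t<pos j. Q j ! t \<in> fst (Z a) - snd (Z a)) \<and>
     (\<forall>t. pos j < t \<longrightarrow> t < length (Q j) \<longrightarrow> Q j ! t \<in> snd (Z a) - fst (Z a)))"
  define pos where "pos a = (SOME pos. ?D a pos)" for a
  have pos: "?D a (pos a)" if "a \<le> n" for a
  proof -
    have "\<exists>pos. ?D a pos"
      unfolding bag_def
      by (rule thread_crossing[OF _ V(1) _ V(2) lQ])
        (use Z(1)[OF that] Z(2)[OF that] in \<open>auto simp: sep_order_def bag_def sep_le_def\<close>)
    then show ?thesis unfolding pos_def by (rule someI_ex)
  qed
  have "threading E Z n m Q pos"
    unfolding threading_def using Q disj pos by simp
  then show ?thesis by blast
qed

lemma roots_props:
  assumes "threading E Z n m P pos" "a \<le> n"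
  shows "length (roots m P pos a) = m" "set (roots m P pos a) = bag (Z a) (Z a)"
    "distinct (roots m P pos a)"
proof -
  show "length (roots m P pos a) = m" "set (roots m P pos a) = bag (Z a) (Z a)"
    using assms by (auto simp: roots_def threading_def atLeast0LessThan)
  have mem: "P j ! pos a j \<in> set (P j)" if "j < m" for j
    using assms that unfolding threading_def by auto
  have disj: "set (P i) \<inter> set (P j) = {}" if "i < m" "j < m" "i \<noteq> j" for i j
    using assms that unfolding threading_def by blast
  have "inj_on (\<lambda>j. P j ! pos a j) {0..<m}"
  proof (rule inj_onI)
    fix i j assume ij: "i \<in> {0..<m}" "j \<in> {0..<m}" "P i ! pos a i = P j ! pos a j"
    then show "i = j" using mem[of i] mem[of j] disj[of i j] by auto
  qed
  then show "distinct (roots m P pos a)" by (simp add: roots_def distinct_map)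
qed

text \<open>
  Equal colours at both ends exclude segments of length one, the only ones that need not be strongly
  connected.
\<close>

lemma thread_skip:
  assumes thr: "threading E Z n m P pos" and sem: "semicomplete_rel V E"
    and ab: "a \<le> b" "b \<le> n" "sep_le (Z a) (Z b)"
    and col: "colours m pos a = colours m pos b"
    and zs: "distinct zs" "length zs = m"
  shows "rooted_minor (set zs) {} zs zs (bag (Z a) (Z b)) E (roots m P pos a) (roots m P pos b)"
proof -
  have P: "\<And>j. j < m \<Longrightarrow> dpath E (P j)"
    "\<And>j a b. j < m \<Longrightarrow> Suc a < b \<Longrightarrow> b < length (P j) \<Longrightarrow> (P j ! a, P j ! b) \<notin> E"
    "\<And>i j. i < m \<Longrightarrow> j < m \<Longrightarrow> i \<noteq> j \<Longrightarrow> set (P i) \<inter> set (P j) = {}"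
    using thr by (simp_all add: threading_def)
  have im: "(\<lambda>j. P j ! pos a j) ` {..<m} = bag (Z a) (Z a)" if "a \<le> n" for a
    using thr that unfolding threading_def by blast
  have pos: "pos a j < length (P j)" "\<And>t. t < pos a j \<Longrightarrow> P j ! t \<in> fst (Z a) - snd (Z a)"
    "\<And>t. pos a j < t \<Longrightarrow> t < length (P j) \<Longrightarrow> P j ! t \<in> snd (Z a) - fst (Z a)"
    "P j ! pos a j \<in> fst (Z a) \<inter> snd (Z a)" if "a \<le> n" "j < m" for a j
    using thr that im[OF that(1)] unfolding threading_def bag_def by blast+
  have an: "a \<le> n" using ab by simp
  \<comment> \<open>Threads cross the separations in their order: a crossing of \<open>Z b\<close>
    before that of \<open>Z a\<close> would lie outside \<open>snd (Z a)\<close>, which contains the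
    adhesion set of \<open>Z b\<close>.\<close>
  have posle: "pos a j \<le> pos b j" if "j < m" for j
  proof (rule ccontr)
    assume "\<not> pos a j \<le> pos b j"
    then have "P j ! pos b j \<notin> snd (Z a)" using pos(2)[OF an that] by simp
    then show False using pos(4)[OF ab(2) that] ab(3) by (auto simp: sep_le_def)
  qed
  have parity: "odd (pos a j) = odd (pos b j)" if "j < m" for j
    using arg_cong[OF col, of "\<lambda>xs. xs ! j"] that by (simp add: colours_def)
  define seg where "seg j = (\<lambda>t. P j ! t) ` {pos a j..pos b j}" for j
  have seg_set: "seg j \<subseteq> set (P j)" if "j < m" for j
    using pos(1)[OF ab(2) that] by (auto simp: seg_def)
  have seg_bag: "seg j \<subseteq> bag (Z a) (Z b)" if "j < m" for j
  proof
    fix x assume "x \<in> seg j"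
    then obtain t where t: "x = P j ! t" "pos a j \<le> t" "t \<le> pos b j" by (auto simp: seg_def)
    have "t < length (P j)" using t pos(1)[OF ab(2) that] by simp
    then have "x \<in> snd (Z a)"
      using pos(3,4)[OF an that] t by (cases "t = pos a j") auto
    moreover have "x \<in> fst (Z b)"
      using pos(2,4)[OF ab(2) that] t by (cases "t = pos b j") auto
    ultimately
    show "x \<in> bag (Z a) (Z b)" by (simp add: bag_def)
  qed
  have seg_sc: "sconn E (seg j)" if "j < m" for j
    unfolding seg_def
  proof (rule sconn_segment)
    have d: "distinct (P j)" "successively (\<lambda>u v. (u, v) \<in> E) (P j)"
      using P(1)[OF that] by (auto simp: dpath_def)
    show "pos a j \<le> pos b j" by (rule posle) fact
    show "pos b j \<noteq> Suc (pos a j)" using parity[OF that] by auto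
    show fwd: "(P j ! t, P j ! Suc t) \<in> E" if "pos a j \<le> t" "t < pos b j" for t
      using d that pos(1)[OF ab(2) \<open>j < m\<close>] by (auto simp: successively_conv_nth)
    show "(P j ! Suc (Suc t), P j ! t) \<in> E" if t: "pos a j \<le> t" "Suc (Suc t) \<le> pos b j" for t
    proof -
      have "P j ! t \<noteq> P j ! Suc (Suc t)"
        using d(1) t pos(1)[OF ab(2) \<open>j < m\<close>] by (subst nth_eq_iff_index_eq) auto
      moreover have "(P j ! t, P j ! Suc (Suc t)) \<notin> E"
        using P(2)[OF \<open>j < m\<close>, of t "Suc (Suc t)"] t pos(1)[OF ab(2) \<open>j < m\<close>] by auto
      moreover have "P j ! t \<in> V" "P j ! Suc (Suc t) \<in> V"
        using fwd[of t] fwd[of "Suc t"] t sem by (auto simp: semicomplete_rel_def)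
      ultimately show ?thesis using sem by (auto simp: semicomplete_rel_def)
    qed
  qed
  define \<phi> where "\<phi> v = \<Union> {seg j | j. j < m \<and> zs ! j = v}" for v
  have \<phi>: "\<phi> (zs ! j) = seg j" if "j < m" for j
    using that zs by (auto simp: \<phi>_def nth_eq_iff_index_eq)
  have "rooted_minor_map \<phi> (set zs) {} zs zs (bag (Z a) (Z b)) E (roots m P pos a) (roots m P pos b)"
    unfolding rooted_minor_map_def
  proof (intro conjI ballI impI)
    fix v assume "v \<in> set zs"
    then obtain j where "j < m" "v = zs ! j" using zs(2) by (auto simp: in_set_conv_nth)
    then show "\<phi> v \<subseteq> bag (Z a) (Z b)" "sconn E (\<phi> v)" using \<phi> seg_bag seg_sc by auto
  next
    fix u v assume uv: "u \<in> set zs" "v \<in> set zs" "u \<noteq> v"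
    then obtain i j where ij: "i < m" "j < m" "u = zs ! i" "v = zs ! j" using zs(2) by (auto simp: in_set_conv_nth)
    then have "i \<noteq> j" using uv(3) by auto
    then show "\<phi> u \<inter> \<phi> v = {}" using ij \<phi> seg_set[of i] seg_set[of j] P(3)[of i j] by blast
  next
    show "list_all2 (\<lambda>x x'. x' \<in> \<phi> x) zs (roots m P pos a)"
      "list_all2 (\<lambda>x x'. x' \<in> \<phi> x) zs (roots m P pos b)"
      using zs(2) \<phi> posle by (auto simp: list_all2_conv_all_nth roots_def seg_def)
  qed auto
  then show ?thesis unfolding rooted_minor_def by blast
qed

section \<open>Well-quasi-order at bounded width\<close>

type_synonym 'a piece = "'a set \<times> ('a \<times> 'a) set \<times> 'a list \<times> 'a list"

definition piece_le :: "'a piece \<Rightarrow> 'a piece \<Rightarrow> bool" where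
  "piece_le p q = (case p of (W, E, xs, ys) \<Rightarrow> case q of (W', E', xs', ys') \<Rightarrow>
     rooted_minor W E xs ys W' E' xs' ys')"

section \<open>Words of coloured pieces\<close>

type_synonym 'a letter = "'a piece \<times> bool list \<times> bool list"

text \<open>Neighbouring letters of a word share the colours at their common separation. Comparing
  colours by equality therefore gives equal colours at both ends of every gap that an embedding
  leaves between letters of the host.\<close>

definition letter_le :: "'a letter \<Rightarrow> 'a letter \<Rightarrow> bool" where
  "letter_le x y \<longleftrightarrow> piece_le (fst x) (fst y) \<and> snd x = snd y"

definition block :: "('a \<times> 'a) set \<Rightarrow> (nat \<Rightarrow> 'a set \<times> 'a set) \<Rightarrow> nat \<Rightarrow> (nat \<Rightarrow> 'a list) \<Rightarrow>
    (nat \<Rightarrow> nat \<Rightarrow> nat) \<Rightarrow> nat \<Rightarrow> 'a letter" where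
  "block E Z m P pos a = ((bag (Z a) (Z (Suc a)), E, roots m P pos a, roots m P pos (Suc a)),
     colours m pos a, colours m pos (Suc a))"

definition sep_chain :: "'a set \<Rightarrow> ('a \<times> 'a) set \<Rightarrow> nat \<Rightarrow> (nat \<Rightarrow> 'a set \<times> 'a set) \<Rightarrow> bool" where
  "sep_chain V E n Z \<longleftrightarrow> (\<forall>a\<le>n. separation V E (Z a)) \<and>
     (\<forall>a b. a \<le> b \<longrightarrow> b \<le> n \<longrightarrow> sep_le (Z a) (Z b))"

lemma list_emb_Cons_right:
  "list_emb P xs (y # ys) \<longleftrightarrow>
     list_emb P xs ys \<or> (\<exists>x xs'. xs = x # xs' \<and> P x y \<and> list_emb P xs' ys)"
  by (auto elim: list_emb.cases)

text \<open>
  The blocks of the host between \<open>a0\<close> and \<open>a\<close> have been skipped and remain to be bridged by threads.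
  Edges within the last adhesion set are left to the piece that follows.
\<close>

lemma embed_blocks:
  assumes H: "threading E Z n m P pos" "sep_chain V E n Z"
    and G: "threading E' Z' n' m P' pos'" "sep_chain V' E' n' Z'" "semicomplete_rel V' E'"
    and last: "colours m pos n = colours m pos' n'"
    and "a \<le> n'" "a0 \<le> a" "i \<le> n" "colours m pos i = colours m pos' a0"
    and "list_emb letter_le (map (block E Z m P pos) [i..<n]) (map (block E' Z' m P' pos') [a..<n'])"
  shows "rooted_minor (bag (Z i) (Z n)) (E - bag (Z n) (Z n) \<times> bag (Z n) (Z n))
     (roots m P pos i) (roots m P pos n)
     (bag (Z' a0) (Z' n')) E' (roots m P' pos' a0) (roots m P' pos' n')"
  using assms(7-)
proof (induction arbitrary: i a0 rule: inc_induct)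
  have leG: "sep_le (Z' a) (Z' b)" if "a \<le> b" "b \<le> n'" for a b
    using G(2) that by (simp add: sep_chain_def)
  have skip: "rooted_minor (bag (Z i) (Z i)) {} (roots m P pos i) (roots m P pos i)
      (bag (Z' a) (Z' b)) E' (roots m P' pos' a) (roots m P' pos' b)"
    if "i \<le> n" "a \<le> b" "b \<le> n'" "colours m pos' a = colours m pos' b" for i a b
    using thread_skip[OF G(1,3) that(2,3) leG[OF that(2,3)] that(4), of "roots m P pos i"]
      roots_props[OF H(1) that(1)] by simp
  {
    \<comment> \<open>The host word is exhausted, so only the bridge from \<open>a0\<close> to the
      end remains.\<close>
    case base
    have "map (block E Z m P pos) [i..<n] = []"
      using base(4) by (intro list_emb_Nil2[of letter_le]) simp
    then have "i = n" using base(2) by auto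
    have "rooted_minor (bag (Z n) (Z n)) (E - bag (Z n) (Z n) \<times> bag (Z n) (Z n))
        (roots m P pos n) (roots m P pos n)
        (bag (Z' a0) (Z' n')) E' (roots m P' pos' a0) (roots m P' pos' n')"
      by (rule rooted_minor_restrict[OF skip[of n a0 n']]) (use base last \<open>i = n\<close> in auto)
    then show ?case using \<open>i = n\<close> by simp
  next
    case (step a)
    have seps: "sep_le (Z i) (Z j)" if "i \<le> j" "j \<le> n" for i j
      using H(2) that by (simp add: sep_chain_def)
    have upt: "[a..<n'] = a # [Suc a..<n']" using step.hyps by (simp add: upt_conv_Cons)
    let ?w = "map (block E Z m P pos) [i..<n]" and ?w' = "map (block E' Z' m P' pos') [Suc a..<n']"
    have "list_emb letter_le ?w ?w' \<or> (\<exists>x xs. ?w = x # xs \<and>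
        letter_le x (block E' Z' m P' pos' a) \<and> list_emb letter_le xs ?w')"
      using step.prems(4) unfolding upt list.map list_emb_Cons_right .
    then show ?case
    proof (elim disjE exE conjE)
      assume "list_emb letter_le ?w ?w'"
      then show ?thesis using step.IH[of a0 i] step.prems by simp
    next
      fix x xs
      assume hit: "?w = x # xs" "letter_le x (block E' Z' m P' pos' a)" "list_emb letter_le xs ?w'"
      have i: "i < n" using hit(1) by (cases "i < n") auto
      then have x: "x = block E Z m P pos i" "xs = map (block E Z m P pos) [Suc i..<n]"
        using hit(1) by (simp_all add: upt_conv_Cons)
      have le: "rooted_minor (bag (Z i) (Z (Suc i))) E (roots m P pos i) (roots m P pos (Suc i))
          (bag (Z' a) (Z' (Suc a))) E' (roots m P' pos' a) (roots m P' pos' (Suc a))"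
        and col: "colours m pos i = colours m pos' a" "colours m pos (Suc i) = colours m pos' (Suc a)"
        using hit(2) unfolding x by (auto simp: letter_le_def piece_le_def block_def)
      have a: "a \<le> n'" "Suc a \<le> n'" using step.hyps by auto
      have IH: "rooted_minor (bag (Z (Suc i)) (Z n)) (E - bag (Z n) (Z n) \<times> bag (Z n) (Z n))
          (roots m P pos (Suc i)) (roots m P pos n)
          (bag (Z' (Suc a)) (Z' n')) E' (roots m P' pos' (Suc a)) (roots m P' pos' n')"
        by (rule step.IH) (use i col hit(3) x in auto)
      have sub: "fst (Z j) \<subseteq> V" "separation V E (Z j)" if "j \<le> n" for j
        using H(2) that separation_sub[of V E "Z j"] by (auto simp: sep_chain_def)
      have sub': "fst (Z' j) \<subseteq> V'" "separation V' E' (Z' j)" if "j \<le> n'" for j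
        using G(2) that separation_sub[of V' E' "Z' j"] by (auto simp: sep_chain_def)
      have rs: "set (roots m P pos j) = bag (Z j) (Z j)" if "j \<le> n" for j
        using roots_props[OF H(1) that] by simp
      have rs': "set (roots m P' pos' j) = bag (Z' j) (Z' j)" if "j \<le> n'" for j
        using roots_props[OF G(1) that] by simp
      have bags: "bag (Z j) (Z j) \<subseteq> bag (Z i) (Z j)" "bag (Z i) (Z i) \<subseteq> bag (Z i) (Z j)"
        if "i \<le> j" "j \<le> n" for i j
        using seps[OF that] by (auto simp: bag_def sep_le_def)
      \<comment> \<open>The letter at \<open>a\<close> is hit: bridge the gap from \<open>a0\<close>
        to \<open>a\<close>, append the piece of the letter, and continue with an empty gap at
        \<open>Suc a\<close>.\<close>
      have "rooted_minor (bag (Z i) (Z i)) {} (roots m P pos i) (roots m P pos i)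
          (bag (Z' a0) (Z' a)) E' (roots m P' pos' a0) (roots m P' pos' a)"
        by (rule skip) (use i step.prems a col in auto)
      then have one: "rooted_minor (bag (Z i) (Z (Suc i))) E (roots m P pos i) (roots m P pos (Suc i))
          (bag (Z' a0) (Z' (Suc a))) E' (roots m P' pos' a0) (roots m P' pos' (Suc a))"
        by (rule rooted_minor_concat[where V = V and E = E and V' = V', OF _ le])
          (use i a step.prems sub sub' seps leG G(3) rs rs' bags[of i "Suc i"] in auto)
      show ?thesis
        by (rule rooted_minor_concat[where V = V and E = E and V' = V', OF one IH])
          (use i a step.prems sub sub' seps leG G(3) rs rs' bags[of i "Suc i"] bags[of "Suc i" n] in auto)
    qed
  }
qed

text \<open>The end pieces stand apart from the word because their outer roots are arbitrary lists
  and not thread vertices. The colours at \<open>Z 0\<close> and \<open>Z n\<close> take care of the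
  gaps before the first and after the last letter that is hit.\<close>

definition decomposed :: "nat \<Rightarrow> 'a piece \<Rightarrow>
    'a piece \<times> 'a piece \<times> 'a letter list \<times> bool list \<times> bool list \<Rightarrow> bool" where
  "decomposed m x y \<longleftrightarrow> (\<exists>V E X Y xs ys n Z P pos. x = (bag X Y, E, xs, ys) \<and>
     semicomplete_rel V E \<and> fst Y \<subseteq> V \<and> set xs = bag X X \<and> set ys = bag Y Y \<and>
     sep_chain V E n Z \<and> sep_le X (Z 0) \<and> sep_le (Z n) Y \<and> threading E Z n m P pos \<and>
     y = ((bag X (Z 0), E, xs, roots m P pos 0), (bag (Z n) Y, E, roots m P pos n, ys),
          map (block E Z m P pos) [0..<n], colours m pos 0, colours m pos n))"

lemma piece_le_decomposed:
  fixes x x' :: "'a piece"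
  assumes x: "decomposed m x (p, q, w, c, d)" and x': "decomposed m x' (p', q', w', c, d)"
    and le: "piece_le p p'" "piece_le q q'" "list_emb letter_le w w'"
  shows "piece_le x x'"
proof -
  obtain V E X Y xs ys n Z P pos where H: "x = (bag X Y, E, xs, ys)"
     "semicomplete_rel V E" "fst Y \<subseteq> V" "set xs = bag X X" "set ys = bag Y Y"
     "sep_chain V E n Z" "sep_le X (Z 0)" "sep_le (Z n) Y" "threading E Z n m P pos"
     "p = (bag X (Z 0), E, xs, roots m P pos 0)" "q = (bag (Z n) Y, E, roots m P pos n, ys)"
     "w = map (block E Z m P pos) [0..<n]" "c = colours m pos 0" "d = colours m pos n"
    using x unfolding decomposed_def prod.inject by (elim exE conjE)
  obtain V' E' X' Y' xs' ys' n' Z' P' pos' where G: "x' = (bag X' Y', E', xs', ys')"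
     "semicomplete_rel V' E'" "fst Y' \<subseteq> V'" "set xs' = bag X' X'" "set ys' = bag Y' Y'"
     "sep_chain V' E' n' Z'" "sep_le X' (Z' 0)" "sep_le (Z' n') Y'" "threading E' Z' n' m P' pos'"
     "p' = (bag X' (Z' 0), E', xs', roots m P' pos' 0)" "q' = (bag (Z' n') Y', E', roots m P' pos' n', ys')"
     "w' = map (block E' Z' m P' pos') [0..<n']" "c = colours m pos' 0" "d = colours m pos' n'"
    using x' unfolding decomposed_def prod.inject by (elim exE conjE)
  let ?S = "bag (Z n) (Z n)"
  have mid: "rooted_minor (bag (Z 0) (Z n)) (E - ?S \<times> ?S) (roots m P pos 0) (roots m P pos n)
     (bag (Z' 0) (Z' n')) E' (roots m P' pos' 0) (roots m P' pos' n')"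
    by (rule embed_blocks[OF H(9,6) G(9,6,2), of 0 0 0]) (use H G le in auto)
  have first: "rooted_minor (bag X (Z 0)) E xs (roots m P pos 0) (bag X' (Z' 0)) E' xs' (roots m P' pos' 0)"
    and final: "rooted_minor (bag (Z n) Y) E (roots m P pos n) ys (bag (Z' n') Y') E' (roots m P' pos' n') ys'"
    using le(1,2) H G by (simp_all add: piece_le_def)
  have sep: "separation V E (Z 0)" "separation V E (Z n)" "sep_le (Z 0) (Z n)"
    "fst (Z n) \<subseteq> V" using H(6) separation_sub[of V E "Z n"] by (auto simp: sep_chain_def)
  have sep': "separation V' E' (Z' 0)" "separation V' E' (Z' n')" "sep_le (Z' 0) (Z' n')"
    "fst (Z' n') \<subseteq> V'" using G(6) separation_sub[of V' E' "Z' n'"] by (auto simp: sep_chain_def)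
  have rs: "set (roots m P pos 0) = bag (Z 0) (Z 0)" "set (roots m P pos n) = bag (Z n) (Z n)"
    using roots_props[OF H(9)] by auto
  have rs': "set (roots m P' pos' 0) = bag (Z' 0) (Z' 0)" "set (roots m P' pos' n') = bag (Z' n') (Z' n')"
    using roots_props[OF G(9)] by auto
  have bags: "bag A A \<subseteq> bag A B" "bag B B \<subseteq> bag A B" if "sep_le A B" for A B :: "'a set \<times> 'a set"
    using that by (auto simp: bag_def sep_le_def)
  have XZ: "sep_le X (Z n)" "sep_le X' (Z' n')"
    using H(7) G(7) sep(3) sep'(3) sep_le_trans by blast+
  have "rooted_minor (bag X (Z n)) (E - ?S \<times> ?S) xs (roots m P pos n)
      (bag X' (Z' n')) E' xs' (roots m P' pos' n')"
    by (rule rooted_minor_concat[OF first mid sep(1) H(7) sep(3,4) sep'(1) G(7) sep'(3,4) G(2)])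
      (use rs rs' bags[OF H(7)] bags[OF sep(3)] H(4) in auto)
  \<comment> \<open>The final piece realises the edges within \<open>?S\<close> that were withheld
    from the middle part.\<close>
  then have "rooted_minor (bag X Y) E xs ys (bag X' Y') E' xs' ys'"
    by (rule rooted_minor_concat[OF _ final sep(2) XZ(1) H(8,3) sep'(2) XZ(2) G(8,3,2)])
      (use rs rs' bags[OF XZ(1)] bags[OF H(8)] H(4,5) in auto)
  then show ?thesis by (simp add: H(1) G(1) piece_le_def)
qed

definition pieces :: "nat \<Rightarrow> nat \<Rightarrow> 'a piece set" where
  "pieces k m = {(bag X Y, E, xs, ys) | X Y E xs ys. \<exists>V. semicomplete_rel V E \<and> level V E k m X Y \<and>
     distinct xs \<and> set xs = bag X X \<and> distinct ys \<and> set ys = bag Y Y}"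

lemma piecesI:
  "semicomplete_rel V E \<Longrightarrow> level V E k m X Y \<Longrightarrow> distinct xs \<Longrightarrow> set xs = bag X X \<Longrightarrow> distinct ys \<Longrightarrow>
   set ys = bag Y Y \<Longrightarrow> (bag X Y, E, xs, ys) \<in> pieces k m"
  unfolding pieces_def by blast

lemma pieces_decompose:
  fixes x :: "'a piece"
  assumes "x \<in> pieces k m" "x \<notin> pieces k (Suc m)"
  shows "\<exists>y \<in> pieces k (Suc m) \<times> pieces k (Suc m) \<times>
    lists (pieces k (Suc m) \<times> {c. length c = m} \<times> {c. length c = m}) \<times>
    {c. length c = m} \<times> {c. length c = m}. decomposed m x y"
proof -
  obtain X Y E xs ys V where x: "x = (bag X Y, E, xs, ys)" "semicomplete_rel V E" "level V E k m X Y"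
     "distinct xs" "set xs = bag X X" "distinct ys" "set ys = bag Y Y"
    using assms(1) unfolding pieces_def by blast
  have V: "finite V" "E \<subseteq> V \<times> V" using x(2) by (auto simp: semicomplete_rel_def)
  obtain zs where zs: "\<forall>z\<in>set zs. sep_order z = m" "successively (level V E k (Suc m)) (X # zs @ [Y])"
    using level_decompose[OF V(1) x(3)] by blast
  have "zs \<noteq> []"
  proof
    assume "zs = []"
    then have "level V E k (Suc m) X Y" using zs(2) by simp
    then show False using assms(2) x piecesI by blast
  qed
  \<comment> \<open>\<open>n\<close> counts the blocks, one less than the separations of order
    \<open>m\<close>; for \<open>n = 0\<close> the word is empty.\<close>
  then obtain n where n: "length zs = Suc n" by (cases zs) auto
  define Z where "Z a = zs ! a" for a
  let ?L = "X # zs @ [Y]"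
  have L: "?L ! 0 = X" "\<And>a. a \<le> n \<Longrightarrow> ?L ! Suc a = Z a" "?L ! Suc (Suc n) = Y" "length ?L = Suc (Suc (Suc n))"
    using n by (auto simp: nth_append Z_def)
  have lev: "level V E k (Suc m) (?L ! a) (?L ! Suc a)" if "a < Suc (Suc n)" for a
    using zs(2) that L(4) unfolding successively_conv_nth by (metis Suc_less_eq)
  have lev0: "level V E k (Suc m) X (Z 0)" and levn: "level V E k (Suc m) (Z n) Y"
    using lev[of 0] lev[of "Suc n"] L by auto
  have leva: "level V E k (Suc m) (Z a) (Z (Suc a))" if "a < n" for a
    using lev[of "Suc a"] L(2)[of a] L(2)[of "Suc a"] that by simp
  have sepZ: "separation V E (Z a)" if "a \<le> n" for a
    using lev[of "Suc a"] that L(2)[OF that] unfolding level_def by auto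
  have steps: "sep_steps V E k (Z a) (Z b)" if "a \<le> b" "b \<le> n" for a b
    using that
  proof (induction rule: dec_induct)
    case (step b)
    then have "sep_steps V E k (Z b) (Z (Suc b))" using leva[of b] by (auto simp: level_def)
    then show ?case using step by (meson Suc_leD rtranclp_trans)
  qed simp
  have chain: "sep_chain V E n Z"
    using sepZ steps sep_steps_le unfolding sep_chain_def by blast
  have XZ: "sep_steps V E k X (Z 0)" "sep_steps V E k (Z n) Y"
    using lev0 levn by (auto simp: level_def)
  have ord: "sep_order (Z a) = m" if "a \<le> n" for a
    using zs(1) n that by (auto simp: Z_def)
  obtain P where P: "linked E (bag (Z 0) (Z 0)) (bag (Z n) (Z n)) m P"
    using level_linked[OF V x(3) XZ(1) steps[of 0 n] XZ(2)] ord by (auto simp: bag_def)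
  have "\<exists>Q pos. threading E Z n m Q pos"
    by (rule threading_exists[OF V _ _ P]) (use sepZ ord chain in \<open>auto simp: sep_chain_def\<close>)
  then obtain Q pos where Q: "threading E Z n m Q pos" by blast
  note rp = roots_props[OF Q]
  let ?y = "((bag X (Z 0), E, xs, roots m Q pos 0), (bag (Z n) Y, E, roots m Q pos n, ys),
          map (block E Z m Q pos) [0..<n], colours m pos 0, colours m pos n)"
  have "fst Y \<subseteq> V" using x(3) separation_sub unfolding level_def by blast
  then have "decomposed m x ?y"
    unfolding decomposed_def using x chain Q XZ[THEN sep_steps_le] by blast
  moreover have "(bag X (Z 0), E, xs, roots m Q pos 0) \<in> pieces k (Suc m)"
    using piecesI[OF x(2) lev0] x rp[of 0] by simp
  moreover have "(bag (Z n) Y, E, roots m Q pos n, ys) \<in> pieces k (Suc m)"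
    using piecesI[OF x(2) levn] x rp[of n] by simp
  moreover have "block E Z m Q pos a \<in> pieces k (Suc m) \<times> {c. length c = m} \<times> {c. length c = m}" if "a < n" for a
    using piecesI[OF x(2) leva[OF that]] rp[of a] rp[of "Suc a"] that by (simp add: block_def colours_def)
  then have "map (block E Z m Q pos) [0..<n] \<in>
      lists (pieces k (Suc m) \<times> {c. length c = m} \<times> {c. length c = m})"
    unfolding lists_eq_set set_map by (simp add: image_subset_iff)
  ultimately show ?thesis by (intro bexI[of _ ?y]) (simp_all add: colours_def)
qed

lemma af_on_pieces_step:
  assumes "af_on piece_le (pieces k (Suc m) :: 'a piece set)"
  shows "af_on piece_le (pieces k m :: 'a piece set)"
proof -
  let ?A = "pieces k (Suc m) :: 'a piece set"
  let ?C = "{c :: bool list. length c = m}"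
  have "finite {c :: bool list. set c \<subseteq> UNIV \<and> length c = m}"
    by (rule finite_lists_length_eq) simp
  then have "finite ?C" by simp
  then have afC: "af_on (=) (?C \<times> ?C)" by (intro af_on_finite_eq) simp
  have "af_on letter_le (?A \<times> ?C \<times> ?C)"
    using af_on_times[OF assms afC] by (simp add: letter_le_def[abs_def])
  then have afL: "af_on (list_emb letter_le) (lists (?A \<times> ?C \<times> ?C))" by (rule higman)
  have "af_on piece_le (pieces k m - ?A)"
  proof (rule af_on_coding[OF af_on_times[OF assms af_on_times[OF assms af_on_times[OF afL afC]]], of _ "decomposed m"])
    fix x :: "'a piece" assume "x \<in> pieces k m - ?A"
    then show "\<exists>y\<in>?A \<times> ?A \<times> lists (?A \<times> ?C \<times> ?C) \<times> ?C \<times> ?C. decomposed m x y"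
      using pieces_decompose by blast
  next
    fix x x' :: "'a piece" and y y'
    assume R: "decomposed m x y" "decomposed m x' y'"
      and le: "piece_le (fst y) (fst y') \<and> piece_le (fst (snd y)) (fst (snd y')) \<and>
        list_emb letter_le (fst (snd (snd y))) (fst (snd (snd y'))) \<and> snd (snd (snd y)) = snd (snd (snd y'))"
    obtain p q w c d p' q' w' c' d' where "y = (p, q, w, c, d)" "y' = (p', q', w', c', d')"
      by (metis prod.exhaust)
    then show "piece_le x x'" using R le piece_le_decomposed[of m x p q w c d x' p' q' w'] by simp
  qed
  then have "af_on piece_le ((pieces k m - ?A) \<union> ?A)" using assms by (rule af_on_Un)
  then show ?thesis by (rule af_on_mono) auto
qed

text \<open>Inner separations have order at most \<open>k\<close> by the width and more than
  \<open>k\<close> by the level. So there are none, and the piece is one bag.\<close>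

lemma level_small_bag:
  assumes "level V E k (Suc k) X Y" "finite V"
  shows "card (bag X Y) \<le> k"
proof -
  have lv: "separation V E X" "sep_order X \<le> k" "sep_steps V E k X Y"
    "\<And>Z. sep_steps V E k X Z \<Longrightarrow> sep_steps V E k Z Y \<Longrightarrow> Z \<noteq> X \<Longrightarrow> Z \<noteq> Y \<Longrightarrow> Suc k \<le> sep_order Z"
    using assms(1) by (auto simp: level_def)
  have "C = X \<or> sep_step V E k X C \<or> (\<exists>Z. Z \<noteq> X \<and> Z \<noteq> C \<and> sep_steps V E k X Z \<and> sep_steps V E k Z C)"
    if "sep_steps V E k X C" for C
    using that
  proof (induction rule: rtranclp_induct)
    case (step C D)
    consider "C = X" | "C = D" | "C \<noteq> X" "C \<noteq> D" by blast
    then show ?case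
    proof cases
      case 3
      then show ?thesis using step.hyps by (intro disjI2 exI[of _ C]) auto
    qed (use step in auto)
  qed simp
  from this[OF lv(3)] consider "Y = X" | "sep_step V E k X Y"
    | Z where "Z \<noteq> X" "Z \<noteq> Y" "sep_steps V E k X Z" "sep_steps V E k Z Y" by blast
  then show ?thesis
  proof cases
    case 1
    then show ?thesis using lv(2) by (simp add: bag_def sep_order_def)
  next
    case 2
    then show ?thesis by (simp add: bag_def sep_step_def)
  next
    case 3
    then have "sep_order Z \<le> k" using sep_steps_order lv(2) assms(2) by blast
    then show ?thesis using lv(4)[OF 3(3,4,1,2)] by simp
  qed
qed

text \<open>Renaming the bag to numbers leaves finitely many codes for small bags. Edges outside the
  bag are cut off, as a piece carries the edges of its whole digraph.\<close>

definition coded :: "'a piece \<Rightarrow> nat piece \<Rightarrow> bool" where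
  "coded x y \<longleftrightarrow> (\<exists>W E xs ys b. x = (W, E, xs, ys) \<and> set xs \<subseteq> W \<and> set ys \<subseteq> W \<and> inj_on b W \<and>
     y = (b ` W, (\<lambda>(u, v). (b u, b v)) ` (E \<inter> W \<times> W), map b xs, map b ys))"

lemma piece_le_coded:
  assumes "coded x y" "coded x' y"
  shows "piece_le x x'"
proof -
  obtain W E xs ys b where x: "x = (W, E, xs, ys)" "set xs \<subseteq> W" "set ys \<subseteq> W" "inj_on b W"
     "y = (b ` W, (\<lambda>(u, v). (b u, b v)) ` (E \<inter> W \<times> W), map b xs, map b ys)"
    using assms(1) unfolding coded_def by blast
  obtain W' E' xs' ys' b' where x': "x' = (W', E', xs', ys')" "set xs' \<subseteq> W'" "set ys' \<subseteq> W'" "inj_on b' W'"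
     "y = (b' ` W', (\<lambda>(u, v). (b' u, b' v)) ` (E' \<inter> W' \<times> W'), map b' xs', map b' ys')"
    using assms(2) unfolding coded_def by blast
  have eq: "b ` W = b' ` W'" "(\<lambda>(u, v). (b u, b v)) ` (E \<inter> W \<times> W) = (\<lambda>(u, v). (b' u, b' v)) ` (E' \<inter> W' \<times> W')"
    "map b xs = map b' xs'" "map b ys = map b' ys'"
    using x(5) x'(5) by simp_all
  define f where "f v = inv_into W' b' (b v)" for v
  have f: "f v \<in> W'" "b' (f v) = b v" if "v \<in> W" for v
  proof -
    have "b v \<in> b' ` W'" using that eq(1) by blast
    then show "f v \<in> W'" "b' (f v) = b v" by (simp_all add: f_def inv_into_into f_inv_into_f)
  qed
  have finj: "f u \<noteq> f v" if "u \<in> W" "v \<in> W" "u \<noteq> v" for u v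
    using f(2)[OF that(1)] f(2)[OF that(2)] x(4) that by (auto simp: inj_on_def)
  have fe: "(f u, f v) \<in> E'" if "u \<in> W" "v \<in> W" "(u, v) \<in> E" for u v
  proof -
    have "(b u, b v) \<in> (\<lambda>(u, v). (b u, b v)) ` (E \<inter> W \<times> W)" using that by auto
    then obtain u' v' where "u' \<in> W'" "v' \<in> W'" "(u', v') \<in> E'" "b u = b' u'" "b v = b' v'"
      unfolding eq(2) by auto
    then show ?thesis using x'(4) by (simp add: f_def)
  qed
  have list: "list_all2 (\<lambda>x x'. x' \<in> {f x}) l l'" if "map b l = map b' l'" "set l' \<subseteq> W'" for l l'
  proof -
    have "length l = length l'" using that(1) by (metis length_map)
    moreover have "l' ! i = f (l ! i)" if "i < length l'" for i
    proof -
      have "b (l ! i) = b' (l' ! i)"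
        using that \<open>length l = length l'\<close> arg_cong[OF \<open>map b l = map b' l'\<close>, of "\<lambda>l. l ! i"] by simp
      moreover have "l' ! i \<in> W'" using \<open>set l' \<subseteq> W'\<close> that by auto
      ultimately show ?thesis using x'(4) by (simp add: f_def)
    qed
    ultimately show ?thesis by (simp add: list_all2_conv_all_nth)
  qed
  have "rooted_minor_map (\<lambda>v. {f v}) W E xs ys W' E' xs' ys'"
    unfolding rooted_minor_map_def using f(1) finj fe list[OF eq(3) x'(2)] list[OF eq(4) x'(3)] by auto
  then show ?thesis unfolding x(1) x'(1) piece_le_def rooted_minor_def by auto
qed

lemma af_on_pieces_base: "af_on piece_le (pieces k (Suc k) :: 'a piece set)"
proof -
  let ?L = "{l. set l \<subseteq> {..<k} \<and> length l \<le> k}"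
  let ?B = "Pow {..<k} \<times> Pow ({..<k} \<times> {..<k}) \<times> ?L \<times> ?L"
  have "finite ?B" by (intro finite_cartesian_product finite_lists_length_le) auto
  then have "af_on (=) ?B" by (rule af_on_finite_eq)
  then show ?thesis
  proof (rule af_on_coding[of _ _ _ coded])
    fix x :: "'a piece" assume "x \<in> pieces k (Suc k)"
    then obtain X Y E xs ys V where x: "x = (bag X Y, E, xs, ys)" "semicomplete_rel V E" "level V E k (Suc k) X Y"
       "distinct xs" "set xs = bag X X" "distinct ys" "set ys = bag Y Y"
      unfolding pieces_def by blast
    let ?W = "bag X Y"
    have finV: "finite V" using x(2) by (simp add: semicomplete_rel_def)
    have W: "card ?W \<le> k" by (rule level_small_bag[OF x(3) finV])
    have "fst Y \<subseteq> V" "sep_le X Y"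
      using x(3) separation_sub sep_steps_le unfolding level_def by blast+
    then have finW: "finite ?W" and sub: "set xs \<subseteq> ?W" "set ys \<subseteq> ?W"
      using finV finite_subset[of "fst Y" V] x(5,7) by (auto simp: bag_def sep_le_def)
    obtain b where "bij_betw b ?W {0..<card ?W}" using ex_bij_betw_finite_nat[OF finW] by blast
    then have b: "inj_on b ?W" "b ` ?W \<subseteq> {..<k}" using W by (auto simp: bij_betw_def)
    have len: "length xs \<le> k" "length ys \<le> k"
      using card_mono[OF finW sub(1)] card_mono[OF finW sub(2)] distinct_card[OF x(4)] distinct_card[OF x(6)] W
      by linarith+
    show "\<exists>y\<in>?B. coded x y"
    proof
      show "coded x (b ` ?W, (\<lambda>(u, v). (b u, b v)) ` (E \<inter> ?W \<times> ?W), map b xs, map b ys)"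
        unfolding coded_def using x(1) sub b(1) by blast
    qed (use b(2) sub len in auto)
  qed (use piece_le_coded in blast)
qed

theorem af_on_pieces:
  assumes "m \<le> Suc k"
  shows "af_on piece_le (pieces k m :: 'a piece set)"
  using assms by (induction rule: inc_induct) (auto intro: af_on_pieces_base af_on_pieces_step)

section \<open>Complete minors from jungles\<close>

definition complete_minor :: "nat \<Rightarrow> 'a set \<Rightarrow> ('a \<times> 'a) set \<Rightarrow> bool" where
  "complete_minor h V E \<longleftrightarrow> (\<exists>\<phi>. (\<forall>i<h. \<phi> i \<subseteq> V \<and> sconn E (\<phi> i)) \<and>
     (\<forall>i<h. \<forall>j<h. i \<noteq> j \<longrightarrow> \<phi> i \<inter> \<phi> j = {} \<and> (\<exists>x\<in>\<phi> i. \<exists>y\<in>\<phi> j. (x, y) \<in> E)))"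

definition two_paths :: "('a \<times> 'a) set \<Rightarrow> 'a \<Rightarrow> 'a \<Rightarrow> 'a set" where
  "two_paths E u v = {x. (u, x) \<in> E \<and> (x, v) \<in> E}"

text \<open>A greedy choice suffices, since each set has room for all of \<open>U\<close> and all
  representatives chosen before.\<close>

lemma distinct_representatives_avoiding:
  assumes "finite D" "finite U" "\<And>d. d \<in> D \<Longrightarrow> card U + card D \<le> card (F d)"
  shows "\<exists>x. inj_on x D \<and> (\<forall>d\<in>D. x d \<in> F d - U)"
  using assms(1,3)
proof (induction D rule: finite_induct)
  case (insert d D)
  have "card U + card D \<le> card (F e)" if "e \<in> D" for e
    using insert.prems[of e] insert.hyps that by simp
  then obtain x where x: "inj_on x D" "\<And>e. e \<in> D \<Longrightarrow> x e \<in> F e - U"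
    using insert.IH by blast
  have "card (U \<union> x ` D) \<le> card U + card D"
    using card_Un_le[of U "x ` D"] card_image_le[OF insert.hyps(1), of x] by linarith
  also have "\<dots> < card (F d)" using insert.prems[of d] insert.hyps by simp
  finally have "\<not> F d \<subseteq> U \<union> x ` D"
    using card_mono[of "U \<union> x ` D" "F d"] assms(2) insert.hyps(1) by auto
  then obtain y where y: "y \<in> F d" "y \<notin> U" "y \<notin> x ` D" by blast
  have "inj_on (x(d := y)) (insert d D)"
    using x(1) y(3) insert.hyps(2) by (auto simp: inj_on_def)
  moreover have "\<forall>e\<in>insert d D. (x(d := y)) e \<in> F e - U" using x(2) y by auto
  ultimately show ?case by blast
qed simp

section \<open>Assembling strongly connected sets\<close>

lemma sconn_cover:
  assumes "r \<in> S" "\<And>y. y \<in> S \<Longrightarrow> \<exists>T\<subseteq>S. r \<in> T \<and> y \<in> T \<and> sconn E T"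
  shows "sconn E S"
proof (rule sconnI[of r])
  fix y assume "y \<in> S"
  then obtain T where "T \<subseteq> S" "r \<in> T" "y \<in> T" "sconn E T" using assms(2) by blast
  then show "(r, y) \<in> (E \<inter> S \<times> S)\<^sup>*" "(y, r) \<in> (E \<inter> S \<times> S)\<^sup>*"
    using sconn_reach_mono by metis+
qed fact

text \<open>\<open>Z\<close> is the interior of a path from \<open>b\<close> to \<open>a\<close> of length at most two.\<close>

definition short_link :: "('a \<times> 'a) set \<Rightarrow> 'a \<Rightarrow> 'a set \<Rightarrow> 'a \<Rightarrow> bool" where
  "short_link E b Z a \<longleftrightarrow> Z = {} \<and> (b = a \<or> (b, a) \<in> E) \<or> (\<exists>z. Z = {z} \<and> (b, z) \<in> E \<and> (z, a) \<in> E)"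

lemma short_link_reach:
  assumes "short_link E b Z a" "b \<in> S" "a \<in> S" "Z \<subseteq> S"
  shows "(b, a) \<in> (E \<inter> S \<times> S)\<^sup>*"
    "z \<in> Z \<Longrightarrow> (b, z) \<in> (E \<inter> S \<times> S)\<^sup>*" "z \<in> Z \<Longrightarrow> (z, a) \<in> (E \<inter> S \<times> S)\<^sup>*"
proof -
  have *: "(b, z) \<in> E \<inter> S \<times> S" "(z, a) \<in> E \<inter> S \<times> S" if "z \<in> Z" for z
    using assms that by (auto simp: short_link_def)
  then show "z \<in> Z \<Longrightarrow> (b, z) \<in> (E \<inter> S \<times> S)\<^sup>*" "z \<in> Z \<Longrightarrow> (z, a) \<in> (E \<inter> S \<times> S)\<^sup>*"
    by blast+
  show "(b, a) \<in> (E \<inter> S \<times> S)\<^sup>*"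
  proof (cases "Z = {}")
    case True
    then have "b = a \<or> (b, a) \<in> E" using assms(1) by (simp add: short_link_def)
    then show ?thesis using assms(2,3) by auto
  next
    case False
    then show ?thesis using * by (meson all_not_in_conv converse_rtrancl_into_rtrancl r_into_rtrancl)
  qed
qed

text \<open>A closed walk runs through \<open>b1\<close>, \<open>Z1\<close>, \<open>a2\<close>,
  \<open>b2\<close>, \<open>Z2\<close>, \<open>a1\<close> and back to \<open>b1\<close>; all other
  vertices of \<open>C1\<close> and \<open>C2\<close> are attached to it by strong
  connectivity.\<close>

lemma sconn_ring:
  assumes "sconn E C1" "sconn E C2" "a1 \<in> C1" "b1 \<in> C1" "a2 \<in> C2" "b2 \<in> C2"
    and "short_link E b1 Z1 a2" "short_link E b2 Z2 a1"
  shows "sconn E (C1 \<union> C2 \<union> Z1 \<union> Z2)"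
proof -
  let ?S = "C1 \<union> C2 \<union> Z1 \<union> Z2"
  let ?R = "(E \<inter> ?S \<times> ?S)\<^sup>*"
  have c1: "(x, y) \<in> ?R" if "x \<in> C1" "y \<in> C1" for x y
    by (rule sconn_reach_mono[OF assms(1) that]) auto
  have c2: "(x, y) \<in> ?R" if "x \<in> C2" "y \<in> C2" for x y
    by (rule sconn_reach_mono[OF assms(2) that]) auto
  have l1: "(b1, a2) \<in> ?R" "\<And>z. z \<in> Z1 \<Longrightarrow> (b1, z) \<in> ?R" "\<And>z. z \<in> Z1 \<Longrightarrow> (z, a2) \<in> ?R"
    by (rule short_link_reach[OF assms(7)]; use assms(3-6) in auto)+
  have l2: "(b2, a1) \<in> ?R" "\<And>z. z \<in> Z2 \<Longrightarrow> (b2, z) \<in> ?R" "\<And>z. z \<in> Z2 \<Longrightarrow> (z, a1) \<in> ?R"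
    by (rule short_link_reach[OF assms(8)]; use assms(3-6) in auto)+
  have r: "(b1, b2) \<in> ?R" "(a2, b1) \<in> ?R" "(a1, b1) \<in> ?R"
    using l1(1) l2(1) c1[OF assms(3,4)] c2[OF assms(5,6)] by (meson rtrancl_trans)+
  show ?thesis
  proof (rule sconnI[of b1])
    show "b1 \<in> ?S" using assms(4) by blast
    fix y assume "y \<in> ?S"
    then consider "y \<in> C1" | "y \<in> C2" | "y \<in> Z1" | "y \<in> Z2" by blast
    then have "(b1, y) \<in> ?R \<and> (y, b1) \<in> ?R"
    proof cases
      case 1
      then show ?thesis using c1 assms(4) by blast
    next
      case 2
      then show ?thesis using c2[of a2 y] c2[of y a2] assms(5) l1(1) r(2) by (meson rtrancl_trans)
    next
      case 3
      then show ?thesis using l1(2,3) r(2) by (meson rtrancl_trans)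
    next
      case 4
      then show ?thesis using l2(2,3) r(1,3) by (meson rtrancl_trans)
    qed
    then show "(b1, y) \<in> ?R" "(y, b1) \<in> ?R" by auto
  qed
qed

text \<open>\<open>Inl i\<close> is the core of the branch set \<open>i\<close>;
  \<open>Inr (i, j)\<close> is reserved for the edge from \<open>i\<close> to
  \<open>j\<close>.\<close>

definition jungle_nodes :: "nat \<Rightarrow> (nat + nat \<times> nat) set" where
  "jungle_nodes h = {..<h} <+> ({..<h} \<times> {..<h})"

definition jungle_size :: "nat \<Rightarrow> nat" where
  "jungle_size h = h + h * h"

text \<open>Enough to choose distinct interior vertices for all links: at most
  \<open>2 * jungle_size h\<close> entries and exits are to be avoided, and there is one link for
  each ordered pair of nodes.\<close>

definition link_bound :: "nat \<Rightarrow> nat" where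
  "link_bound h = 2 * jungle_size h + jungle_size h * jungle_size h"

lemma card_jungle_nodes: "finite (jungle_nodes h)" "card (jungle_nodes h) = jungle_size h"
  by (simp_all add: jungle_nodes_def jungle_size_def card_Plus)

text \<open>
  Every node \<open>p\<close> consists of an entry \<open>a p\<close> and an exit \<open>b p\<close>. To realise an edge from the branch
  set \<open>i\<close> to the branch set \<open>j\<close>, a connecting vertex \<open>z\<close> from \<open>i\<close> to \<open>j\<close> is compared with the entry
  of the auxiliary node \<open>Inr (i, j)\<close>: if it precedes that entry, then it lies on a closed walk through
  \<open>Inl i\<close> and the auxiliary node, otherwise on one through \<open>Inl j\<close> and the auxiliary node.
\<close>

lemma complete_minor_of_jungle:
  fixes a b :: "nat + nat \<times> nat \<Rightarrow> 'a"
  assumes sem: "semicomplete_rel V E"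
    and inV: "\<And>p. p \<in> jungle_nodes h \<Longrightarrow> a p \<in> V \<and> b p \<in> V"
    and node: "\<And>p. p \<in> jungle_nodes h \<Longrightarrow> a p = b p \<or> (a p, b p) \<in> E"
    and disj: "\<And>p q. p \<in> jungle_nodes h \<Longrightarrow> q \<in> jungle_nodes h \<Longrightarrow> p \<noteq> q \<Longrightarrow> {a p, b p} \<inter> {a q, b q} = {}"
    and link: "\<And>p q. p \<in> jungle_nodes h \<Longrightarrow> q \<in> jungle_nodes h \<Longrightarrow> b p \<noteq> a q \<Longrightarrow> (b p, a q) \<notin> E \<Longrightarrow>
      link_bound h \<le> card (two_paths E (b p) (a q))"
  shows "complete_minor h V E"
proof -
  let ?I = "jungle_nodes h"
  have V: "finite V" "E \<subseteq> V \<times> V" "irrefl E" using sem by (auto simp: semicomplete_rel_def)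
  define D where "D = {(p, q). p \<in> ?I \<and> q \<in> ?I \<and> b p \<noteq> a q \<and> (b p, a q) \<notin> E}"
  define U where "U = a ` ?I \<union> b ` ?I"
  have DI: "D \<subseteq> ?I \<times> ?I" by (auto simp: D_def)
  have finD: "finite D" by (rule finite_subset[OF DI]) (simp add: card_jungle_nodes)
  have "card D \<le> jungle_size h * jungle_size h"
    using card_mono[OF _ DI] by (simp add: card_jungle_nodes card_cartesian_product)
  moreover have "card U \<le> 2 * jungle_size h"
    using card_Un_le[of "a ` ?I" "b ` ?I"] card_image_le[of ?I a] card_image_le[of ?I b]
    by (simp add: U_def card_jungle_nodes)
  ultimately have UD: "card U + card D \<le> link_bound h" by (simp add: link_bound_def)
  have "\<exists>x. inj_on x D \<and> (\<forall>d\<in>D. x d \<in> two_paths E (b (fst d)) (a (snd d)) - U)"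
  proof (rule distinct_representatives_avoiding[OF finD])
    show "finite U" by (simp add: U_def card_jungle_nodes)
    fix d assume "d \<in> D"
    then show "card U + card D \<le> card (two_paths E (b (fst d)) (a (snd d)))"
      using UD link[of "fst d" "snd d"] by (auto simp: D_def)
  qed
  then obtain x where x: "inj_on x D" "\<And>d. d \<in> D \<Longrightarrow> x d \<in> two_paths E (b (fst d)) (a (snd d)) - U"
    by blast
  have xE: "(b p, x (p, q)) \<in> E" "(x (p, q), a q) \<in> E" "x (p, q) \<notin> U" "x (p, q) \<in> V" if "(p, q) \<in> D" for p q
    using x(2)[OF that] V(2) by (auto simp: two_paths_def)
  define X where "X p q = x ` ({(p, q)} \<inter> D)" for p q
  have sl: "short_link E (b p) (X p q) (a q)" if "p \<in> ?I" "q \<in> ?I" for p q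
    using that xE[of p q] by (cases "(p, q) \<in> D") (auto simp: short_link_def X_def, auto simp: D_def)
  define C where "C p = {a p, b p} \<union> X p p" for p
  have C: "sconn E (C p)" if "p \<in> ?I" for p
  proof -
    have "short_link E (a p) {} (b p)" using node[OF that] by (auto simp: short_link_def)
    then have "sconn E ({b p} \<union> {a p} \<union> X p p \<union> {})"
      by (intro sconn_ring[where ?b1.0 = "b p" and ?a1.0 = "b p" and ?a2.0 = "a p" and ?b2.0 = "a p"] sl that) auto
    moreover have "{b p} \<union> {a p} \<union> X p p \<union> {} = C p" by (auto simp: C_def)
    ultimately show ?thesis by simp
  qed
  define w where "w i j = (Inr (i, j) :: nat + nat \<times> nat)" for i j :: nat
  define z where "z i j = x (Inl i, Inl j)" for i j :: nat
  \<comment> \<open>\<open>Out\<close> gives the auxiliary node and the connecting vertex to the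
    branch set \<open>i\<close>, \<open>In\<close> gives them to \<open>j\<close>.\<close>
  define Out where "Out i j \<longleftrightarrow> (Inl i, Inl j) \<in> D \<and> (z i j, a (w i j)) \<in> E" for i j :: nat
  define In where "In i j \<longleftrightarrow> (Inl i, Inl j) \<in> D \<and> (z i j, a (w i j)) \<notin> E" for i j :: nat
  define T where "T i = {Inl i} \<union> {w i j | j. j < h \<and> j \<noteq> i \<and> Out i j} \<union> {w j i | j. j < h \<and> j \<noteq> i \<and> In j i}" for i
  \<comment> \<open>The links whose interiors belong to the branch set: those from the exit of each
    of its nodes back to the entry, and those along its closed walks.\<close>
  define Q where "Q i = (\<lambda>p. (p, p)) ` T i
     \<union> {(Inl i, Inl j) | j. j < h \<and> j \<noteq> i \<and> Out i j} \<union> {(w i j, Inl i) | j. j < h \<and> j \<noteq> i \<and> Out i j}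
     \<union> {(Inl j, Inl i) | j. j < h \<and> j \<noteq> i \<and> In j i} \<union> {(Inl i, w j i) | j. j < h \<and> j \<noteq> i \<and> In j i}" for i
  define \<phi> where "\<phi> i = a ` T i \<union> b ` T i \<union> x ` (Q i \<inter> D)" for i
  have nodes: "Inl i \<in> ?I" "w i j \<in> ?I" if "i < h" "j < h" for i j
    using that by (auto simp: jungle_nodes_def w_def)
  have TI: "T i \<subseteq> ?I" if "i < h" for i
    using that nodes by (auto simp: T_def)
  have Tdisj: "T i \<inter> T j = {}" if "i \<noteq> j" for i j
    using that by (auto simp: T_def w_def Out_def In_def)
  have Qdisj: "Q i \<inter> Q j = {}" if "i \<noteq> j" for i j
    using that Tdisj[OF that] by (auto simp: Q_def w_def Out_def In_def)
  have sub: "\<phi> i \<subseteq> V" if "i < h" for i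
    using inV TI[OF that] xE(4) by (auto simp: \<phi>_def)
  have phi_disj: "\<phi> i \<inter> \<phi> j = {}" if ij: "i < h" "j < h" "i \<noteq> j" for i j
  proof -
    have "{a p, b p} \<inter> {a q, b q} = {}" if "p \<in> T i" "q \<in> T j" for p q
      using disj[of p q] TI[OF ij(1)] TI[OF ij(2)] Tdisj[OF ij(3)] that by blast
    then have "(\<Union>p\<in>T i. {a p, b p}) \<inter> (\<Union>q\<in>T j. {a q, b q}) = {}" by blast
    define A where "A l = a ` T l \<union> b ` T l" for l
    define B where "B l = x ` (Q l \<inter> D)" for l
    have "A i \<inter> A j = {}" using \<open>(\<Union>p\<in>T i. {a p, b p}) \<inter> (\<Union>q\<in>T j. {a q, b q}) = {}\<close>
      unfolding A_def by blast
    moreover have "B i \<inter> B j = {}"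
      using inj_on_image_Int[OF x(1), of "Q i \<inter> D" "Q j \<inter> D"] Qdisj[OF ij(3)] by (auto simp: B_def)
    moreover have "A l \<subseteq> U" if "l < h" for l using TI[OF that] by (auto simp: A_def U_def)
    moreover have "B l \<inter> U = {}" for l using xE(3) by (auto simp: B_def)
    ultimately have "(A i \<union> B i) \<inter> (A j \<union> B j) = {}" using ij(1,2) by blast
    then show ?thesis by (simp only: \<phi>_def A_def B_def)
  qed
  have Cphi: "C p \<subseteq> \<phi> i" if "p \<in> T i" for p i
    using that by (auto simp: C_def \<phi>_def X_def Q_def)
  have Xphi: "X p q \<subseteq> \<phi> i" if "(p, q) \<in> Q i" for p q i
    using that by (auto simp: \<phi>_def X_def)
  have Cab: "a p \<in> C p" "b p \<in> C p" for p by (auto simp: C_def)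
  have Oring: "sconn E (C (Inl i) \<union> C (w i j) \<union> {z i j} \<union> X (w i j) (Inl i))"
    if "i < h" "j < h" "Out i j" for i j
  proof (rule sconn_ring[OF C C Cab(1,2) Cab(1,2)])
    show "short_link E (b (Inl i)) {z i j} (a (w i j))"
      using that(3) xE(1)[of "Inl i" "Inl j"] by (auto simp: short_link_def Out_def z_def)
  qed (use sl nodes that in auto)
  have Iring: "sconn E (C (Inl j) \<union> C (w i j) \<union> X (Inl j) (w i j) \<union> {z i j})"
    if "i < h" "j < h" "In i j" for i j
  \<comment> \<open>The walk leaves the auxiliary node at its entry, where the edge to the
    connecting vertex starts.\<close>
  proof (rule sconn_ring[OF C C Cab(1,2) Cab(1,1)])
    have D: "(Inl i, Inl j) \<in> D" using that by (simp add: In_def)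
    have "z i j \<noteq> a (w i j)" using xE(3)[OF D] nodes(2)[OF that(1,2)] by (auto simp: U_def z_def)
    moreover have "z i j \<in> V" "a (w i j) \<in> V" using xE(4)[OF D] inV nodes(2)[OF that(1,2)] by (auto simp: z_def)
    ultimately have "(a (w i j), z i j) \<in> E" using sem that(3) by (auto simp: semicomplete_rel_def In_def)
    then show "short_link E (a (w i j)) {z i j} (a (Inl j))"
      using xE(2)[OF D] by (auto simp: short_link_def z_def)
  qed (use sl nodes that in auto)
  have zX: "X (Inl i) (Inl j) = {z i j}" if "(Inl i, Inl j) \<in> D" for i j
    using that by (auto simp: X_def z_def)
  have Osub: "C (Inl i) \<union> C (w i j) \<union> {z i j} \<union> X (w i j) (Inl i) \<subseteq> \<phi> i"
    if "j < h" "j \<noteq> i" "Out i j" for i j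
  proof -
    have "Inl i \<in> T i" "w i j \<in> T i" "(Inl i, Inl j) \<in> Q i" "(w i j, Inl i) \<in> Q i"
      using that by (auto simp: T_def Q_def)
    then show ?thesis using Cphi Xphi zX[of i j] that(3) by (simp add: Out_def) blast
  qed
  have Isub: "C (Inl i) \<union> C (w j i) \<union> X (Inl i) (w j i) \<union> {z j i} \<subseteq> \<phi> i"
    if "j < h" "j \<noteq> i" "In j i" for i j
  proof -
    have "Inl i \<in> T i" "w j i \<in> T i" "(Inl j, Inl i) \<in> Q i" "(Inl i, w j i) \<in> Q i"
      using that by (auto simp: T_def Q_def)
    then show ?thesis using Cphi Xphi zX[of j i] that(3) by (simp add: In_def) blast
  qed
  have sc: "sconn E (\<phi> i)" if i: "i < h" for i
  proof (rule sconn_cover[of "a (Inl i)"])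
    have IT: "Inl i \<in> T i" by (simp add: T_def)
    then show "a (Inl i) \<in> \<phi> i" by (auto simp: \<phi>_def)
    fix y assume "y \<in> \<phi> i"
    then have "y \<in> C (Inl i) \<or> (\<exists>j<h. j \<noteq> i \<and> Out i j \<and> y \<in> C (w i j) \<union> {z i j} \<union> X (w i j) (Inl i)) \<or>
        (\<exists>j<h. j \<noteq> i \<and> In j i \<and> y \<in> C (w j i) \<union> X (Inl i) (w j i) \<union> {z j i})"
      unfolding \<phi>_def T_def Q_def C_def X_def z_def by (elim UnE imageE IntE) auto
    then show "\<exists>T\<subseteq>\<phi> i. a (Inl i) \<in> T \<and> y \<in> T \<and> sconn E T"
    proof (elim disjE exE conjE)
      assume "y \<in> C (Inl i)"
      then show ?thesis using Cphi[OF IT] C[OF nodes(1)[OF i i]] Cab by blast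
    next
      fix j assume "j < h" "j \<noteq> i" "Out i j" "y \<in> C (w i j) \<union> {z i j} \<union> X (w i j) (Inl i)"
      then show ?thesis
        using Osub[of j i] Oring[OF i, of j] Cab(1)[of "Inl i"]
        by (intro exI[of _ "C (Inl i) \<union> C (w i j) \<union> {z i j} \<union> X (w i j) (Inl i)"]) auto
    next
      fix j assume "j < h" "j \<noteq> i" "In j i" "y \<in> C (w j i) \<union> X (Inl i) (w j i) \<union> {z j i}"
      then show ?thesis
        using Isub[of j i] Iring[of j i] i Cab(1)[of "Inl i"]
        by (intro exI[of _ "C (Inl i) \<union> C (w j i) \<union> X (Inl i) (w j i) \<union> {z j i}"]) auto
    qed
  qed
  have edge: "\<exists>u\<in>\<phi> i. \<exists>v\<in>\<phi> j. (u, v) \<in> E" if ij: "i < h" "j < h" "i \<noteq> j" for i j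
  proof -
    have ab: "a (Inl j) \<in> \<phi> j" "b (Inl i) \<in> \<phi> i" by (auto simp: \<phi>_def T_def)
    have "b (Inl i) \<noteq> a (Inl j)" using disj[of "Inl i" "Inl j"] nodes ij by blast
    then consider "(b (Inl i), a (Inl j)) \<in> E" | "Out i j" | "In i j"
      using nodes ij by (auto simp: D_def Out_def In_def)
    then show ?thesis
    proof cases
      case 1
      then show ?thesis using ab by blast
    next
      case 2
      then have "z i j \<in> \<phi> i" "(z i j, a (Inl j)) \<in> E"
        using Osub[of j i] ij xE(2)[of "Inl i" "Inl j"] by (auto simp: Out_def z_def)
      then show ?thesis using ab by blast
    next
      case 3
      then have "z i j \<in> \<phi> j" "(b (Inl i), z i j) \<in> E"
        using Isub[of i j] ij xE(1)[of "Inl i" "Inl j"] by (auto simp: In_def z_def)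
      then show ?thesis using ab by blast
    qed
  qed
  show ?thesis
    unfolding complete_minor_def using sub sc phi_disj edge by (intro exI[of _ \<phi>]) simp
qed

text \<open>By double counting, bounded in-degrees leave some vertex of out-degree at most
  \<open>d\<close>. Choosing it discards at most \<open>2 * d + 1\<close> vertices, itself
  included.\<close>

lemma large_independent_set:
  assumes "finite T" "\<And>u. \<not> B u u" "\<And>v. v \<in> T \<Longrightarrow> card {u \<in> T. B u v} \<le> d"
  shows "\<exists>S\<subseteq>T. (\<forall>u\<in>S. \<forall>v\<in>S. \<not> B u v) \<and> card T \<le> card S * (2 * d + 1)"
  using assms(1,3)
proof (induction "card T" arbitrary: T rule: less_induct)
  case less
  show ?case
  proof (cases "T = {}")
    case False
    have "(\<Sum>v\<in>T. card {u \<in> T. B v u}) = (\<Sum>v\<in>T. \<Sum>u\<in>T. if B v u then 1 else 0)"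
      using less.prems(1) by (simp add: sum.If_cases Int_def)
    also have "\<dots> = (\<Sum>u\<in>T. \<Sum>v\<in>T. if B v u then 1 else 0)" by (rule sum.swap)
    also have "\<dots> = (\<Sum>u\<in>T. card {v \<in> T. B v u})"
      using less.prems(1) by (simp add: sum.If_cases Int_def)
    also have "\<dots> \<le> (\<Sum>u\<in>T. d)" by (rule sum_mono) (rule less.prems)
    finally have le: "(\<Sum>v\<in>T. card {u \<in> T. B v u}) \<le> (\<Sum>u\<in>T. d)" .
    have "\<exists>v\<in>T. card {u \<in> T. B v u} \<le> d"
    proof (rule ccontr)
      assume "\<not> ?thesis"
      then have "(\<Sum>u\<in>T. d) < (\<Sum>v\<in>T. card {u \<in> T. B v u})"
        using less.prems(1) False by (intro sum_strict_mono) auto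
      then show False using le by simp
    qed
    then obtain v where v: "v \<in> T" "card {u \<in> T. B v u} \<le> d" by blast
    define R where "R = insert v ({u \<in> T. B u v} \<union> {u \<in> T. B v u})"
    have "card R \<le> Suc (card ({u \<in> T. B u v} \<union> {u \<in> T. B v u}))"
      unfolding R_def by (rule card_insert_le_m1[THEN order_trans]) (use less.prems(1) in \<open>auto simp: card_insert_if\<close>)
    also have "\<dots> \<le> Suc (d + d)"
      using card_Un_le[of "{u \<in> T. B u v}" "{u \<in> T. B v u}"] v less.prems(2)[OF v(1)] by linarith
    finally have R: "card R \<le> 2 * d + 1" by simp
    have finT: "finite T" by fact
    have RT: "R \<subseteq> T" using v(1) by (auto simp: R_def)
    have "card (T - R) < card T"
      by (rule psubset_card_mono[OF finT]) (use v(1) in \<open>auto simp: R_def\<close>)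
    moreover have "card {u \<in> T - R. B u w} \<le> d" if "w \<in> T - R" for w
      using less.prems(2)[of w] card_mono[of "{u \<in> T. B u w}" "{u \<in> T - R. B u w}"] finT that by force
    ultimately obtain S where S: "S \<subseteq> T - R" "\<forall>u\<in>S. \<forall>v\<in>S. \<not> B u v" "card (T - R) \<le> card S * (2 * d + 1)"
      using less.hyps[of "T - R"] finT by blast
    have finS: "finite S" using S(1) finT finite_subset by blast
    have vS: "v \<notin> S" using S(1) by (auto simp: R_def)
    have "card T = card (T - R) + card R"
      using card_Diff_subset[of R T] RT finT finite_subset[OF RT finT] card_mono[OF finT RT] by simp
    also have "\<dots> \<le> card (insert v S) * (2 * d + 1)" using S(3) R vS finS by simp
    finally show ?thesis
      using S(1,2) v(1) assms(2) by (intro exI[of _ "insert v S"]) (auto simp: R_def)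
  qed auto
qed

lemma complete_minor_of_clique:
  assumes "finite S" "h \<le> card S" "S \<subseteq> V" "\<And>u v. u \<in> S \<Longrightarrow> v \<in> S \<Longrightarrow> u \<noteq> v \<Longrightarrow> (u, v) \<in> E"
  shows "complete_minor h V E"
proof -
  obtain S' where S': "S' \<subseteq> S" "card S' = h" "finite S'"
    using assms(2) by (rule obtain_subset_with_card_n)
  then obtain f where f: "bij_betw f {0..<h} S'" using ex_bij_betw_nat_finite by blast
  have "f i \<in> S" if "i < h" for i using f S'(1) that by (auto simp: bij_betw_def)
  moreover have "f i \<noteq> f j" if "i < h" "j < h" "i \<noteq> j" for i j
    using f that by (auto simp: bij_betw_def inj_on_def)
  ultimately show ?thesis
    unfolding complete_minor_def using assms(3,4) by (intro exI[of _ "\<lambda>i. {f i}"]) auto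
qed

section \<open>Out-degrees and paths of length two\<close>

definition outdeg :: "('a \<times> 'a) set \<Rightarrow> 'a \<Rightarrow> nat" where
  "outdeg E u = card (E `` {u})"

text \<open>In a semi-complete digraph, a vertex other than \<open>v\<close> that is no
  out-neighbour of \<open>v\<close> is an in-neighbour of \<open>v\<close>.\<close>

lemma out_diff_two_paths:
  assumes "semicomplete_rel V E" "v \<in> V"
  shows "E `` {u} - E `` {v} \<subseteq> insert v (two_paths E u v)"
proof
  fix w assume "w \<in> E `` {u} - E `` {v}"
  then show "w \<in> insert v (two_paths E u v)"
    using assms unfolding semicomplete_rel_def two_paths_def by auto
qed

lemma finite_out: "semicomplete_rel V E \<Longrightarrow> finite (E `` {u})"
  by (rule finite_subset[of _ V]) (auto simp: semicomplete_rel_def)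

lemma finite_two_paths: "semicomplete_rel V E \<Longrightarrow> finite (two_paths E u v)"
  by (rule finite_subset[of _ V]) (auto simp: semicomplete_rel_def two_paths_def)

lemma card_diff_le_two_paths:
  assumes "semicomplete_rel V E" "v \<in> V"
  shows "outdeg E u \<le> outdeg E v + Suc (card (two_paths E u v))"
proof -
  have "outdeg E u \<le> card (E `` {v} \<union> insert v (two_paths E u v))"
    unfolding outdeg_def
    by (rule card_mono) (use out_diff_two_paths[OF assms, of u] finite_out[OF assms(1)] finite_two_paths[OF assms(1)] in auto)
  also have "\<dots> \<le> outdeg E v + card (insert v (two_paths E u v))"
    unfolding outdeg_def by (rule card_Un_le)
  also have "card (insert v (two_paths E u v)) \<le> Suc (card (two_paths E u v))"
    by (simp add: card_insert_if finite_two_paths[OF assms(1)])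
  finally show ?thesis by simp
qed

text \<open>Two applications of \<open>large_independent_set\<close>. With in-degrees at most
  \<open>2 * link_bound h\<close> the factor is \<open>4 * link_bound h + 1\<close>, taken
  \<open>h\<close> times for a clique. That product bounds the in-degrees in the other application,
  which has to yield \<open>jungle_size h\<close> vertices.\<close>

definition tangle_bound :: "nat \<Rightarrow> nat" where
  "tangle_bound h = jungle_size h * (2 * ((4 * link_bound h + 1) * h) + 1)"

text \<open>
  If \<open>u\<close> has few paths of length two to its in-neighbour \<open>v\<close> and both have similar out-degrees, then
  they have nearly the same out-neighbours. So many such \<open>u\<close> for the same \<open>v\<close> span an almost complete
  digraph.
\<close>

lemma complete_minor_of_degree_tangle:
  assumes sem: "semicomplete_rel V E" and T: "T \<subseteq> V" "tangle_bound h \<le> card T"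
    and deg: "\<And>u. u \<in> T \<Longrightarrow> lo \<le> outdeg E u \<and> outdeg E u \<le> lo + link_bound h"
  shows "complete_minor h V E"
proof -
  let ?K = "link_bound h"
  define bad where "bad u v \<longleftrightarrow> u \<noteq> v \<and> (u, v) \<notin> E \<and> card (two_paths E u v) < ?K" for u v
  have finT: "finite T" using T(1) sem finite_subset by (auto simp: semicomplete_rel_def)
  show ?thesis
  proof (cases "\<exists>v\<in>T. (4 * ?K + 1) * h < card {u \<in> T. bad u v}")
    case True
    then obtain v where v: "v \<in> T" "(4 * ?K + 1) * h < card {u \<in> T. bad u v}" by blast
    let ?U = "{u \<in> T. bad u v}"
    have vU: "(v, u) \<in> E" if "u \<in> ?U" for u
      using that v(1) T(1) sem by (auto simp: bad_def semicomplete_rel_def)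
    \<comment> \<open>Few out-neighbours of \<open>u\<close> are missed by \<open>v\<close>. As the
      out-degrees differ by at most \<open>link_bound h\<close>, the difference in the other
      direction is small too.\<close>
    have diff: "card (E `` {v} - E `` {u}) \<le> 2 * ?K" if u: "u \<in> ?U" for u
    proof -
      have "v \<notin> E `` {u}" using u by (simp add: bad_def)
      then have "E `` {u} - E `` {v} \<subseteq> two_paths E u v"
        using out_diff_two_paths[OF sem, of v u] v(1) T(1) by blast
      then have "card (E `` {u} - E `` {v}) \<le> card (two_paths E u v)"
        by (rule card_mono[OF finite_two_paths[OF sem]])
      then have "card (E `` {u} - E `` {v}) \<le> ?K" using u by (simp add: bad_def)
      moreover have "outdeg E v = card (E `` {u} \<inter> E `` {v}) + card (E `` {v} - E `` {u})"
        "outdeg E u = card (E `` {u} \<inter> E `` {v}) + card (E `` {u} - E `` {v})"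
        using card_Int_Diff[OF finite_out[OF sem], of v "E `` {u}"]
          card_Int_Diff[OF finite_out[OF sem], of u "E `` {v}"]
        by (simp_all add: outdeg_def Int_commute)
      moreover have "outdeg E v \<le> outdeg E u + ?K" using deg[of v] deg[of u] v(1) u by simp
      ultimately show ?thesis by linarith
    qed
    have "\<exists>S\<subseteq>?U. (\<forall>u\<in>S. \<forall>w\<in>S. \<not> (u \<noteq> w \<and> (w, u) \<notin> E)) \<and> card ?U \<le> card S * (2 * (2 * ?K) + 1)"
    proof (rule large_independent_set)
      fix w assume w: "w \<in> ?U"
      \<comment> \<open>All members of \<open>?U\<close> are out-neighbours of \<open>v\<close>, so
        those that \<open>w\<close> misses are counted by the difference just bounded.\<close>
      have "{u \<in> ?U. u \<noteq> w \<and> (w, u) \<notin> E} \<subseteq> E `` {v} - E `` {w}" using vU by auto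
      then have "card {u \<in> ?U. u \<noteq> w \<and> (w, u) \<notin> E} \<le> card (E `` {v} - E `` {w})"
        by (rule card_mono[rotated]) (use finite_out[OF sem] in simp)
      then show "card {u \<in> ?U. u \<noteq> w \<and> (w, u) \<notin> E} \<le> 2 * ?K" using diff[OF w] by simp
    qed (use finT in auto)
    then obtain S where S: "S \<subseteq> ?U" "\<forall>u\<in>S. \<forall>w\<in>S. \<not> (u \<noteq> w \<and> (w, u) \<notin> E)"
      "card ?U \<le> card S * (4 * ?K + 1)" by auto
    have "h * (4 * ?K + 1) \<le> card S * (4 * ?K + 1)" using S(3) v(2) by (simp only: mult.commute)
    then have "h \<le> card S" unfolding mult_le_cancel2 by simp
    moreover have finS: "finite S" by (rule finite_subset[OF S(1)]) (use finT in simp)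
    ultimately show ?thesis
    proof (intro complete_minor_of_clique[OF finS])
      show "S \<subseteq> V" using S(1) T(1) by blast
      show "(u, w) \<in> E" if "u \<in> S" "w \<in> S" "u \<noteq> w" for u w using S(2) that by metis
    qed
  next
    case False
    let ?M = "(4 * ?K + 1) * h"
    have "\<exists>S\<subseteq>T. (\<forall>u\<in>S. \<forall>v\<in>S. \<not> bad u v) \<and> card T \<le> card S * (2 * ?M + 1)"
      by (rule large_independent_set) (use finT False in \<open>auto simp: bad_def not_less\<close>)
    then obtain S where S: "S \<subseteq> T" "\<And>u v. u \<in> S \<Longrightarrow> v \<in> S \<Longrightarrow> \<not> bad u v" "card T \<le> card S * (2 * ?M + 1)"
      by blast
    have "jungle_size h * (2 * ?M + 1) \<le> card S * (2 * ?M + 1)"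
      using S(3) T(2) unfolding tangle_bound_def by linarith
    then have "card (jungle_nodes h) \<le> card S" unfolding mult_le_cancel2 card_jungle_nodes by simp
    moreover have "finite S" using S(1) finT finite_subset by blast
    ultimately obtain f where f: "f ` jungle_nodes h \<subseteq> S" "inj_on f (jungle_nodes h)"
      using card_le_inj[OF card_jungle_nodes(1)] by blast
    show ?thesis
    \<comment> \<open>Nodes are single vertices here, with equal entry and exit.\<close>
    proof (rule complete_minor_of_jungle[OF sem, of h f f])
      fix p assume "p \<in> jungle_nodes h"
      then show "f p \<in> V \<and> f p \<in> V" using f(1) S(1) T(1) by blast
    next
      fix p q assume pq: "p \<in> jungle_nodes h" "q \<in> jungle_nodes h"
      then show "p \<noteq> q \<Longrightarrow> {f p, f p} \<inter> {f q, f q} = {}" using f(2) by (auto simp: inj_on_def)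
      show "?K \<le> card (two_paths E (f p) (f q))" if "f p \<noteq> f q" "(f p, f q) \<notin> E"
      proof -
        have "f p \<in> S" "f q \<in> S" using f(1) pq by auto
        then show ?thesis using S(2)[of "f p" "f q"] that by (simp add: bad_def)
      qed
    qed simp
  qed
qed

text \<open>Each matching edge is a node, entered at its end of small out-degree and left at that of
  large out-degree. The strict inequality makes up for the \<open>Suc\<close> in
  \<open>card_diff_le_two_paths\<close>.\<close>

lemma complete_minor_of_matching:
  assumes sem: "semicomplete_rel V E"
    and uv: "\<And>i. i < jungle_size h \<Longrightarrow> (u i, v i) \<in> E"
    and disj: "\<And>i j. i < jungle_size h \<Longrightarrow> j < jungle_size h \<Longrightarrow> i \<noteq> j \<Longrightarrow> {u i, v i} \<inter> {u j, v j} = {}"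
    and deg: "\<And>i j. i < jungle_size h \<Longrightarrow> j < jungle_size h \<Longrightarrow> outdeg E (u i) + link_bound h < outdeg E (v j)"
  shows "complete_minor h V E"
proof -
  obtain f where f: "f ` jungle_nodes h \<subseteq> {..<jungle_size h}" "inj_on f (jungle_nodes h)"
    using card_le_inj[OF card_jungle_nodes(1), of "{..<jungle_size h}" h] by (auto simp: card_jungle_nodes)
  have fI: "f p < jungle_size h" if "p \<in> jungle_nodes h" for p using f(1) that by auto
  have inV: "u i \<in> V" "v i \<in> V" if "i < jungle_size h" for i
    using uv[OF that] sem by (auto simp: semicomplete_rel_def)
  show ?thesis
  proof (rule complete_minor_of_jungle[OF sem, of h "\<lambda>p. u (f p)" "\<lambda>p. v (f p)"])
    fix p q assume pq: "p \<in> jungle_nodes h" "q \<in> jungle_nodes h"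
    show "{u (f p), v (f p)} \<inter> {u (f q), v (f q)} = {}" if "p \<noteq> q"
      using disj[OF fI[OF pq(1)] fI[OF pq(2)]] that f(2) pq by (auto simp: inj_on_def)
    show "link_bound h \<le> card (two_paths E (v (f p)) (u (f q)))"
      using card_diff_le_two_paths[OF sem inV(1)[OF fI[OF pq(2)]], of "v (f p)"]
        deg[OF fI[OF pq(2)] fI[OF pq(1)]] by simp
  qed (use fI uv inV in auto)
qed

section \<open>Bounded width without complete minors\<close>

definition low :: "'a set \<Rightarrow> ('a \<times> 'a) set \<Rightarrow> nat \<Rightarrow> 'a set" where
  "low V E a = {v \<in> V. outdeg E v < a}"

text \<open>The gap of \<open>link_bound h\<close> between low and high is what
  \<open>complete_minor_of_matching\<close> asks for.\<close>

definition high :: "nat \<Rightarrow> 'a set \<Rightarrow> ('a \<times> 'a) set \<Rightarrow> nat \<Rightarrow> 'a set" where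
  "high h V E a = {v \<in> V. a + link_bound h \<le> outdeg E v}"

text \<open>Fewer than \<open>jungle_size h\<close> vertices separate low from high along the edges
  between them; at most \<open>tangle_bound h\<close> vertices are neither, and they are added to
  both sides.\<close>

definition threshold_order :: "nat \<Rightarrow> nat" where
  "threshold_order h = jungle_size h + tangle_bound h"

definition threshold_separation :: "nat \<Rightarrow> 'a set \<Rightarrow> ('a \<times> 'a) set \<Rightarrow> nat \<Rightarrow> 'a set \<times> 'a set \<Rightarrow> bool" where
  "threshold_separation h V E a S \<longleftrightarrow> separation V E S \<and> low V E a \<subseteq> fst S \<and> high h V E a \<subseteq> snd S"

lemma card_degree_zone:
  assumes "semicomplete_rel V E" "\<not> complete_minor h V E"
  shows "card {v \<in> V. lo \<le> outdeg E v \<and> outdeg E v \<le> lo + link_bound h} \<le> tangle_bound h"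
proof (rule ccontr)
  assume "\<not> ?thesis"
  then have "complete_minor h V E"
    by (intro complete_minor_of_degree_tangle[OF assms(1), of "{v \<in> V. lo \<le> outdeg E v \<and> outdeg E v \<le> lo + link_bound h}"]) auto
  then show False using assms(2) by blast
qed

lemma threshold_separation_exists:
  assumes sem: "semicomplete_rel V E" and no: "\<not> complete_minor h V E"
  shows "\<exists>S. threshold_separation h V E a S \<and> sep_order S \<le> threshold_order h"
proof -
  let ?L = "low V E a" and ?R = "high h V E a"
  \<comment> \<open>Keeping only the edges from low to high vertices makes every path of a linkage
    contribute an edge to a matching.\<close>
  let ?F = "E \<inter> ?L \<times> ?R"
  let ?n = "jungle_size h"
  have V: "finite V" "E \<subseteq> V \<times> V" using sem by (auto simp: semicomplete_rel_def)
  have disj: "?L \<inter> ?R = {}" by (auto simp: low_def high_def)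
  have "\<exists>A B. separation V ?F (A, B) \<and> ?L \<subseteq> A \<and> ?R \<subseteq> B \<and> card (A \<inter> B) < ?n"
  proof (rule ccontr)
    assume none: "\<not> ?thesis"
    have "\<exists>P. linked ?F ?L ?R ?n P"
    proof (rule menger[OF V(1)])
      fix A B assume "separation V ?F (A, B)" "?L \<subseteq> A" "?R \<subseteq> B"
      then show "?n \<le> card (A \<inter> B)" using none not_le by blast
    qed (use V in \<open>auto simp: low_def high_def\<close>)
    then obtain P where P: "linked ?F ?L ?R ?n P" by blast
    have edge: "(P i ! 0, P i ! 1) \<in> ?F \<and> {P i ! 0, P i ! 1} \<subseteq> set (P i)" if i: "i < ?n" for i
    proof -
      have p: "P i \<noteq> []" "successively (\<lambda>u v. (u, v) \<in> ?F) (P i)" "hd (P i) \<in> ?L" "last (P i) \<in> ?R"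
        using P i by (auto simp: linked_def dpath_def)
      have "1 < length (P i)"
      proof (rule ccontr)
        assume "\<not> 1 < length (P i)"
        then have "length (P i) = 1" using p(1) by (cases "P i") auto
        then have "hd (P i) = last (P i)" using p(1) by (simp add: hd_conv_nth last_conv_nth)
        then show False using p(3,4) disj by auto
      qed
      moreover from this have "P i ! 0 \<in> set (P i)" "P i ! 1 \<in> set (P i)" by (auto intro: nth_mem)
      ultimately show ?thesis using p(2) by (auto simp: successively_conv_nth)
    qed
    have "complete_minor h V E"
    proof (rule complete_minor_of_matching[OF sem, of h "\<lambda>i. P i ! 0" "\<lambda>i. P i ! 1"])
      fix i j assume ij: "i < ?n" "j < ?n"
      show "outdeg E (P i ! 0) + link_bound h < outdeg E (P j ! 1)"
        using edge[OF ij(1)] edge[OF ij(2)] by (auto simp: low_def high_def)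
      show "{P i ! 0, P i ! 1} \<inter> {P j ! 0, P j ! 1} = {}" if "i \<noteq> j"
      proof -
        have "set (P i) \<inter> set (P j) = {}" using P ij that by (simp add: linked_def)
        then show ?thesis using edge[OF ij(1)] edge[OF ij(2)] by blast
      qed
    qed (use edge in auto)
    then show False using no by blast
  qed
  then obtain A B where AB: "separation V ?F (A, B)" "?L \<subseteq> A" "?R \<subseteq> B" "card (A \<inter> B) < ?n" by blast
  define M where "M = V - ?L - ?R"
  have "M \<subseteq> {v \<in> V. a \<le> outdeg E v \<and> outdeg E v \<le> a + link_bound h}"
    by (auto simp: M_def low_def high_def)
  then have "card M \<le> card {v \<in> V. a \<le> outdeg E v \<and> outdeg E v \<le> a + link_bound h}"
    by (rule card_mono[rotated]) (use V in simp)
  then have M: "card M \<le> tangle_bound h" using card_degree_zone[OF sem no, of a] by linarith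
  note s = separationD[OF AB(1)]
  \<comment> \<open>With the middle vertices in both sides, a crossing edge could only go from low
    to high, and such edges respect \<open>(A, B)\<close>.\<close>
  have "separation V E (A \<union> M, B \<union> M)"
  proof (rule separationI)
    show "A \<union> M \<union> (B \<union> M) = V" using s(1) by (auto simp: M_def)
    fix u v assume uv: "(u, v) \<in> E" "u \<in> A \<union> M" "u \<notin> B \<union> M" "v \<in> B \<union> M" "v \<notin> A \<union> M"
    then have "u \<in> ?L" "v \<in> ?R" using V(2) AB(2,3) by (auto simp: M_def)
    then have "(u, v) \<in> ?F" using uv by blast
    then show False using s(2)[of u v] uv by blast
  qed
  moreover have "sep_order (A \<union> M, B \<union> M) \<le> threshold_order h"
  proof -
    have "(A \<union> M) \<inter> (B \<union> M) = (A \<inter> B) \<union> M" by blast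
    then have "sep_order (A \<union> M, B \<union> M) \<le> card (A \<inter> B) + card M"
      using card_Un_le[of "A \<inter> B" M] by (simp add: sep_order_def)
    then show ?thesis using AB(4) M by (simp add: threshold_order_def)
  qed
  ultimately show ?thesis
    using AB(2,3) by (intro exI[of _ "(A \<union> M, B \<union> M)"]) (auto simp: threshold_separation_def)
qed

text \<open>Breaks ties between separations of equal order in favour of those low in
  \<open>sep_le\<close>: passing to a meet can only decrease it.\<close>

definition sep_size :: "'a set \<Rightarrow> 'a set \<times> 'a set \<Rightarrow> nat" where
  "sep_size V S = card (fst S) + card (V - snd S)"

definition extremal_separation :: "nat \<Rightarrow> 'a set \<Rightarrow> ('a \<times> 'a) set \<Rightarrow> nat \<Rightarrow> 'a set \<times> 'a set \<Rightarrow> bool" where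
  "extremal_separation h V E a S \<longleftrightarrow> threshold_separation h V E a S \<and>
     (\<forall>W. threshold_separation h V E a W \<longrightarrow> sep_order S \<le> sep_order W \<and>
        (sep_order W = sep_order S \<longrightarrow> sep_size V S \<le> sep_size V W))"

lemma extremal_separationD:
  assumes "extremal_separation h V E a S" "threshold_separation h V E a W"
  shows "sep_order S \<le> sep_order W" "sep_order W = sep_order S \<Longrightarrow> sep_size V S \<le> sep_size V W"
  using assms unfolding extremal_separation_def by blast+

lemma extremal_separation_exists:
  assumes "semicomplete_rel V E" "\<not> complete_minor h V E"
  shows "\<exists>S. extremal_separation h V E a S"
proof -
  let ?T = "threshold_separation h V E a"
  obtain S0 where "?T S0" using threshold_separation_exists[OF assms] by blast
  define S1 where "S1 = (ARG_MIN sep_order W. ?T W)"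
  have S1: "?T S1" "\<And>W. ?T W \<Longrightarrow> sep_order S1 \<le> sep_order W"
    unfolding S1_def using \<open>?T S0\<close> arg_min_natI[of ?T S0 sep_order] arg_min_nat_le[of ?T _ sep_order] by auto
  let ?Q = "\<lambda>W. ?T W \<and> sep_order W = sep_order S1"
  define S where "S = (ARG_MIN (sep_size V) W. ?Q W)"
  have S: "?Q S" "\<And>W. ?Q W \<Longrightarrow> sep_size V S \<le> sep_size V W"
    unfolding S_def using S1(1) arg_min_natI[of ?Q S1 "sep_size V"] arg_min_nat_le[of ?Q _ "sep_size V"] by auto
  show ?thesis
    unfolding extremal_separation_def using S S1(2) by (intro exI[of _ S]) auto
qed

text \<open>
  By submodularity, both minimal orders are attained by the meet and the join; the minimal size then
  forces the meet to be \<open>S\<close>.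
\<close>

lemma extremal_separations_nested:
  assumes V: "finite V" "E \<subseteq> V \<times> V" and "a \<le> b"
    and S: "extremal_separation h V E a S" and S': "extremal_separation h V E b S'"
  shows "sep_le S S'"
proof -
  have T: "separation V E S" "low V E a \<subseteq> fst S" "high h V E a \<subseteq> snd S"
    "separation V E S'" "low V E b \<subseteq> fst S'" "high h V E b \<subseteq> snd S'"
    using S S' by (auto simp: extremal_separation_def threshold_separation_def)
  have mono: "low V E a \<subseteq> low V E b" "high h V E b \<subseteq> high h V E a"
    using \<open>a \<le> b\<close> by (auto simp: low_def high_def)
  have "threshold_separation h V E a (sep_meet S S')"
    using T mono separation_meet[OF T(1,4) V(2)] by (auto simp: threshold_separation_def sep_meet_def)
  note m = extremal_separationD[OF S this]
  have "threshold_separation h V E b (sep_join S S')"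
    using T mono separation_join[OF T(1,4) V(2)] by (auto simp: threshold_separation_def sep_join_def)
  then have "sep_order S' \<le> sep_order (sep_join S S')"
    by (rule extremal_separationD[OF S'])
  moreover have fin: "finite (fst S)" "finite (fst S')" "finite (V - snd S)"
    using T V(1) separation_sub finite_subset by (metis finite_Diff)+
  ultimately have "sep_order (sep_meet S S') = sep_order S"
    using m(1) sep_order_submodular[OF fin(1,2)] by linarith
  then have le: "sep_size V S \<le> sep_size V (sep_meet S S')" by (rule m(2))
  have sub: "fst S \<inter> fst S' \<subseteq> fst S" "V - (snd S \<union> snd S') \<subseteq> V - snd S" by auto
  have cards: "card (fst S \<inter> fst S') \<le> card (fst S)" "card (V - (snd S \<union> snd S')) \<le> card (V - snd S)"
    using card_mono[OF fin(1) sub(1)] card_mono[OF fin(3) sub(2)] by auto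
  have "card (fst S \<inter> fst S') = card (fst S)" "card (V - (snd S \<union> snd S')) = card (V - snd S)"
    using le cards by (auto simp: sep_size_def sep_meet_def)
  then have "fst S \<inter> fst S' = fst S" "V - (snd S \<union> snd S') = V - snd S"
    using card_subset_eq[OF fin(1) sub(1)] card_subset_eq[OF fin(3) sub(2)] by auto
  then show ?thesis using separation_sub[OF T(4)] by (auto simp: sep_le_def)
qed

text \<open>A bag between neighbouring thresholds is covered by two adhesion sets and one zone of
  similar out-degrees.\<close>

definition width_bound :: "nat \<Rightarrow> nat" where
  "width_bound h = 2 * threshold_order h + tangle_bound h"

theorem bounded_width:
  assumes sem: "semicomplete_rel V E" and no: "\<not> complete_minor h V E"
  shows "sep_steps V E (width_bound h) ({}, V) (V, {})"
proof -
  let ?k = "width_bound h"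
  have V: "finite V" "E \<subseteq> V \<times> V" "irrefl E" using sem by (auto simp: semicomplete_rel_def)
  define C where "C a = (SOME S. extremal_separation h V E a S)" for a
  have C: "extremal_separation h V E a (C a)" for a
    unfolding C_def by (rule someI_ex, rule extremal_separation_exists[OF sem no])
  have T: "separation V E (C a)" "low V E a \<subseteq> fst (C a)" "high h V E a \<subseteq> snd (C a)" for a
    using C[of a] by (auto simp: extremal_separation_def threshold_separation_def)
  have ord: "card (fst (C a) \<inter> snd (C a)) \<le> threshold_order h" for a
  proof -
    obtain S where S: "threshold_separation h V E a S" "sep_order S \<le> threshold_order h"
      using threshold_separation_exists[OF sem no] by blast
    show ?thesis using extremal_separationD(1)[OF C S(1)] S(2) by (simp add: sep_order_def)
  qed
  have CV: "fst (C a) \<subseteq> V" "snd (C a) \<subseteq> V" "fst (C a) \<union> snd (C a) = V" for a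
    using T(1)[of a] by (auto simp: separation_def)
  have finC: "finite (fst (C a))" for a using CV(1) V(1) by (rule finite_subset)
  let ?Z = "\<lambda>lo. {v \<in> V. lo \<le> outdeg E v \<and> outdeg E v \<le> lo + link_bound h}"
  have Z: "card (?Z lo) \<le> tangle_bound h" for lo by (rule card_degree_zone[OF sem no])
  have triv: "separation V E ({}, V)" "separation V E (V, {})" by (auto simp: separation_def)
  have first: "sep_step V E ?k ({}, V) (C 0)"
  proof -
    have "fst (C 0) \<inter> V \<subseteq> (fst (C 0) \<inter> snd (C 0)) \<union> ?Z 0"
      using CV(1)[of 0] T(3)[of 0] by (auto simp: high_def)
    then have "card (fst (C 0) \<inter> V) \<le> card ((fst (C 0) \<inter> snd (C 0)) \<union> ?Z 0)"
      by (rule card_mono[rotated]) (use V(1) finC in simp)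
    also have "\<dots> \<le> card (fst (C 0) \<inter> snd (C 0)) + card (?Z 0)" by (rule card_Un_le)
    also have "\<dots> \<le> ?k" using ord[of 0] Z[of 0] by (simp add: width_bound_def)
    finally show ?thesis using triv T(1)[of 0] CV(2)[of 0] by (auto simp: sep_step_def sep_le_def)
  qed
  have mid: "sep_step V E ?k (C a) (C (Suc a))" for a
  proof -
    let ?S = "fst (C a) \<inter> snd (C a)" and ?S' = "fst (C (Suc a)) \<inter> snd (C (Suc a))"
    \<comment> \<open>Outside both adhesion sets, a vertex of the bag is not low for
      \<open>a\<close> and not high for \<open>Suc a\<close>, so its out-degree lies between
      \<open>a\<close> and \<open>a + link_bound h\<close>.\<close>
    have "fst (C (Suc a)) \<inter> snd (C a) \<subseteq> (?S \<union> ?S') \<union> ?Z a"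
      using CV(1)[of "Suc a"] T(2)[of a] T(3)[of "Suc a"] by (auto simp: high_def low_def)
    then have "card (fst (C (Suc a)) \<inter> snd (C a)) \<le> card ((?S \<union> ?S') \<union> ?Z a)"
      by (rule card_mono[rotated]) (use V(1) finC in simp)
    also have "\<dots> \<le> (card ?S + card ?S') + card (?Z a)"
      using card_Un_le[of "?S \<union> ?S'" "?Z a"] card_Un_le[of ?S ?S'] by linarith
    also have "\<dots> \<le> ?k" using ord[of a] ord[of "Suc a"] Z[of a] by (simp add: width_bound_def)
    finally show ?thesis
      using T(1) extremal_separations_nested[OF V(1,2) _ C C, of a "Suc a"] by (auto simp: sep_step_def)
  qed
  have deg: "outdeg E v < card V" if "v \<in> V" for v
  proof -
    have "E `` {v} \<subseteq> V - {v}" using V(2,3) by (auto simp: irrefl_def)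
    then have "outdeg E v \<le> card (V - {v})" unfolding outdeg_def by (rule card_mono[rotated]) (use V(1) in simp)
    then show ?thesis using card_Diff1_less[OF V(1) that] by simp
  qed
  have final: "sep_step V E ?k (C (card V)) (V, {})"
  proof -
    \<comment> \<open>Every out-degree is below \<open>card V\<close>, so at this threshold all
      vertices are low.\<close>
    have "fst (C (card V)) = V" using T(2)[of "card V"] deg CV(1)[of "card V"] by (auto simp: low_def)
    then show ?thesis
      using ord[of "card V"] triv T(1)[of "card V"] by (auto simp: sep_step_def sep_le_def width_bound_def)
  qed
  have "sep_steps V E ?k ({}, V) (C a)" for a
    by (induction a) (use first mid in \<open>auto intro: rtranclp.rtrancl_into_rtrancl\<close>)
  then show ?thesis using final by (rule rtranclp.rtrancl_into_rtrancl)
qed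

section \<open>Semi-complete digraphs\<close>

lemma semicomplete_rel_arcs_ends:
  assumes "semi_complete G"
  shows "semicomplete_rel (verts G) (arcs_ends G)"
proof -
  interpret digraph G using assms by (simp add: semi_complete_def)
  have "arcs_ends G \<subseteq> verts G \<times> verts G" using adj_in_verts by auto
  moreover have "irrefl (arcs_ends G)" using adj_not_same by (auto simp: irrefl_def)
  ultimately show ?thesis
    using assms unfolding semicomplete_rel_def semi_complete_def by simp
qed

section \<open>From vertex sets to minor mappings\<close>

lemma (in wf_digraph) strongly_connected_induce_subgraph:
  assumes "sconn (arcs_ends G) S"
  shows "strongly_connected (G \<restriction> S)"
proof
  show "verts (G \<restriction> S) \<noteq> {}" using assms by (simp add: sconn_def)
  interpret H: wf_digraph "G \<restriction> S" by blast
  fix u v assume uv: "u \<in> verts (G \<restriction> S)" "v \<in> verts (G \<restriction> S)"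
  then have "(u, v) \<in> (arcs_ends G \<inter> S \<times> S)\<^sup>*" using assms by (simp add: sconn_def)
  then show "u \<rightarrow>\<^sup>*\<^bsub>G \<restriction> S\<^esub> v"
  proof (induction rule: rtrancl_induct)
    case base
    then show ?case using uv(1) by simp
  next
    case (step y z)
    then have "y \<rightarrow>\<^bsub>G \<restriction> S\<^esub> z" by (auto simp: arcs_ends_conv)
    then show ?case using step.IH by (rule H.reachable_adj_trans[rotated])
  qed
qed

text \<open>The branch sets induce the subdigraphs of the mapping. A simple digraph asks for at most
  one edge per ordered pair of distinct vertices, and an edge between two disjoint branch sets lies
  in none of the induced subdigraphs.\<close>

lemma minorI:
  fixes H :: "('c, 'd) pre_digraph" and G :: "('a, 'b) pre_digraph"
  assumes "digraph H" "fin_digraph G"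
    and sub: "\<And>v. v \<in> verts H \<Longrightarrow> \<phi> v \<subseteq> verts G \<and> sconn (arcs_ends G) (\<phi> v)"
    and disj: "\<And>u v. u \<in> verts H \<Longrightarrow> v \<in> verts H \<Longrightarrow> u \<noteq> v \<Longrightarrow> \<phi> u \<inter> \<phi> v = {}"
    and edge: "\<And>u v. u \<in> verts H \<Longrightarrow> v \<in> verts H \<Longrightarrow> (u, v) \<in> arcs_ends H \<Longrightarrow>
       \<exists>x\<in>\<phi> u. \<exists>y\<in>\<phi> v. (x, y) \<in> arcs_ends G"
  shows "minor H G"
proof (rule minor_mapping_imp_minor)
  interpret H: digraph H by fact
  interpret G: fin_digraph G by fact
  show "fin_digraph H" using assms(1) by (simp add: digraph_def)
  show "fin_digraph G" by fact
  show "minor_mapping H G (\<lambda>v. G \<restriction> \<phi> v)"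
    unfolding minor_mapping_def
  proof (intro conjI ballI impI)
    fix v assume v: "v \<in> verts H"
    show "subgraph (G \<restriction> \<phi> v) G" using sub[OF v] by (intro G.subgraph_induce_subgraphI) blast
    show "strongly_connected (G \<restriction> \<phi> v)"
      using sub[OF v] by (intro G.strongly_connected_induce_subgraph) blast
  next
    fix u v assume "u \<in> verts H" "v \<in> verts H" "u \<noteq> v"
    then show "verts (G \<restriction> \<phi> u) \<inter> verts (G \<restriction> \<phi> v) = {}" using disj by simp
  next
    fix u v assume uv: "u \<in> verts H" "v \<in> verts H"
    let ?L = "{e \<in> arcs H. tail H e = u \<and> head H e = v}"
    let ?R = "{e \<in> arcs G. tail G e \<in> verts (G \<restriction> \<phi> u) \<and> head G e \<in> verts (G \<restriction> \<phi> v) \<and>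
                        (\<forall>x \<in> verts H. e \<notin> arcs (G \<restriction> \<phi> x))}"
    show "card ?L \<le> card ?R"
    proof (cases "?L = {}")
      case True
      show ?thesis unfolding True by simp
    next
      case False
      then obtain e where e: "e \<in> arcs H" "tail H e = u" "head H e = v" by blast
      have "?L \<subseteq> {e}"
      proof
        fix e' assume "e' \<in> ?L"
        then show "e' \<in> {e}" using H.no_multi_arcs[of e' e] e by (simp add: arc_to_ends_def)
      qed
      then have L: "card ?L \<le> 1" using card_mono[of "{e}" ?L] by simp
      have ne: "u \<noteq> v" using H.no_loops[OF e(1)] e by simp
      have "(u, v) \<in> arcs_ends H" using e by (auto simp: arcs_ends_conv)
      then obtain x y where xy: "x \<in> \<phi> u" "y \<in> \<phi> v" "(x, y) \<in> arcs_ends G" using edge[OF uv] by blast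
      then obtain g where g: "g \<in> arcs G" "tail G g = x" "head G g = y" by (auto simp: arcs_ends_conv)
      have "g \<notin> arcs (G \<restriction> \<phi> w)" if "w \<in> verts H" for w
      proof
        assume "g \<in> arcs (G \<restriction> \<phi> w)"
        then have "x \<in> \<phi> w" "y \<in> \<phi> w" using g by auto
        then have "w = u" "w = v" using disj[OF that uv(1)] disj[OF that uv(2)] xy by blast+
        then show False using ne by simp
      qed
      then have "g \<in> ?R" using g xy by simp
      then have "1 \<le> card ?R" using card_mono[of ?R "{g}"] by simp
      then show ?thesis using L by simp
    qed
  qed
qed

lemma minor_of_complete_minor:
  assumes "digraph H" "fin_digraph G" "complete_minor (card (verts H)) (verts G) (arcs_ends G)"
  shows "minor H G"
proof -
  interpret H: digraph H by fact
  obtain \<phi> where \<phi>: "\<And>i. i < card (verts H) \<Longrightarrow> \<phi> i \<subseteq> verts G \<and> sconn (arcs_ends G) (\<phi> i)"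
    "\<And>i j. i < card (verts H) \<Longrightarrow> j < card (verts H) \<Longrightarrow> i \<noteq> j \<Longrightarrow>
       \<phi> i \<inter> \<phi> j = {} \<and> (\<exists>x\<in>\<phi> i. \<exists>y\<in>\<phi> j. (x, y) \<in> arcs_ends G)"
    using assms(3) unfolding complete_minor_def by blast
  obtain f where "bij_betw f (verts H) {0..<card (verts H)}"
    using ex_bij_betw_finite_nat[OF H.finite_verts] by blast
  then have f: "\<And>v. v \<in> verts H \<Longrightarrow> f v < card (verts H)" "inj_on f (verts H)"
    by (auto simp: bij_betw_def)
  have ne: "f u \<noteq> f v" if "u \<in> verts H" "v \<in> verts H" "u \<noteq> v" for u v
    using f(2) that by (auto simp: inj_on_def)
  show ?thesis
  proof (rule minorI[OF assms(1,2), of "\<lambda>v. \<phi> (f v)"])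
    fix u v assume uv: "u \<in> verts H" "v \<in> verts H"
    show "\<phi> (f u) \<inter> \<phi> (f v) = {}" if "u \<noteq> v"
      using \<phi>(2)[OF f(1)[OF uv(1)] f(1)[OF uv(2)] ne[OF uv that]] by blast
    assume "(u, v) \<in> arcs_ends H"
    then have "u \<noteq> v" using H.adj_not_same by blast
    then show "\<exists>x\<in>\<phi> (f u). \<exists>y\<in>\<phi> (f v). (x, y) \<in> arcs_ends G"
      using \<phi>(2)[OF f(1)[OF uv(1)] f(1)[OF uv(2)] ne[OF uv]] by blast
  qed (use \<phi>(1) f(1) in blast)
qed

theorem mainTheorem1:
  fixes G :: "nat \<Rightarrow> ('a, 'b) pre_digraph"
  assumes "\<And>n. semi_complete (G n)"
  shows "\<exists>i j. i < j \<and> minor (G i) (G j)"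
proof (cases "\<exists>j>0. minor (G 0) (G j)")
  case True
  then show ?thesis by blast
next
  case False
  have dig: "digraph (G n)" for n using assms by (simp add: semi_complete_def)
  have fin: "fin_digraph (G n)" for n using dig[of n] by (simp add: digraph_def)
  let ?V = "\<lambda>n. verts (G (Suc n))" and ?E = "\<lambda>n. arcs_ends (G (Suc n))"
  let ?k = "width_bound (card (verts (G 0)))"
  have "(?V n, ?E n, [], []) \<in> pieces ?k 0" for n
  proof -
    have sem: "semicomplete_rel (?V n) (?E n)" by (rule semicomplete_rel_arcs_ends[OF assms])
    have "\<not> complete_minor (card (verts (G 0))) (?V n) (?E n)"
      using minor_of_complete_minor[OF dig fin] False by blast
    then have "sep_steps (?V n) (?E n) ?k ({}, ?V n) (?V n, {})" by (rule bounded_width[OF sem])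
    then have "level (?V n) (?E n) ?k 0 ({}, ?V n) (?V n, {})"
      by (simp add: level_def separation_def sep_order_def)
    \<comment> \<open>Both end separations have empty adhesion sets, hence the empty root lists, and
      the bag between them is the whole vertex set.\<close>
    from piecesI[OF sem this, of "[]" "[]"] show ?thesis by (simp add: bag_def)
  qed
  then obtain i j where "i < j" "piece_le (?V i, ?E i, [], []) (?V j, ?E j, [], [])"
    using af_onD[OF af_on_pieces[of 0 ?k], of "\<lambda>n. (?V n, ?E n, [], [])"] by blast
  then obtain \<phi> where \<phi>: "rooted_minor_map \<phi> (?V i) (?E i) [] [] (?V j) (?E j) [] []"
    unfolding piece_le_def rooted_minor_def by auto
  have "minor (G (Suc i)) (G (Suc j))"
    by (rule minorI[OF dig fin, of _ \<phi>]) (use \<phi> in \<open>auto simp: rooted_minor_map_def\<close>)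
  then show ?thesis using \<open>i < j\<close> by blast
qed

end
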